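(* Let $(X_t)_{t\ge 0}$ be a one-dimensional Lévy process with characteristic exponent $\Psi$, and assume that at least one of the following holds: (a) $X$ is recurrent and $\int_0^\infty \left|\frac{1}{q+\Psi(\lambda)}\right|d\lambda<\infty$ for every $q>0$; (b) $X$ is transient, $X$ is not a compound Poisson process, and $0$ is regular for itself. Let $n\ge 2$, let $a_1,\dots,a_n\in\mathbb{R}$ be distinct points, and put $A_n=\{a_1,\dots,a_n\}$. Let $M=(M_{k,l})_{k,l=1}^{n-1}$ be the $(n-1)\times(n-1)$ matrix with entries $$M_{k,l}=\mathbb{P}_{a_l}(T_{a_k}<T_{a_n}),\qquad k,l\in\{1,\dots,n-1\}$$ (so that $M_{k,k}=1$). Then $M$ is invertible and, for every $x\in\mathbb{R}$, $$\begin{pmatrix}\mathbb{P}_{x}(T_{a_1}=T_{A_{n}}<\infty)\\ \mathbb{P}_{x}(T_{a_2}=T_{A_{n}}<\infty)\\ \vdots\\ \mathbb{P}_{x}(T_{a_{n-1}}=T_{A_{n}}<\infty)\end{pmatrix}=M^{-1}\begin{pmatrix}\mathbb{P}_x(T_{a_1}<T_{a_n})\\ \mathbb{P}_x(T_{a_2}<T_{a_n})\\ \vdots\\ \mathbb{P}_x(T_{a_{n-1}}<T_{a_n})\end{pmatrix}.$$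
   Context: $\mathbb{P}_x$ denotes the law of the Lévy process $X$ started at $x\in\mathbb{R}$ (canonical representation, right-continuous paths), and $\Psi$ is defined by $\mathbb{P}_0[e^{i\lambda X_t}]=e^{-t\Psi(\lambda)}$ for $\lambda\in\mathbb{R}$, $t\ge0$, where $\mathbb{P}_x[\cdot]$ denotes expectation under $\mathbb{P}_x$. For $A\subset\mathbb{R}$, $T_A:=\inf\{t\ge 0;\ X_t\in A\}$ (with $\inf\emptyset=\infty$), and $T_a:=T_{\{a\}}$. "$0$ is regular for itself" means $\mathbb{P}_0(\inf\{t>0;\ X_t=0\}=0)=1$. *)

theory Defs
  imports
    "HOL-Probability.Probability"
    "Jordan_Normal_Form.Gauss_Jordan_Elimination"
begin

definition cadlag :: "(real \<Rightarrow> real) \<Rightarrow> bool" where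
  "cadlag w \<longleftrightarrow>
     (\<forall>t\<ge>0. (w \<longlongrightarrow> w t) (at_right t)) \<and>
     (\<forall>t>0. \<exists>l. (w \<longlongrightarrow> l) (at_left t))"

locale levy_process = prob_space P for P :: "'w measure" +
  fixes X :: "real \<Rightarrow> 'w \<Rightarrow> real"
  assumes measurable_X: "\<And>t. 0 \<le> t \<Longrightarrow> X t \<in> borel_measurable P"
    and cadlag_paths: "\<And>\<omega>. \<omega> \<in> space P \<Longrightarrow> cadlag (\<lambda>t. X t \<omega>)"
    and start_zero: "AE \<omega> in P. X 0 \<omega> = 0"
    and indep_increments:
      "\<And>n (t :: nat \<Rightarrow> real). 0 \<le> t 0 \<Longrightarrow> (\<And>i. i < n \<Longrightarrow> t i \<le> t (Suc i)) \<Longrightarrow>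
         indep_vars (\<lambda>_. borel) (\<lambda>i \<omega>. X (t (Suc i)) \<omega> - X (t i) \<omega>) {..<n}"
    and stationary_increments:
      "\<And>s t. 0 \<le> s \<Longrightarrow> 0 \<le> t \<Longrightarrow>
         distr P borel (\<lambda>\<omega>. X (s + t) \<omega> - X s \<omega>) = distr P borel (X t)"

text \<open>Paths are functions on \<open>[0, \<infinity>)\<close>, represented as extensional functions on the
  whole line; the \<open>\<sigma>\<close>-algebra is generated by the coordinate maps.\<close>

definition path_space :: "(real \<Rightarrow> real) measure" where
  "path_space = restrict_space (Pi\<^sub>M {0..} (\<lambda>_. borel)) {w. cadlag w}"

text \<open>The law \<open>\<P>\<^sub>x\<close> of the process started at \<open>x\<close>. It is completed because hitting
  times of points need not be measurable for the raw \<open>\<sigma>\<close>-algebra on the path space, and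
  \<^const>\<open>measure\<close> is \<open>0\<close> on non-measurable sets.\<close>

definition levy_law :: "'w measure \<Rightarrow> (real \<Rightarrow> 'w \<Rightarrow> real) \<Rightarrow> real \<Rightarrow> (real \<Rightarrow> real) measure" where
  "levy_law P X x = completion (distr P path_space (\<lambda>\<omega>. \<lambda>t\<in>{0..}. x + X t \<omega>))"

definition levy_prob ::
    "'w measure \<Rightarrow> (real \<Rightarrow> 'w \<Rightarrow> real) \<Rightarrow> real \<Rightarrow> ((real \<Rightarrow> real) \<Rightarrow> bool) \<Rightarrow> real" where
  "levy_prob P X x E = measure (levy_law P X x) {w \<in> space (levy_law P X x). E w}"

definition hit :: "real set \<Rightarrow> (real \<Rightarrow> real) \<Rightarrow> ereal" where
  "hit A w = (INF t\<in>{t. 0 \<le> t \<and> w t \<in> A}. ereal t)"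

definition characteristic_exponent ::
    "'w measure \<Rightarrow> (real \<Rightarrow> 'w \<Rightarrow> real) \<Rightarrow> (real \<Rightarrow> complex) \<Rightarrow> bool" where
  "characteristic_exponent P X \<Psi> \<longleftrightarrow>
     (\<forall>t\<ge>0. \<forall>\<xi>. (LINT w|levy_law P X 0. iexp (\<xi> * w t)) = exp (- (of_real t * \<Psi> \<xi>)))"

definition recurrent :: "'w measure \<Rightarrow> (real \<Rightarrow> 'w \<Rightarrow> real) \<Rightarrow> bool" where
  "recurrent P X \<longleftrightarrow> (AE w in levy_law P X 0. Liminf at_top (\<lambda>t. ereal \<bar>w t\<bar>) = 0)"

definition transient :: "'w measure \<Rightarrow> (real \<Rightarrow> 'w \<Rightarrow> real) \<Rightarrow> bool" where
  "transient P X \<longleftrightarrow> (AE w in levy_law P X 0. filterlim (\<lambda>t. \<bar>w t\<bar>) at_top at_top)"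

text \<open>Here \<open>c\<close> is the jump rate and \<open>\<sigma>\<close> the jump distribution.\<close>

definition compound_poisson :: "'w measure \<Rightarrow> (real \<Rightarrow> 'w \<Rightarrow> real) \<Rightarrow> bool" where
  "compound_poisson P X \<longleftrightarrow>
     (\<exists>c \<sigma>. 0 < c \<and> real_distribution \<sigma> \<and> measure \<sigma> {0} = 0 \<and>
        (\<forall>t\<ge>0. \<forall>\<xi>. (LINT w|levy_law P X 0. iexp (\<xi> * w t)) =
           exp (of_real (t * c) * (char \<sigma> \<xi> - 1))))"

definition regular_for_itself :: "'w measure \<Rightarrow> (real \<Rightarrow> 'w \<Rightarrow> real) \<Rightarrow> bool" where
  "regular_for_itself P X \<longleftrightarrow>
     levy_prob P X 0 (\<lambda>w. (INF t\<in>{t. 0 < t \<and> w t = 0}. ereal t) = 0) = 1"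

text \<open>Matrices and vectors are indexed from \<open>0\<close>, whereas the points are
  \<open>a 1, \<dots>, a n\<close>; hence the successors below.\<close>

definition hitting_matrix ::
    "'w measure \<Rightarrow> (real \<Rightarrow> 'w \<Rightarrow> real) \<Rightarrow> nat \<Rightarrow> (nat \<Rightarrow> real) \<Rightarrow> real mat" where
  "hitting_matrix P X n a =
     Matrix.mat (n - 1) (n - 1)
       (\<lambda>(k, l). levy_prob P X (a (Suc l)) (\<lambda>w. hit {a (Suc k)} w < hit {a n} w))"

end

theory Submission
  imports
    Defs
    "Jordan_Normal_Form.Determinant"
begin

text \<open>
  Let \<open>h\<^sub>b(x)\<close> be the probability, starting from \<open>x\<close>, of hitting \<open>b\<close> before the last point \<open>c\<close>, and
  let \<open>B\<close> be a finite set containing \<open>b\<close> and \<open>c\<close>. The strong Markov property at the hitting time of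
  \<open>B\<close> gives \<open>h\<^sub>b(x) = \<Sum>y\<in>B. Q\<^sub>B(x, y) h\<^sub>b(y)\<close>, where \<open>Q\<^sub>B(x, y)\<close> is the probability that \<open>B\<close> is first hit
  at \<open>y\<close>. For \<open>B = A\<^sub>n\<close> this is the claimed linear system, as \<open>h\<^sub>b(c) = 0\<close>.

  If a combination of the rows of \<open>M\<close> vanishes, the same identity for \<open>B = A\<^sub>n - {x}\<close> shows that the
  coefficient of row \<open>x\<close> is killed by the probability \<open>1 - \<Sum>y\<in>B. Q\<^sub>B(x, y) h\<^sub>x(y)\<close> of not returning to \<open>x\<close>
  through \<open>B\<close> before \<open>c\<close>. Were it \<open>0\<close>, the process would return to \<open>x\<close> again and again without ever
  meeting \<open>c\<close>, so it would be neither transient nor able to reach \<open>c\<close>. In case (a) it does reach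
  \<open>c\<close> with positive probability: \<open>1 / (1 + \<Psi>)\<close> is the integrable Fourier transform of the
  \<open>1\<close>-potential measure, which therefore has a continuous density, positive at \<open>0\<close>. So nearby
  points are hit with positive probability, and distant ones in several steps.
\<close>

subsection \<open>The path space\<close>

text \<open>Hitting times of points need not be measurable on the raw path space, so the arguments
  run on \<open>reg_hit\<close>, the limit of the hitting times of shrinking open neighbourhoods. It
  is an optional time and equals \<open>hit\<close> almost surely. Since optional times look
  infinitesimally ahead, the strong Markov property is obtained from time grids lying strictly above
  them. Sure return is refuted without iterating return times. Let F t be the probability of having,
  by time t, met c or left a large interval for good. Sure return gives F (t + d) \<le> p * F (t +
  d) + F t, where p < 1 is the chance of reaching B before time d. Hence F = 0 propagates from
  negative t to all t. Potential mass around y only detects neighbourhoods of y. To reach the point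
  itself, a Gaussian kernel concentrating at y is used: its potential is bounded by a constant that
  does not depend on the neighbourhood, so all neighbourhoods are hit before one fixed time with
  probability bounded below.\<close>

type_synonym path = "real \<Rightarrow> real"

abbreviation paths :: "path set" where
  "paths \<equiv> space path_space"

lemma cadlag_cong:
  assumes "\<And>t. 0 \<le> t \<Longrightarrow> w t = v t" "cadlag w"
  shows "cadlag v"
  unfolding cadlag_def
proof (intro conjI allI impI)
  fix t :: real assume t: "0 \<le> t"
  have "eventually (\<lambda>s. w s = v s) (at_right t)"
    using eventually_at_right_less[of t] by eventually_elim (use t assms(1) in auto)
  moreover have "(w \<longlongrightarrow> w t) (at_right t)"
    using assms(2) t by (auto simp: cadlag_def)
  ultimately show "(v \<longlongrightarrow> v t) (at_right t)"
    using assms(1)[OF t] by (simp add: tendsto_cong)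
next
  fix t :: real assume t: "0 < t"
  then have "eventually (\<lambda>s. w s = v s) (at_left t)"
    using eventually_at_left[of 0 t] assms(1) less_imp_le by blast
  moreover obtain l where "(w \<longlongrightarrow> l) (at_left t)"
    using assms(2) t by (auto simp: cadlag_def)
  ultimately show "\<exists>l. (v \<longlongrightarrow> l) (at_left t)"
    by (auto simp: tendsto_cong)
qed

lemma cadlag_restrict [simp]: "cadlag (restrict w {0..}) \<longleftrightarrow> cadlag w"
  using cadlag_cong[of w "restrict w {0..}"] cadlag_cong[of "restrict w {0..}" w] by auto

lemma cadlag_add_const:
  assumes "cadlag w" shows "cadlag (\<lambda>t. c + w t)"
  unfolding cadlag_def
proof (intro conjI allI impI)
  fix t :: real assume "0 \<le> t"
  then show "((\<lambda>t. c + w t) \<longlongrightarrow> c + w t) (at_right t)"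
    using assms by (intro tendsto_add tendsto_const) (auto simp: cadlag_def)
next
  fix t :: real assume "0 < t"
  then obtain l where "(w \<longlongrightarrow> l) (at_left t)"
    using assms by (auto simp: cadlag_def)
  then show "\<exists>l. ((\<lambda>t. c + w t) \<longlongrightarrow> l) (at_left t)"
    by (intro exI[of _ "c + l"] tendsto_add tendsto_const)
qed

lemma cadlag_diff_const:
  assumes "cadlag w" shows "cadlag (\<lambda>t. w t - c)"
  using cadlag_add_const[OF assms, of "- c"] by simp

lemma cadlag_right:
  assumes "cadlag w" "0 \<le> t" shows "(w \<longlongrightarrow> w t) (at_right t)"
  using assms by (auto simp: cadlag_def)

lemma cadlag_left:
  assumes "cadlag w" "0 < t" obtains l where "(w \<longlongrightarrow> l) (at_left t)"
  using assms by (auto simp: cadlag_def)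

lemma cadlag_shift:
  assumes "cadlag w" "0 \<le> s" shows "cadlag (\<lambda>t. w (s + t))"
  unfolding cadlag_def
proof (intro conjI allI impI)
  fix t :: real assume "0 \<le> t"
  then show "((\<lambda>t. w (s + t)) \<longlongrightarrow> w (s + t)) (at_right t)"
    using cadlag_right[OF assms(1), of "s + t"] assms(2)
    by (simp add: filterlim_at_right_to_0[of _ _ "s + t"] filterlim_at_right_to_0[of _ _ t] ac_simps)
next
  fix t :: real assume "0 < t"
  then obtain l where "(w \<longlongrightarrow> l) (at_left (s + t))"
    using cadlag_left[OF assms(1), of "s + t"] assms(2) by auto
  moreover have "filterlim (\<lambda>t. s + t) (at_left (s + t)) (at_left t)"
    unfolding filterlim_at
    by (auto intro!: tendsto_intros simp: eventually_at_filter)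
  ultimately show "\<exists>l. ((\<lambda>t. w (s + t)) \<longlongrightarrow> l) (at_left t)"
    using filterlim_compose by blast
qed

lemma space_path_space: "paths = {w \<in> extensional {0..}. cadlag w}"
  by (auto simp: path_space_def space_restrict_space space_PiM PiE_def)

lemma path_cadlag: "w \<in> paths \<Longrightarrow> cadlag w"
  by (simp add: space_path_space)

lemma path_extensional: "w \<in> paths \<Longrightarrow> w \<in> extensional {0..}"
  by (simp add: space_path_space)

lemma measurable_coordinate: "(\<lambda>w. w t) \<in> borel_measurable path_space"
proof (cases "0 \<le> t")
  case True
  show ?thesis
    unfolding path_space_def by (rule measurable_restrict_space1, rule measurable_component_singleton) (simp add: True)
next
  case False
  \<comment> \<open>At negative times every path has the default value \<open>undefined\<close>, so
    the coordinate is constant.\<close>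
  then show ?thesis
    by (intro measurable_cong[THEN iffD2, OF _ measurable_const[of undefined]])
      (auto simp: space_path_space extensional_def)
qed

lemma measurable_path:
  assumes "\<And>\<omega>. \<omega> \<in> space M \<Longrightarrow> cadlag (f \<omega>)" "\<And>\<omega>. \<omega> \<in> space M \<Longrightarrow> f \<omega> \<in> extensional {0..}"
    and "\<And>t. 0 \<le> t \<Longrightarrow> (\<lambda>\<omega>. f \<omega> t) \<in> borel_measurable M"
  shows "f \<in> M \<rightarrow>\<^sub>M path_space"
  unfolding path_space_def
proof (rule measurable_restrict_space2)
  show "f \<in> space M \<rightarrow> {w. cadlag w}"
    using assms(1) by auto
  have "(\<lambda>\<omega> t. f \<omega> t) \<in> M \<rightarrow>\<^sub>M Pi\<^sub>M {0..} (\<lambda>_. borel)"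
    by (rule measurable_PiM_single') (use assms in \<open>auto simp: PiE_def\<close>)
  then show "f \<in> M \<rightarrow>\<^sub>M Pi\<^sub>M {0..} (\<lambda>_. borel)" by simp
qed

lemma measurable_path_restrict:
  assumes "\<And>\<omega>. \<omega> \<in> space M \<Longrightarrow> cadlag (f \<omega>)"
    and "\<And>t. 0 \<le> t \<Longrightarrow> (\<lambda>\<omega>. f \<omega> t) \<in> borel_measurable M"
  shows "(\<lambda>\<omega>. \<lambda>t\<in>{0..}. f \<omega> t) \<in> M \<rightarrow>\<^sub>M path_space"
  by (rule measurable_path) (use assms in auto)

lemma measurable_translate: "(\<lambda>w. \<lambda>t\<in>{0..}. c + w t) \<in> path_space \<rightarrow>\<^sub>M path_space"
  by (rule measurable_path_restrict)
    (auto intro: cadlag_add_const path_cadlag borel_measurable_add measurable_coordinate)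

text \<open>Closed lower orthants of finitely many coordinates: an intersection-stable generator on
  which measures are compared. The closed bounds let limits of paths remain inside a box.\<close>

definition lower_box :: "real set \<Rightarrow> path \<Rightarrow> path set" where
  "lower_box J c = {w \<in> paths. \<forall>t\<in>J. w t \<le> c t}"

lemma sets_lower_box [measurable]: "finite J \<Longrightarrow> lower_box J c \<in> sets path_space"
  unfolding lower_box_def
  by (intro sets.sets_Collect_finite_All borel_measurable_le measurable_coordinate borel_measurable_const)

text \<open>The information carried by the times in \<open>I\<close>;
  \<open>coord_algebra {0..t}\<close> plays the role of the natural filtration. The underlying set
  is always \<open>paths\<close>, so these sigma-algebras are directly comparable for different
  \<open>I\<close>.\<close>

definition coord_algebra :: "real set \<Rightarrow> path measure" where
  "coord_algebra I = sigma paths {lower_box J c |J c. finite J \<and> J \<subseteq> I}"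

lemma space_coord_algebra [simp]: "space (coord_algebra I) = paths"
  unfolding coord_algebra_def by (rule space_measure_of) (auto simp: lower_box_def)

lemma sets_coord_algebra:
  "sets (coord_algebra I) = sigma_sets paths {lower_box J c |J c. finite J \<and> J \<subseteq> I}"
  unfolding coord_algebra_def by (rule sets_measure_of) (auto simp: lower_box_def)

lemma Int_stable_boxes: "Int_stable {lower_box J c |J c. finite J \<and> J \<subseteq> I}"
proof (rule Int_stableI)
  fix A B assume "A \<in> {lower_box J c |J c. finite J \<and> J \<subseteq> I}" "B \<in> {lower_box J c |J c. finite J \<and> J \<subseteq> I}"
  then obtain J c K d where AB: "A = lower_box J c" "B = lower_box K d"
      and "finite J" "finite K" "J \<subseteq> I" "K \<subseteq> I"
    by blast
  moreover have "lower_box J c \<inter> lower_box K d =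
      lower_box (J \<union> K) (\<lambda>t. if t \<in> J \<and> t \<in> K then min (c t) (d t) else if t \<in> J then c t else d t)"
    unfolding lower_box_def by (simp add: set_eq_iff Ball_def) (smt (verit))
  ultimately show "A \<inter> B \<in> {lower_box J c |J c. finite J \<and> J \<subseteq> I}"
    unfolding AB by blast
qed

lemma measurable_coord_algebra:
  assumes "t \<in> I"
  shows "(\<lambda>w. w t) \<in> borel_measurable (coord_algebra I)"
proof (subst borel_measurable_iff_le, intro allI)
  fix a
  have "{w \<in> space (coord_algebra I). w t \<le> a} = lower_box {t} (\<lambda>_. a)"
    by (auto simp: lower_box_def)
  then show "{w \<in> space (coord_algebra I). w t \<le> a} \<in> sets (coord_algebra I)"
    unfolding sets_coord_algebra using assms by (auto intro!: sigma_sets.Basic)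
qed

lemma sets_coord_algebra_le: "sets (coord_algebra I) \<subseteq> sets path_space"
  unfolding sets_coord_algebra by (rule sets.sigma_sets_subset) auto

lemma sets_coord_algebra_mono:
  assumes "I \<subseteq> K" shows "sets (coord_algebra I) \<subseteq> sets (coord_algebra K)"
  unfolding sets_coord_algebra by (rule sigma_sets_mono') (use assms in blast)

lemma sets_path_space: "sets path_space = sets (coord_algebra {0..})"
proof
  have id: "(\<lambda>w. w) \<in> coord_algebra {0..} \<rightarrow>\<^sub>M path_space"
    by (rule measurable_path) (auto simp: space_path_space measurable_coord_algebra)
  show "sets path_space \<subseteq> sets (coord_algebra {0..})"
  proof
    fix A assume A: "A \<in> sets path_space"
    then have "(\<lambda>w. w) -` A \<inter> space (coord_algebra {0..}) = A"
      using sets.sets_into_space by fastforce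
    then show "A \<in> sets (coord_algebra {0..})"
      using measurable_sets[OF id A] by simp
  qed
qed (rule sets_coord_algebra_le)

text \<open>Uniqueness of finite measures on an intersection-stable generator. Both measures may
  live on larger sigma-algebras and are first restricted; the box without constraints is the whole
  space and serves as exhausting sequence.\<close>

lemma emeasure_eq_on_coord_algebra:
  assumes M: "sets path_space \<subseteq> sets M" and N: "sets path_space \<subseteq> sets N"
    and sp: "space M = paths" "space N = paths"
    and fin: "emeasure M (space M) \<noteq> \<infinity>"
    and eq: "\<And>J c. finite J \<Longrightarrow> J \<subseteq> I \<Longrightarrow> emeasure M (lower_box J c) = emeasure N (lower_box J c)"
    and A: "A \<in> sets (coord_algebra I)"
  shows "emeasure M A = emeasure N A"
proof -
  have sub: "sets (coord_algebra I) \<subseteq> sets M" "sets (coord_algebra I) \<subseteq> sets N"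
    using order_trans[OF sets_coord_algebra_le M] order_trans[OF sets_coord_algebra_le N] by simp_all
  let ?M = "restr_to_subalg M (coord_algebra I)" and ?N = "restr_to_subalg N (coord_algebra I)"
  have subM: "subalgebra M (coord_algebra I)" and subN: "subalgebra N (coord_algebra I)"
    using sub sp by (auto simp: subalgebra_def)
  have lower_box: "lower_box J c \<in> sets (coord_algebra I)" if "finite J" "J \<subseteq> I" for J c
    unfolding sets_coord_algebra using that by (auto intro!: sigma_sets.Basic)
  have "?M = ?N"
  proof (rule measure_eqI_generator_eq[OF Int_stable_boxes, of I "paths" _ _ "\<lambda>_. lower_box {} (\<lambda>_. 0)"])
    show "{lower_box J c |J c. finite J \<and> J \<subseteq> I} \<subseteq> Pow paths"
      by (auto simp: lower_box_def)
    show "range (\<lambda>_. lower_box {} (\<lambda>_. 0)) \<subseteq> {lower_box J c |J c. finite J \<and> J \<subseteq> I}"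
      by auto
    show "(\<Union>i::nat. lower_box {} (\<lambda>_. 0)) = paths"
      by (auto simp: lower_box_def)
    show "emeasure ?M (lower_box {} (\<lambda>_. 0)) \<noteq> \<infinity>" for i :: nat
      using lower_box[of "{}"] fin sp by (simp add: emeasure_restr_to_subalg[OF subM]) (simp add: lower_box_def)
    show "emeasure ?M X = emeasure ?N X" if "X \<in> {lower_box J c |J c. finite J \<and> J \<subseteq> I}" for X
      using that eq lower_box by (auto simp: emeasure_restr_to_subalg[OF subM] emeasure_restr_to_subalg[OF subN])
    show "sets ?M = sigma_sets paths {lower_box J c |J c. finite J \<and> J \<subseteq> I}"
      by (simp add: sets_restr_to_subalg[OF subM] sets_coord_algebra)
    show "sets ?N = sigma_sets paths {lower_box J c |J c. finite J \<and> J \<subseteq> I}"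
      by (simp add: sets_restr_to_subalg[OF subN] sets_coord_algebra)
  qed
  then show ?thesis
    using emeasure_restr_to_subalg[OF subM A] emeasure_restr_to_subalg[OF subN A] by simp
qed

text \<open>The path after \<open>s\<close>, re-centred at 0. Its law is \<open>law 0\<close>
  whatever the position at \<open>s\<close>, and it is independent of the past, so the Markov
  properties are proved for it and transferred to \<open>shift\<close> later.\<close>

definition incr :: "real \<Rightarrow> path \<Rightarrow> real \<Rightarrow> real" where
  "incr s w = (\<lambda>t\<in>{0..}. w (s + t) - w s)"

lemma incr_path: "w \<in> paths \<Longrightarrow> 0 \<le> s \<Longrightarrow> incr s w \<in> paths"
  using cadlag_diff_const[OF cadlag_shift, of w s "w s"]
  by (simp add: space_path_space incr_def)

lemma measurable_incr:
  assumes "0 \<le> s" shows "incr s \<in> path_space \<rightarrow>\<^sub>M path_space"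
proof (rule measurable_path)
  show "(\<lambda>w. incr s w t) \<in> borel_measurable path_space" if "0 \<le> t" for t
    using that by (simp add: incr_def borel_measurable_diff measurable_coordinate)
qed (use assms in \<open>auto simp: incr_def space_path_space intro!: cadlag_diff_const cadlag_shift\<close>)

subsection \<open>The simple Markov property\<close>

lemma sets_Collect_sum_le:
  fixes c :: "'a \<Rightarrow> real"
  assumes "finite R" "\<And>q. q \<in> R \<Longrightarrow> S q \<subseteq> I"
  shows "{v\<in>space (PiM I (\<lambda>_. borel)). \<forall>q\<in>R. (\<Sum>i\<in>S q. v i) \<le> c q} \<in> sets (PiM I (\<lambda>_. borel))"
proof (rule sets.sets_Collect_finite_All[OF _ assms(1)])
  fix q assume q: "q \<in> R"
  have "(\<lambda>v. v i) \<in> borel_measurable (PiM I (\<lambda>_. borel :: real measure))" if "i \<in> S q" for i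
    by (rule measurable_component_singleton) (use assms(2)[OF q] that in auto)
  then have "(\<lambda>v. \<Sum>i\<in>S q. v i) \<in> borel_measurable (PiM I (\<lambda>_. borel :: real measure))"
    using borel_measurable_sum[of "S q" "\<lambda>i v. v i"] by fast
  then show "{v\<in>space (PiM I (\<lambda>_. borel)). (\<Sum>i\<in>S q. v i) \<le> c q} \<in> sets (PiM I (\<lambda>_. borel))"
    by (rule borel_measurable_le) simp
qed

context levy_process
begin

definition law :: "real \<Rightarrow> path measure" where
  "law x = distr P path_space (\<lambda>\<omega>. \<lambda>t\<in>{0..}. x + X t \<omega>)"

abbreviation Pr :: "real \<Rightarrow> path set \<Rightarrow> real" where
  "Pr x \<equiv> measure (law x)"

abbreviation ePr :: "real \<Rightarrow> path set \<Rightarrow> ennreal" where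
  "ePr x \<equiv> emeasure (law x)"

lemma levy_law_eq: "levy_law P X x = completion (law x)"
  by (simp add: levy_law_def law_def)

lemma measurable_levy_path [measurable]: "(\<lambda>\<omega>. \<lambda>t\<in>{0..}. x + X t \<omega>) \<in> P \<rightarrow>\<^sub>M path_space"
  by (rule measurable_path_restrict) (auto intro!: cadlag_add_const cadlag_paths borel_measurable_add measurable_X)

lemma sets_law [simp, measurable_cong]: "sets (law x) = sets path_space"
  by (simp add: law_def)

lemma space_law [simp]: "space (law x) = paths"
  by (simp add: law_def)

lemma prob_space_law: "prob_space (law x)"
  unfolding law_def by (rule prob_space_distr) measurable

sublocale law: prob_space "law x" for x
  by (rule prob_space_law)

text \<open>Independence and stationarity combined: both vectors are distributed as the product of
  the laws of \<open>X\<close> at the step lengths, so only these lengths matter.\<close>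

lemma distr_increments_cong:
  fixes t t' :: "nat \<Rightarrow> real"
  assumes "0 \<le> t 0" "\<And>i. i < n \<Longrightarrow> t i \<le> t (Suc i)" "0 \<le> t' 0" "\<And>i. i < n \<Longrightarrow> t' i \<le> t' (Suc i)"
    and eq: "\<And>i. i < n \<Longrightarrow> t (Suc i) - t i = t' (Suc i) - t' i"
  shows "distr P (PiM {..<n} (\<lambda>_. borel)) (\<lambda>\<omega>. \<lambda>i\<in>{..<n}. X (t (Suc i)) \<omega> - X (t i) \<omega>) =
    distr P (PiM {..<n} (\<lambda>_. borel)) (\<lambda>\<omega>. \<lambda>i\<in>{..<n}. X (t' (Suc i)) \<omega> - X (t' i) \<omega>)"
proof (cases "n = 0")
  case False
  have *: "distr P (PiM {..<n} (\<lambda>_. borel)) (\<lambda>\<omega>. \<lambda>i\<in>{..<n}. X (t (Suc i)) \<omega> - X (t i) \<omega>) =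
      PiM {..<n} (\<lambda>i. distr P borel (X (t (Suc i) - t i)))"
    if t: "0 \<le> t 0" "\<And>i. i < n \<Longrightarrow> t i \<le> t (Suc i)" for t :: "nat \<Rightarrow> real"
  proof -
    have pos: "0 \<le> t i" if "i \<le> n" for i
      using that by (induction i) (use t in \<open>auto intro: order_trans\<close>)
    have "indep_vars (\<lambda>_. borel) (\<lambda>i \<omega>. X (t (Suc i)) \<omega> - X (t i) \<omega>) {..<n}"
      using indep_increments t by blast
    then have "distr P (PiM {..<n} (\<lambda>_. borel)) (\<lambda>\<omega>. \<lambda>i\<in>{..<n}. X (t (Suc i)) \<omega> - X (t i) \<omega>) =
        PiM {..<n} (\<lambda>i. distr P borel (\<lambda>\<omega>. X (t (Suc i)) \<omega> - X (t i) \<omega>))"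
      by (subst indep_vars_iff_distr_eq_PiM'[symmetric])
        (use False pos in \<open>auto intro!: borel_measurable_diff measurable_X\<close>)
    also have "\<dots> = PiM {..<n} (\<lambda>i. distr P borel (X (t (Suc i) - t i)))"
    proof (rule PiM_cong[OF refl])
      fix i assume "i \<in> {..<n}"
      then show "distr P borel (\<lambda>\<omega>. X (t (Suc i)) \<omega> - X (t i) \<omega>) = distr P borel (X (t (Suc i) - t i))"
        using stationary_increments[of "t i" "t (Suc i) - t i"] t pos[of i] by simp
    qed
    finally show ?thesis .
  qed
  show ?thesis
    unfolding *[OF assms(1,2), simplified] *[OF assms(3,4), simplified]
    by (rule PiM_cong) (use eq in auto)
qed (simp add: restrict_def)

text \<open>Index \<open>p\<close> separates past from future. The events depend on partial sums of
  two disjoint blocks of increments, which are independent; the future block is then re-timed to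
  start at 0. Differences to \<open>X 0\<close> are kept because \<open>X 0\<close> vanishes only
  almost surely.\<close>

lemma prob_increments_boxes_indexed:
  fixes t :: "nat \<Rightarrow> real"
  assumes t: "t 0 = 0" "\<And>i. i < n \<Longrightarrow> t i \<le> t (Suc i)" and p: "p \<le> n"
    and R: "R \<subseteq> {..p}" and Q: "Q \<subseteq> {..n - p}"
  shows "prob {\<omega>\<in>space P. (\<forall>q\<in>R. X (t q) \<omega> - X 0 \<omega> \<le> c q) \<and> (\<forall>q\<in>Q. X (t (p + q)) \<omega> - X (t p) \<omega> \<le> d q)} =
    prob {\<omega>\<in>space P. \<forall>q\<in>R. X (t q) \<omega> - X 0 \<omega> \<le> c q} *
    prob {\<omega>\<in>space P. \<forall>q\<in>Q. X (t (p + q) - t p) \<omega> - X 0 \<omega> \<le> d q}"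
proof -
  define D where "D i \<omega> = X (t (Suc i)) \<omega> - X (t i) \<omega>" for i \<omega>
  have D_sum: "(\<Sum>i=a..<b. D i \<omega>) = X (t b) \<omega> - X (t a) \<omega>" if "a \<le> b" for a b \<omega>
    unfolding D_def using sum_Suc_diff'[OF that, of "\<lambda>i. X (t i) \<omega>"] by simp
  have fin: "finite R" "finite Q"
    using R Q finite_subset by blast+
  define A where "A = {v\<in>space (PiM {..<p} (\<lambda>_. borel :: real measure)). \<forall>q\<in>R. (\<Sum>i=0..<q. v i) \<le> c q}"
  define B where "B = {v\<in>space (PiM {p..<n} (\<lambda>_. borel :: real measure)). \<forall>q\<in>Q. (\<Sum>i=p..<p+q. v i) \<le> d q}"
  define G where "G = {v\<in>space (PiM {..<n-p} (\<lambda>_. borel :: real measure)). \<forall>q\<in>Q. (\<Sum>i=0..<q. v i) \<le> d q}"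
  have A: "A \<in> sets (PiM {..<p} (\<lambda>_. borel))"
    unfolding A_def by (rule sets_Collect_sum_le) (use fin R in auto)
  have B: "B \<in> sets (PiM {p..<n} (\<lambda>_. borel))"
    unfolding B_def by (rule sets_Collect_sum_le) (use fin Q p in force)+
  have G: "G \<in> sets (PiM {..<n-p} (\<lambda>_. borel))"
    unfolding G_def by (rule sets_Collect_sum_le) (use fin Q in force)+
  have ind: "indep_vars (\<lambda>_. borel) D {..<n}"
    unfolding D_def using indep_increments[of t n] t by simp
  have "indep_var (PiM {..<p} (\<lambda>_. borel)) (\<lambda>\<omega>. \<lambda>i\<in>{..<p}. D i \<omega>)
      (PiM {p..<n} (\<lambda>_. borel)) (\<lambda>\<omega>. \<lambda>i\<in>{p..<n}. D i \<omega>)"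
    by (rule indep_var_restrict[OF ind]) (use p in auto)
  note indep_varD[OF this A B]
  moreover have evA: "(\<lambda>i\<in>{..<p}. D i \<omega>) \<in> A \<longleftrightarrow> (\<forall>q\<in>R. X (t q) \<omega> - X 0 \<omega> \<le> c q)" for \<omega>
  proof -
    have "(\<Sum>i=0..<q. (\<lambda>i\<in>{..<p}. D i \<omega>) i) = X (t q) \<omega> - X 0 \<omega>" if "q \<in> R" for q
      using that R t(1) D_sum[of 0 q \<omega>] by (subst sum.cong[OF refl, of _ _ "\<lambda>i. D i \<omega>"]) auto
    then show ?thesis by (simp add: A_def space_PiM)
  qed
  moreover have evB: "(\<lambda>i\<in>{p..<n}. D i \<omega>) \<in> B \<longleftrightarrow> (\<forall>q\<in>Q. X (t (p + q)) \<omega> - X (t p) \<omega> \<le> d q)" for \<omega>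
  proof -
    have "(\<Sum>i=p..<p+q. (\<lambda>i\<in>{p..<n}. D i \<omega>) i) = X (t (p + q)) \<omega> - X (t p) \<omega>" if "q \<in> Q" for q
      using that Q p D_sum[of p "p + q" \<omega>]
      by (subst sum.cong[OF refl, of _ _ "\<lambda>i. D i \<omega>"]) (auto simp: subset_iff)
    then show ?thesis by (simp add: B_def space_PiM)
  qed
  ultimately have 1: "prob {\<omega>\<in>space P. (\<forall>q\<in>R. X (t q) \<omega> - X 0 \<omega> \<le> c q) \<and> (\<forall>q\<in>Q. X (t (p + q)) \<omega> - X (t p) \<omega> \<le> d q)} =
    prob {\<omega>\<in>space P. \<forall>q\<in>R. X (t q) \<omega> - X 0 \<omega> \<le> c q} *
    prob {\<omega>\<in>space P. \<forall>q\<in>Q. X (t (p + q)) \<omega> - X (t p) \<omega> \<le> d q}"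
    by (simp add: vimage_def Int_def conj_commute conj_left_commute del: Bex_def Ball_def)
  \<comment> \<open>Two time sequences with the same step lengths, one running from
    \<open>t p\<close> and one from 0.\<close>
  define t1 where "t1 i = t (p + i)" for i
  define t2 where "t2 i = t (p + i) - t p" for i
  have mono: "t i \<le> t j" if "i \<le> j" "j \<le> n" for i j
    using that by (induction j) (auto simp: le_Suc_eq intro: order_trans[OF _ t(2)])
  have pos: "0 \<le> t i" if "i \<le> n" for i
    using mono[of 0 i] that t(1) by simp
  let ?M = "PiM {..<n-p} (\<lambda>_. borel :: real measure)"
  let ?D = "\<lambda>t \<omega>. \<lambda>i\<in>{..<n-p}. X (t (Suc i)) \<omega> - X (t i) \<omega>"
  have eq: "distr P ?M (?D t1) = distr P ?M (?D t2)"
    by (rule distr_increments_cong) (use pos p mono in \<open>auto simp: t1_def t2_def\<close>)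
  have meas: "?D t1 \<in> P \<rightarrow>\<^sub>M ?M" "?D t2 \<in> P \<rightarrow>\<^sub>M ?M"
    using pos p mono by (auto intro!: measurable_restrict borel_measurable_diff measurable_X simp: t1_def t2_def)
  have "prob (?D t1 -` G \<inter> space P) = prob (?D t2 -` G \<inter> space P)"
    using arg_cong[OF eq, of "\<lambda>M. measure M G"] meas G by (simp add: measure_distr)
  moreover have ev: "?D u \<omega> \<in> G \<longleftrightarrow> (\<forall>q\<in>Q. X (u q) \<omega> - X (u 0) \<omega> \<le> d q)" for u \<omega>
  proof -
    have "(\<Sum>i=0..<q. ?D u \<omega> i) = X (u q) \<omega> - X (u 0) \<omega>" if "q \<in> Q" for q
      using that Q sum_Suc_diff'[of 0 q "\<lambda>i. X (u i) \<omega>"]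
      by (subst sum.cong[OF refl, of _ _ "\<lambda>i. X (u (Suc i)) \<omega> - X (u i) \<omega>"]) (auto simp: subset_iff)
    then show ?thesis by (simp add: G_def space_PiM)
  qed
  ultimately have "prob {\<omega>\<in>space P. \<forall>q\<in>Q. X (t (p + q)) \<omega> - X (t p) \<omega> \<le> d q} =
      prob {\<omega>\<in>space P. \<forall>q\<in>Q. X (t (p + q) - t p) \<omega> - X 0 \<omega> \<le> d q}"
    unfolding ev vimage_def Int_def by (simp add: t1_def t2_def conj_commute)
  with 1 show ?thesis by simp
qed

text \<open>The times 0, \<open>s\<close>, \<open>J\<close> and the translate of \<open>K\<close> by
  \<open>s\<close> are listed in increasing order, which gives the indexed situation with
  \<open>p\<close> the position of \<open>s\<close>.\<close>

lemma prob_increments_boxes: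
  assumes J: "finite J" "J \<subseteq> {0..s}" and K: "finite K" "K \<subseteq> {0..}" and s: "0 \<le> s"
  shows "prob {\<omega>\<in>space P. (\<forall>u\<in>J. X u \<omega> - X 0 \<omega> \<le> c u) \<and> (\<forall>u\<in>K. X (s + u) \<omega> - X s \<omega> \<le> d u)} =
    prob {\<omega>\<in>space P. \<forall>u\<in>J. X u \<omega> - X 0 \<omega> \<le> c u} *
    prob {\<omega>\<in>space P. \<forall>u\<in>K. X u \<omega> - X 0 \<omega> \<le> d u}"
proof -
  define F where "F = {0, s} \<union> J \<union> (+) s ` K"
  define L where "L = sorted_list_of_set F"
  have F: "finite F" "F \<subseteq> {0..}" "0 \<in> F" "s \<in> F"
    using J K s by (auto simp: F_def)
  have L: "set L = F" "sorted L" "distinct L"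
    using F(1) by (simp_all add: L_def)
  have "L \<noteq> []" using L(1) F(3) by auto
  define n where "n = length L - 1"
  have len: "length L = Suc n" using \<open>L \<noteq> []\<close> by (simp add: n_def)
  have mono: "L ! i \<le> L ! j" if "i \<le> j" "j \<le> n" for i j
    using that L(2) len by (simp add: sorted_iff_nth_mono)
  have less_iff: "L ! i \<le> L ! j \<longleftrightarrow> i \<le> j" if "i \<le> n" "j \<le> n" for i j
    using mono that L(3) len by (metis le_less_Suc_eq less_Suc_eq_le linorder_le_cases nth_eq_iff_index_eq order_antisym)
  have ex: "\<exists>i\<le>n. L ! i = u" if "u \<in> F" for u
    using that L(1) len by (metis in_set_conv_nth less_Suc_eq_le)
  have L0: "L ! 0 = 0"
  proof -
    obtain i where "i \<le> n" "L ! i = 0" using ex F(3) by blast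
    then have "L ! 0 \<le> 0" using mono[of 0 i] by simp
    moreover have "L ! 0 \<in> F" using L(1) len nth_mem[of 0 L] by simp
    ultimately show ?thesis using F(2) by force
  qed
  obtain p where p: "p \<le> n" "L ! p = s" using ex F(4) by blast
  define R where "R = {i. i \<le> p \<and> L ! i \<in> J}"
  define Q where "Q = {i. i \<le> n - p \<and> L ! (p + i) - s \<in> K}"
  have R: "J = (!) L ` R"
  proof
    show "J \<subseteq> (!) L ` R"
    proof
      fix u assume u: "u \<in> J"
      then obtain i where i: "i \<le> n" "L ! i = u" using ex[of u] by (auto simp: F_def)
      then have "i \<le> p" using less_iff[of i p] p u J(2) by auto
      then show "u \<in> (!) L ` R" using i u by (auto simp: R_def)
    qed
  qed (auto simp: R_def)
  have Q: "K = (\<lambda>i. L ! (p + i) - s) ` Q"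
  proof
    show "K \<subseteq> (\<lambda>i. L ! (p + i) - s) ` Q"
    proof
      fix u assume u: "u \<in> K"
      then obtain i where i: "i \<le> n" "L ! i = s + u" using ex[of "s + u"] by (auto simp: F_def)
      then have "p \<le> i" using less_iff[of p i] p u K(2) by auto
      then show "u \<in> (\<lambda>i. L ! (p + i) - s) ` Q"
        using i u by (intro image_eqI[of _ _ "i - p"]) (auto simp: Q_def)
    qed
  qed (auto simp: Q_def)
  have "prob {\<omega>\<in>space P. (\<forall>q\<in>R. X (L ! q) \<omega> - X 0 \<omega> \<le> c (L ! q)) \<and>
        (\<forall>q\<in>Q. X (L ! (p + q)) \<omega> - X (L ! p) \<omega> \<le> d (L ! (p + q) - s))} =
    prob {\<omega>\<in>space P. \<forall>q\<in>R. X (L ! q) \<omega> - X 0 \<omega> \<le> c (L ! q)} *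
    prob {\<omega>\<in>space P. \<forall>q\<in>Q. X (L ! (p + q) - L ! p) \<omega> - X 0 \<omega> \<le> d (L ! (p + q) - s)}"
    by (rule prob_increments_boxes_indexed[where n=n]) (use L0 p mono in \<open>auto simp: R_def Q_def\<close>)
  then show ?thesis
    unfolding R Q by (simp add: p)
qed

lemma sets_Collect_increments_le:
  assumes "finite J" "\<And>u. u \<in> J \<Longrightarrow> 0 \<le> f u" "0 \<le> (s::real)"
  shows "{\<omega>\<in>space P. \<forall>u\<in>J. X (f u) \<omega> - X s \<omega> \<le> c u} \<in> sets P"
  by (rule sets.sets_Collect_finite_All[OF _ assms(1)])
    (intro borel_measurable_le borel_measurable_diff measurable_X assms borel_measurable_const)

lemma measure_law:
  "A \<in> sets path_space \<Longrightarrow> Pr x A = prob {\<omega>\<in>space P. (\<lambda>t\<in>{0..}. x + X t \<omega>) \<in> A}"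
  unfolding law_def by (subst measure_distr) (auto simp: vimage_def Int_def conj_commute)

lemma measure_law_lower_box:
  assumes "finite J" "J \<subseteq> {0..}"
  shows "Pr x (lower_box J c) = prob {\<omega>\<in>space P. \<forall>u\<in>J. X u \<omega> - X 0 \<omega> \<le> c u - x}"
proof -
  have "Pr x (lower_box J c) = prob {\<omega>\<in>space P. (\<lambda>t\<in>{0..}. x + X t \<omega>) \<in> lower_box J c}"
    by (rule measure_law) (use assms in auto)
  also have "\<dots> = prob {\<omega>\<in>space P. \<forall>u\<in>J. X u \<omega> - X 0 \<omega> \<le> c u - x}"
  proof (rule finite_measure_eq_AE)
    show "AE \<omega> in P. \<omega> \<in> {\<omega>\<in>space P. (\<lambda>t\<in>{0..}. x + X t \<omega>) \<in> lower_box J c} \<longleftrightarrow>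
        \<omega> \<in> {\<omega>\<in>space P. \<forall>u\<in>J. X u \<omega> - X 0 \<omega> \<le> c u - x}"
      using start_zero AE_space
    proof eventually_elim
      case (elim \<omega>)
      then show ?case
        using assms(2) measurable_space[OF measurable_levy_path, of \<omega> x]
        by (auto simp: lower_box_def subset_iff algebra_simps)
    qed
    show "{\<omega>\<in>space P. (\<lambda>t\<in>{0..}. x + X t \<omega>) \<in> lower_box J c} \<in> sets P"
      using measurable_sets[OF measurable_levy_path sets_lower_box[OF assms(1)], of x c]
      by (simp add: vimage_def Int_def conj_commute)
    show "{\<omega>\<in>space P. \<forall>u\<in>J. X u \<omega> - X 0 \<omega> \<le> c u - x} \<in> sets P"
      by (rule sets_Collect_increments_le) (use assms in auto)
  qed
  finally show ?thesis .
qed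

lemma AE_law_start: "AE w in law x. w 0 = x"
  unfolding law_def
proof (subst AE_distr_iff)
  show "{w \<in> paths. w 0 = x} \<in> sets path_space"
    using measurable_sets[OF measurable_coordinate, of "{x}" 0] by (simp add: vimage_def Int_def conj_commute)
qed (use start_zero in auto)

lemma measure_law_boxes:
  assumes J: "finite J" "J \<subseteq> {0..s}" and K: "finite K" "K \<subseteq> {0..}" and s: "0 \<le> s"
  shows "Pr x (lower_box J c \<inter> incr s -` lower_box K d) =
    Pr x (lower_box J c) * Pr 0 (lower_box K d)"
proof -
  have J': "J \<subseteq> {0..}" using J by auto
  have in_sets: "lower_box J c \<inter> incr s -` lower_box K d \<in> sets path_space"
    using sets.Int[OF sets_lower_box[OF J(1)] measurable_sets[OF measurable_incr[OF s] sets_lower_box[OF K(1)]], of c d]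
    by (simp add: lower_box_def Int_def vimage_def conj_ac)
  have "Pr x (lower_box J c \<inter> incr s -` lower_box K d) =
      prob {\<omega>\<in>space P. (\<lambda>t\<in>{0..}. x + X t \<omega>) \<in> lower_box J c \<inter> incr s -` lower_box K d}"
    by (rule measure_law[OF in_sets])
  also have "\<dots> = prob {\<omega>\<in>space P. (\<forall>u\<in>J. X u \<omega> - X 0 \<omega> \<le> c u - x) \<and> (\<forall>u\<in>K. X (s + u) \<omega> - X s \<omega> \<le> d u)}"
  proof (rule finite_measure_eq_AE)
    show "AE \<omega> in P. \<omega> \<in> {\<omega>\<in>space P. (\<lambda>t\<in>{0..}. x + X t \<omega>) \<in> lower_box J c \<inter> incr s -` lower_box K d} \<longleftrightarrow>
        \<omega> \<in> {\<omega>\<in>space P. (\<forall>u\<in>J. X u \<omega> - X 0 \<omega> \<le> c u - x) \<and> (\<forall>u\<in>K. X (s + u) \<omega> - X s \<omega> \<le> d u)}"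
      using start_zero AE_space
    proof eventually_elim
      case (elim \<omega>)
      have sp: "(\<lambda>t\<in>{0..}. x + X t \<omega>) \<in> paths"
        using elim measurable_space[OF measurable_levy_path, of \<omega> x] by simp
      have 1: "(\<lambda>t\<in>{0..}. x + X t \<omega>) \<in> lower_box J c \<longleftrightarrow> (\<forall>u\<in>J. X u \<omega> - X 0 \<omega> \<le> c u - x)"
        using sp J' elim by (auto simp: lower_box_def subset_iff algebra_simps)
      have 2: "incr s (\<lambda>t\<in>{0..}. x + X t \<omega>) \<in> lower_box K d \<longleftrightarrow> (\<forall>u\<in>K. X (s + u) \<omega> - X s \<omega> \<le> d u)"
        using incr_path[OF sp s] K(2) s by (auto simp: lower_box_def incr_def subset_iff)
      show ?case using 1 2 elim by simp
    qed
    show "{\<omega>\<in>space P. (\<lambda>t\<in>{0..}. x + X t \<omega>) \<in> lower_box J c \<inter> incr s -` lower_box K d} \<in> sets P"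
      using measurable_sets[OF measurable_levy_path in_sets, of x]
      by (simp add: vimage_def Int_def conj_ac)
    have "{\<omega>\<in>space P. \<forall>u\<in>J. X u \<omega> - X 0 \<omega> \<le> c u - x} \<in> sets P"
      by (rule sets_Collect_increments_le) (use J in auto)
    moreover have "{\<omega>\<in>space P. \<forall>u\<in>K. X (s + u) \<omega> - X s \<omega> \<le> d u} \<in> sets P"
      by (rule sets_Collect_increments_le) (use K s in auto)
    ultimately show "{\<omega>\<in>space P. (\<forall>u\<in>J. X u \<omega> - X 0 \<omega> \<le> c u - x) \<and> (\<forall>u\<in>K. X (s + u) \<omega> - X s \<omega> \<le> d u)} \<in> sets P"
      by (rule sets.sets_Collect_conj[rotated])
  qed
  also have "\<dots> = prob {\<omega>\<in>space P. \<forall>u\<in>J. X u \<omega> - X 0 \<omega> \<le> c u - x} *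
      prob {\<omega>\<in>space P. \<forall>u\<in>K. X u \<omega> - X 0 \<omega> \<le> d u}"
    by (rule prob_increments_boxes[OF J K s, of "\<lambda>u. c u - x"])
  also have "\<dots> = Pr x (lower_box J c) * Pr 0 (lower_box K d)"
    using measure_law_lower_box[OF J(1) J'] measure_law_lower_box[OF K] by simp
  finally show ?thesis .
qed

text \<open>Two uniqueness arguments in succession: the product formula for two boxes is extended to
  all future events while the past event is a box, and then to all past events.\<close>

theorem simple_markov:
  assumes s: "0 \<le> s" and A: "A \<in> sets (coord_algebra {0..s})" and E: "E \<in> sets path_space"
  shows "ePr x (A \<inter> incr s -` E) = ePr x A * ePr 0 E"
proof -
  have pre: "incr s -` E \<inter> paths \<in> sets path_space" if "E \<in> sets path_space" for E
    by (rule measurable_sets[OF measurable_incr[OF s] that])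
  have in_sets: "B \<inter> incr s -` E \<in> sets path_space" if "E \<in> sets path_space" "B \<in> sets path_space" for E B
    using sets.Int[OF that(2) pre[OF that(1)]] sets.sets_into_space[OF that(2)]
    by (simp add: Int_absorb1 Int_assoc[symmetric] inf.absorb1 Int_commute Int_left_commute)
  have box_box: "ePr x (lower_box J c \<inter> incr s -` lower_box K d) =
      ePr x (lower_box J c) * ePr 0 (lower_box K d)"
    if "finite J" "J \<subseteq> {0..s}" "finite K" "K \<subseteq> {0..}" for J c K d
    using measure_law_boxes[OF that s] by (simp add: law.emeasure_eq_measure ennreal_mult)
  have box: "ePr x (lower_box J c \<inter> incr s -` E) =
      ePr x (lower_box J c) * ePr 0 E"
    if J: "finite J" "J \<subseteq> {0..s}" and E: "E \<in> sets path_space" for J c E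
  proof -
    let ?M = "distr (density (law x) (indicator (lower_box J c))) path_space (incr s)"
    let ?N = "scale_measure (ePr x (lower_box J c)) (law 0)"
    have M: "emeasure ?M F = ePr x (lower_box J c \<inter> incr s -` F)" if "F \<in> sets path_space" for F
    proof -
      have "emeasure ?M F = ePr x (lower_box J c \<inter> (incr s -` F \<inter> paths))"
        using that J(1) pre[OF that] measurable_incr[OF s]
        by (subst emeasure_distr) (simp_all add: emeasure_density indicator_inter_arith[symmetric])
      also have "lower_box J c \<inter> (incr s -` F \<inter> paths) = lower_box J c \<inter> incr s -` F"
        by (auto simp: lower_box_def)
      finally show ?thesis .
    qed
    have "emeasure ?M E = emeasure ?N E"
    proof (rule emeasure_eq_on_coord_algebra[where I="{0..}"])
      show "emeasure ?M (space ?M) \<noteq> \<infinity>"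
        using M[OF sets.top[of path_space]] by (simp add: law.emeasure_eq_measure)
      show "emeasure ?M (lower_box K d) = emeasure ?N (lower_box K d)" if "finite K" "K \<subseteq> {0..}" for K d
        using box_box[OF J that] M[OF sets_lower_box[OF that(1)]] by simp
    qed (use E in \<open>auto simp: sets_path_space[symmetric] space_scale_measure\<close>)
    then show ?thesis using M[OF E] by simp
  qed
  \<comment> \<open>With the future event \<open>E\<close> fixed, both sides are now read as
    measures of the past event.\<close>
  let ?M = "density (law x) (indicator (incr s -` E \<inter> paths))"
  let ?N = "scale_measure (ePr 0 E) (law x)"
  have M: "emeasure ?M F = ePr x (F \<inter> incr s -` E)" if "F \<in> sets path_space" for F
  proof -
    have "emeasure ?M F = ePr x (incr s -` E \<inter> paths \<inter> F)"
      using that pre[OF E] by (subst emeasure_density) (simp_all add: indicator_inter_arith[symmetric])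
    also have "incr s -` E \<inter> paths \<inter> F = F \<inter> incr s -` E"
      using sets.sets_into_space[OF that] by auto
    finally show ?thesis .
  qed
  have "emeasure ?M A = emeasure ?N A"
  proof (rule emeasure_eq_on_coord_algebra[OF _ _ _ _ _ _ A])
    show "emeasure ?M (space ?M) \<noteq> \<infinity>"
      using M[OF sets.top[of path_space]] by (simp add: law.emeasure_eq_measure)
    show "emeasure ?M (lower_box J c) = emeasure ?N (lower_box J c)" if "finite J" "J \<subseteq> {0..s}" for J c
      using box[OF that E] M[OF sets_lower_box[OF that(1)]] by (simp add: mult.commute)
  qed (auto simp: space_scale_measure)
  then show ?thesis
    using M[of A] A sets_coord_algebra_le[of "{0..s}"] by (simp add: mult.commute subset_iff)
qed

end

subsection \<open>The strong Markov property\<close>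

text \<open>For nonnegative \<open>s\<close>, the least multiple of \<open>1 / Suc m\<close>
  strictly above \<open>s\<close>. Strictness allows right limits along the grid, and it makes the
  grid cell of an optional time known at the grid time.\<close>

definition grid :: "nat \<Rightarrow> real \<Rightarrow> real" where
  "grid m s = real (Suc (nat \<lfloor>s * Suc m\<rfloor>)) / Suc m"

lemma grid_greater: "0 \<le> s \<Longrightarrow> s < grid m s"
  unfolding grid_def by (simp add: field_simps) linarith

lemma grid_le:
  assumes "0 \<le> s" shows "grid m s \<le> s + 1 / Suc m"
proof -
  have "real (Suc (nat \<lfloor>s * Suc m\<rfloor>)) \<le> s * Suc m + 1"
    using of_nat_floor[of "s * Suc m"] assms by simp
  then have "grid m s \<le> (s * Suc m + 1) / Suc m"
    unfolding grid_def by (rule divide_right_mono) simp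
  then show ?thesis by (simp add: add_divide_distrib)
qed

lemma measurable_grid [measurable]:
  "\<tau> \<in> borel_measurable M \<Longrightarrow> (\<lambda>\<omega>. grid m (\<tau> \<omega>)) \<in> borel_measurable M"
proof -
  assume "\<tau> \<in> borel_measurable M"
  then have "(\<lambda>\<omega>. \<tau> \<omega> * c) \<in> borel_measurable M" for c by simp
  then have "(\<lambda>\<omega>. nat \<lfloor>\<tau> \<omega> * c\<rfloor>) \<in> M \<rightarrow>\<^sub>M count_space UNIV" for c
    by measurable
  from measurable_compose[OF this, of "\<lambda>k. real (Suc k) / real (Suc m)" borel "real (Suc m)"]
  show "(\<lambda>\<omega>. grid m (\<tau> \<omega>)) \<in> borel_measurable M"
    unfolding grid_def by simp
qed

lemma grid_tendsto:
  assumes "0 \<le> s" shows "filterlim (\<lambda>m. grid m s) (at_right s) sequentially"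
proof -
  have "(\<lambda>m. s + 1 / real (Suc m)) \<longlonglongrightarrow> s + 0"
    by (rule tendsto_add[OF tendsto_const LIMSEQ_Suc[OF lim_1_over_n]])
  then have upper: "(\<lambda>m. s + 1 / real (Suc m)) \<longlonglongrightarrow> s" by simp
  have "(\<lambda>m. grid m s) \<longlonglongrightarrow> s"
  proof (rule tendsto_sandwich[OF _ _ tendsto_const upper])
    show "\<forall>\<^sub>F m in sequentially. s \<le> grid m s"
      using grid_greater[OF assms] by (simp add: less_imp_le)
    show "\<forall>\<^sub>F m in sequentially. grid m s \<le> s + 1 / real (Suc m)"
      using grid_le[OF assms] by (simp only: eventually_True)
  qed
  then show ?thesis
    unfolding filterlim_at using grid_greater[OF assms] less_imp_neq[OF grid_greater[OF assms], symmetric] by simp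
qed

text \<open>A right limit at a random time is the limit of evaluations at grid times, which take
  countably many values and can be treated value by value.\<close>

lemma measurable_right_eval:
  fixes V :: "'a \<Rightarrow> real \<Rightarrow> real"
  assumes \<tau>: "\<tau> \<in> borel_measurable M" "\<And>\<omega>. \<omega> \<in> space M \<Longrightarrow> 0 \<le> \<tau> \<omega>"
    and meas: "\<And>u. 0 \<le> u \<Longrightarrow> (\<lambda>\<omega>. V \<omega> u) \<in> borel_measurable M"
    and lim: "\<And>\<omega>. \<omega> \<in> space M \<Longrightarrow> (V \<omega> \<longlongrightarrow> V' \<omega>) (at_right (\<tau> \<omega>))"
  shows "V' \<in> borel_measurable M"
proof (rule borel_measurable_LIMSEQ_real)
  show "(\<lambda>m. V \<omega> (grid m (\<tau> \<omega>))) \<longlonglongrightarrow> V' \<omega>" if "\<omega> \<in> space M" for \<omega>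
    using filterlim_compose[OF lim[OF that] grid_tendsto[OF \<tau>(2)[OF that]]] .
  show "(\<lambda>\<omega>. V \<omega> (grid m (\<tau> \<omega>))) \<in> borel_measurable M" for m
  proof -
    have "(\<lambda>\<omega>. nat \<lfloor>\<tau> \<omega> * Suc m\<rfloor>) \<in> M \<rightarrow>\<^sub>M count_space UNIV"
      using \<tau>(1) by measurable
    moreover have "(\<lambda>\<omega>. V \<omega> (real (Suc k) / Suc m)) \<in> borel_measurable M" for k
      by (rule meas) simp
    ultimately show ?thesis
      unfolding grid_def
      by (rule measurable_compose_countable[where f="\<lambda>k \<omega>. V \<omega> (real (Suc k) / Suc m)", rotated])
  qed
qed

section \<open>Shifted paths and optional times\<close>

definition shift :: "real \<Rightarrow> path \<Rightarrow> real \<Rightarrow> real" where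
  "shift s w = (\<lambda>t\<in>{0..}. w (s + t))"

abbreviation value_at :: "(path \<Rightarrow> ereal) \<Rightarrow> path \<Rightarrow> real" where
  "value_at T w \<equiv> w (real_of_ereal (T w))"

abbreviation incr_at :: "(path \<Rightarrow> ereal) \<Rightarrow> path \<Rightarrow> real \<Rightarrow> real" where
  "incr_at T w \<equiv> incr (real_of_ereal (T w)) w"

abbreviation shift_at :: "(path \<Rightarrow> ereal) \<Rightarrow> path \<Rightarrow> real \<Rightarrow> real" where
  "shift_at T w \<equiv> shift (real_of_ereal (T w)) w"

lemma shift_path: "w \<in> paths \<Longrightarrow> 0 \<le> s \<Longrightarrow> shift s w \<in> paths"
  using cadlag_shift[of w s] by (simp add: space_path_space shift_def)

abbreviation finite_time :: "(path \<Rightarrow> ereal) \<Rightarrow> path set" where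
  "finite_time T \<equiv> {w\<in>paths. T w < \<infinity>}"

abbreviation stopped_at :: "(path \<Rightarrow> ereal) \<Rightarrow> real \<Rightarrow> path set" where
  "stopped_at T y \<equiv> {w\<in>paths. T w < \<infinity> \<and> value_at T w = y}"

abbreviation restarted :: "(path \<Rightarrow> ereal) \<Rightarrow> real set \<Rightarrow> path set \<Rightarrow> path set" where
  "restarted T B E \<equiv> {w\<in>paths. T w < \<infinity> \<and> value_at T w \<in> B \<and> shift_at T w \<in> E}"

text \<open>Paths are only observed up to an infinitesimal amount of time after \<open>T\<close>; this covers
  hitting times of open sets.\<close>

definition optional :: "(path \<Rightarrow> ereal) \<Rightarrow> bool" where
  "optional T \<longleftrightarrow> (\<forall>w\<in>paths. 0 \<le> T w) \<and>
     (\<forall>t. {w\<in>paths. T w < ereal t} \<in> sets (coord_algebra {0..t}))"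

lemma optional_nonneg: "optional T \<Longrightarrow> w \<in> paths \<Longrightarrow> 0 \<le> T w"
  by (simp add: optional_def)

lemma optional_nonneg_real: "optional T \<Longrightarrow> w \<in> paths \<Longrightarrow> 0 \<le> real_of_ereal (T w)"
  by (simp add: optional_def real_of_ereal_pos)

lemma optional_less: "optional T \<Longrightarrow> s \<le> t \<Longrightarrow> {w\<in>paths. T w < ereal s} \<in> sets (coord_algebra {0..t})"
  using sets_coord_algebra_mono[of "{0..s}" "{0..t}"] by (auto simp: optional_def)

lemma measurable_optional:
  assumes "optional T" shows "T \<in> borel_measurable path_space"
proof (rule borel_measurableI_less)
  fix a
  have less: "{w\<in>paths. T w < ereal t} \<in> sets path_space" for t
    using optional_less[OF assms order_refl, of t] sets_coord_algebra_le by blast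
  show "{w \<in> paths. T w < a} \<in> sets path_space"
  proof (cases a)
    case (real r)
    then show ?thesis using less by simp
  next
    case PInf
    have "{w \<in> paths. T w < a} = (\<Union>n::nat. {w\<in>paths. T w < ereal (real n)})"
      unfolding PInf using less_PInf_Ex_of_nat by (auto intro: less_trans)
    then show ?thesis using less by simp
  next
    case MInf
    then show ?thesis by simp
  qed
qed

text \<open>Killing a time, that is sending it to infinity off an event, turns statements restricted
  to that event into statements about another optional time.\<close>

lemma optional_restrict:
  assumes "optional T" "\<And>t. {w\<in>paths. T w < ereal t \<and> Q w} \<in> sets (coord_algebra {0..t})"
  shows "optional (\<lambda>w. if Q w then T w else \<infinity>)"
proof -
  have "{w\<in>paths. (if Q w then T w else \<infinity>) < ereal t} = {w\<in>paths. T w < ereal t \<and> Q w}" for t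
    by auto
  then show ?thesis
    using assms by (auto simp: optional_def)
qed

lemma optional_before:
  assumes "optional T" shows "optional (\<lambda>w. if T w < ereal d then T w else \<infinity>)"
proof (rule optional_restrict[OF assms])
  fix u
  have "{w\<in>paths. T w < ereal u \<and> T w < ereal d} = {w\<in>paths. T w < ereal (min u d)}"
    by (simp only: ereal_min min_less_iff_conj)
  then show "{w\<in>paths. T w < ereal u \<and> T w < ereal d} \<in> sets (coord_algebra {0..u})"
    using optional_less[OF assms, of "min u d" u] by simp
qed

lemma sets_optional_finite: "optional T \<Longrightarrow> finite_time T \<in> sets path_space"
  by (intro borel_measurable_less measurable_optional borel_measurable_const)

lemma sets_optional_less: "optional T \<Longrightarrow> {w\<in>paths. T w < ereal t} \<in> sets path_space"
  using optional_less[OF _ order_refl] sets_coord_algebra_le by blast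

text \<open>By right-continuity the position at \<open>T\<close> is a limit of positions at slightly
  later times, and these times are still below \<open>t\<close> when \<open>T\<close> is.\<close>

lemma optional_eval:
  assumes T: "optional T" and B: "B \<in> sets borel"
  shows "{w\<in>paths. T w < ereal t \<and> value_at T w \<in> B} \<in> sets (coord_algebra {0..t})"
proof (cases "0 < t")
  case True
  let ?M = "coord_algebra {0..t}"
  define \<tau> where "\<tau> w = (if T w < ereal t then real_of_ereal (T w) else 0)" for w
  have less: "T w < ereal a \<longleftrightarrow> real_of_ereal (T w) < a" if "T w < ereal t" "w \<in> paths" for w a
    using that optional_nonneg[OF T that(2)] by (cases "T w") auto
  have \<tau>: "0 \<le> \<tau> w" "\<tau> w < t" if "w \<in> paths" for w
    using that True less[of w t] optional_nonneg_real[OF T that] by (auto simp: \<tau>_def)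
  have meas: "\<tau> \<in> borel_measurable ?M"
    unfolding borel_measurable_iff_less
  proof
    fix a
    consider "a \<le> 0" | "0 < a" "a < t" | "t \<le> a" by linarith
    then show "{w \<in> space ?M. \<tau> w < a} \<in> sets ?M"
    proof cases
      case 1
      then have *: "{w \<in> space ?M. \<tau> w < a} = {}" using \<tau>(1) by force
      show ?thesis unfolding * by (rule sets.empty_sets)
    next
      case 2
      have "\<tau> w < a \<longleftrightarrow> T w < ereal a \<or> \<not> T w < ereal t" if "w \<in> paths" for w
        using less[of w a] less_trans[of "T w" "ereal a" "ereal t"] 2 that by (cases "T w < ereal t") (auto simp: \<tau>_def)
      then have *: "{w \<in> space ?M. \<tau> w < a} =
          {w\<in>paths. T w < ereal a} \<union> (space ?M - {w\<in>paths. T w < ereal t})"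
        by auto
      show ?thesis
        unfolding * by (intro sets.Un sets.compl_sets optional_less[OF T]) (use 2 in auto)
    next
      case 3
      then have *: "{w \<in> space ?M. \<tau> w < a} = space ?M" using \<tau>(2) by force
      show ?thesis unfolding * by (rule sets.top)
    qed
  qed
  have eval: "(\<lambda>w. w (\<tau> w)) \<in> borel_measurable ?M"
  proof (rule measurable_right_eval[OF meas])
    \<comment> \<open>Capping at \<open>t\<close> consults only coordinates in
      \<open>{0..t}\<close>; to the right of \<open>\<tau> w < t\<close> the cap has no effect on
      the limit.\<close>
    show "(\<lambda>w. w (min u t)) \<in> borel_measurable ?M" if "0 \<le> u" for u
      using that True by (intro measurable_coord_algebra) auto
    fix w assume "w \<in> space ?M"
    then have w: "w \<in> paths" by simp
    have "eventually (\<lambda>u. u < t) (at_right (\<tau> w))"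
      by (rule order_tendstoD(2)[OF tendsto_ident_at \<tau>(2)[OF w]])
    then have "eventually (\<lambda>u. w (min u t) = w u) (at_right (\<tau> w))"
      by eventually_elim simp
    then show "((\<lambda>u. w (min u t)) \<longlongrightarrow> w (\<tau> w)) (at_right (\<tau> w))"
      using cadlag_right[OF path_cadlag[OF w] \<tau>(1)[OF w]] by (simp add: tendsto_cong)
  qed (use \<tau> in auto)
  have *: "{w\<in>paths. T w < ereal t \<and> value_at T w \<in> B} =
      {w\<in>paths. T w < ereal t} \<inter> ((\<lambda>w. w (\<tau> w)) -` B \<inter> space ?M)"
    by (auto simp: \<tau>_def)
  show ?thesis
    unfolding * by (rule sets.Int[OF optional_less[OF T order_refl] measurable_sets[OF eval B]])
next
  case False
  have "\<not> T w < ereal t" if "w \<in> paths" for w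
    using optional_nonneg[OF T that] False by (cases "T w") auto
  then have *: "{w\<in>paths. T w < ereal t \<and> value_at T w \<in> B} = {}" by blast
  show ?thesis unfolding * by (rule sets.empty_sets)
qed

lemma measurable_eval:
  assumes "\<tau> \<in> borel_measurable path_space" "\<And>w. w \<in> paths \<Longrightarrow> 0 \<le> \<tau> w"
  shows "(\<lambda>w. w (\<tau> w)) \<in> borel_measurable path_space"
proof (rule measurable_right_eval[OF assms, of "\<lambda>w. w"])
  show "(w \<longlongrightarrow> w (\<tau> w)) (at_right (\<tau> w))" if "w \<in> paths" for w
    by (rule cadlag_right[OF path_cadlag[OF that] assms(2)[OF that]])
qed (assumption, rule measurable_coordinate)

lemma measurable_incr_random:
  assumes "\<tau> \<in> borel_measurable path_space" "\<And>w. w \<in> paths \<Longrightarrow> 0 \<le> \<tau> w"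
  shows "(\<lambda>w. incr (\<tau> w) w) \<in> path_space \<rightarrow>\<^sub>M path_space"
proof (rule measurable_path)
  show "(\<lambda>w. incr (\<tau> w) w t) \<in> borel_measurable path_space" if "0 \<le> t" for t
  proof -
    have "(\<lambda>w. w (\<tau> w + t)) \<in> borel_measurable path_space"
      by (rule measurable_eval) (use assms that in auto)
    then show ?thesis
      using that borel_measurable_diff[OF _ measurable_eval[OF assms]] by (simp add: incr_def)
  qed
  fix w assume w: "w \<in> paths"
  show "cadlag (incr (\<tau> w) w)"
    by (rule path_cadlag[OF incr_path[OF w assms(2)[OF w]]])
  show "incr (\<tau> w) w \<in> extensional {0..}"
    by (rule path_extensional[OF incr_path[OF w assms(2)[OF w]]])
qed

lemma measurable_shift_random:
  assumes "\<tau> \<in> borel_measurable path_space" "\<And>w. w \<in> paths \<Longrightarrow> 0 \<le> \<tau> w"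
  shows "(\<lambda>w. shift (\<tau> w) w) \<in> path_space \<rightarrow>\<^sub>M path_space"
proof (rule measurable_path)
  show "(\<lambda>w. shift (\<tau> w) w t) \<in> borel_measurable path_space" if "0 \<le> t" for t
  proof -
    have "(\<lambda>w. w (\<tau> w + t)) \<in> borel_measurable path_space"
      by (rule measurable_eval) (use assms that in auto)
    then show ?thesis using that by (simp add: shift_def)
  qed
  fix w assume w: "w \<in> paths"
  show "cadlag (shift (\<tau> w) w)"
    by (rule path_cadlag[OF shift_path[OF w assms(2)[OF w]]])
  show "shift (\<tau> w) w \<in> extensional {0..}"
    by (rule path_extensional[OF shift_path[OF w assms(2)[OF w]]])
qed

lemma lower_box_mono: "(\<And>t. t \<in> J \<Longrightarrow> c t \<le> d t) \<Longrightarrow> lower_box J c \<subseteq> lower_box J d"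
  unfolding lower_box_def by (blast intro: order_trans)

section \<open>From grid times to general optional times\<close>

context levy_process
begin

text \<open>\<open>C k\<close> consists of the paths with
  \<open>k * h \<le> T w < Suc k * h\<close>. On it the grid time is the constant
  \<open>Suc k * h\<close>, by which \<open>C k\<close> is already known, so the simple Markov
  property applies cell by cell and the cells are summed.\<close>

lemma strong_markov_grid:
  assumes T: "optional T" and E: "E \<in> sets path_space"
  shows "ePr x {w\<in>paths. T w < \<infinity> \<and> incr (grid m (real_of_ereal (T w))) w \<in> E} =
    ePr x (finite_time T) * ePr 0 E"
proof -
  define h where "h = (1::real) / Suc m"
  have "0 < h" by (simp add: h_def)
  define C where "C k = {w\<in>paths. T w < ereal (real (Suc k) * h)} - {w\<in>paths. T w < ereal (real k * h)}" for k
  have C_coord: "C k \<in> sets (coord_algebra {0..real (Suc k) * h})" for k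
    unfolding C_def by (intro sets.Diff optional_less[OF T]) (use \<open>0 < h\<close> in auto)
  then have C_sets: "C k \<in> sets path_space" for k
    using sets_coord_algebra_le by blast
  have inC: "w \<in> C k \<longleftrightarrow> T w < \<infinity> \<and> nat \<lfloor>real_of_ereal (T w) * Suc m\<rfloor> = k" if "w \<in> paths" for w k
  proof (cases "T w")
    case (real r)
    then have "0 \<le> r" using optional_nonneg[OF T that] by simp
    then have "(nat \<lfloor>r * Suc m\<rfloor> = k) \<longleftrightarrow> real k \<le> r * Suc m \<and> r * Suc m < real k + 1"
      by (auto simp: nat_eq_iff floor_eq_iff)
    then show ?thesis
      using that real by (auto simp: C_def h_def field_simps)
  next
    case PInf
    then show ?thesis by (simp add: C_def)
  next
    case MInf
    then show ?thesis using optional_nonneg[OF T that] by simp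
  qed
  have C_space: "w \<in> paths" if "w \<in> C k" for w k
    using that by (simp add: C_def)
  have disj: "disjoint_family C"
    unfolding disjoint_family_on_def
  proof (intro ballI impI)
    fix i j :: nat assume "i \<noteq> j"
    then have "\<not> (w \<in> C i \<and> w \<in> C j)" for w
      using inC[of w i] inC[of w j] C_space[of w i] by metis
    then show "C i \<inter> C j = {}" by blast
  qed
  have UN: "finite_time T = (\<Union>k. C k)"
  proof (rule Set.set_eqI, rule iffI)
    fix w assume "w \<in> finite_time T"
    then show "w \<in> (\<Union>k. C k)" using inC[of w] by simp
  next
    fix w assume "w \<in> (\<Union>k. C k)"
    then obtain k where "w \<in> C k" by blast
    then show "w \<in> finite_time T" using inC[of w k] C_space[of w k] by simp
  qed
  have "{w\<in>paths. T w < \<infinity> \<and> incr (grid m (real_of_ereal (T w))) w \<in> E} =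
      (\<Union>k. C k \<inter> incr (real (Suc k) * h) -` E)" (is "_ = (\<Union>k. ?D k)")
  proof (rule Set.set_eqI, rule iffI)
    fix w assume "w \<in> {w\<in>paths. T w < \<infinity> \<and> incr (grid m (real_of_ereal (T w))) w \<in> E}"
    then show "w \<in> (\<Union>k. ?D k)" using inC[of w] by (simp add: grid_def h_def)
  next
    fix w assume "w \<in> (\<Union>k. ?D k)"
    then obtain k where k: "w \<in> C k" "incr (real (Suc k) * h) w \<in> E" by blast
    then have "grid m (real_of_ereal (T w)) = real (Suc k) * h" "T w < \<infinity>"
      using inC[of w k] C_space[of w k] by (simp_all add: grid_def h_def)
    then show "w \<in> {w\<in>paths. T w < \<infinity> \<and> incr (grid m (real_of_ereal (T w))) w \<in> E}"
      using k(2) C_space[OF k(1)] by simp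
  qed
  moreover have disj_D: "disjoint_family ?D"
    using disj unfolding disjoint_family_on_def by blast
  moreover have D_sets: "?D k \<in> sets path_space" for k
  proof -
    have "?D k = C k \<inter> (incr (real (Suc k) * h) -` E \<inter> paths)"
      using sets.sets_into_space[OF C_sets] by blast
    moreover have "incr (real (Suc k) * h) -` E \<inter> paths \<in> sets path_space"
      by (rule measurable_sets[OF measurable_incr E]) (use \<open>0 < h\<close> in simp)
    ultimately show ?thesis using C_sets by simp
  qed
  ultimately have "ePr x {w\<in>paths. T w < \<infinity> \<and> incr (grid m (real_of_ereal (T w))) w \<in> E} =
      (\<Sum>k. ePr x (?D k))"
    using disj_D by (simp only:, intro suminf_emeasure[symmetric]) auto
  also have "\<dots> = (\<Sum>k. ePr x (C k) * ePr 0 E)"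
    using simple_markov[OF _ C_coord E] \<open>0 < h\<close> by simp
  also have "\<dots> = (\<Sum>k. ePr x (C k)) * ePr 0 E"
    by simp
  also have "(\<Sum>k. ePr x (C k)) = ePr x (finite_time T)"
    unfolding UN by (rule suminf_emeasure) (use C_sets disj in auto)
  finally show ?thesis .
qed

lemma sets_finite_time_incr:
  assumes T: "optional T" and E: "E \<in> sets path_space"
    and \<tau>: "\<tau> \<in> borel_measurable path_space" "\<And>w. w \<in> paths \<Longrightarrow> 0 \<le> \<tau> w"
  shows "{w\<in>paths. T w < \<infinity> \<and> incr (\<tau> w) w \<in> E} \<in> sets path_space"
  using sets.Int[OF measurable_sets[OF measurable_incr_random[OF \<tau>] E] sets_optional_finite[OF T]]
  by (rule back_subst[of "\<lambda>A. A \<in> sets path_space"]) auto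

lemma incr_grid_tendsto:
  assumes "w \<in> paths" "0 \<le> s" "0 \<le> t"
  shows "(\<lambda>m. incr (grid m s) w t) \<longlonglongrightarrow> incr s w t"
proof -
  have st: "0 \<le> s + t" using assms by simp
  have "(\<lambda>m. grid m s) \<longlonglongrightarrow> s"
    using grid_tendsto[OF assms(2)] unfolding filterlim_at by blast
  from tendsto_add[OF this tendsto_const[of t]]
  have "filterlim (\<lambda>m. grid m s + t) (at_right (s + t)) sequentially"
    unfolding filterlim_at using grid_greater[OF assms(2)]
    by (intro conjI always_eventually) (auto simp: less_imp_neq[symmetric] dest: less_imp_neq)
  from filterlim_compose[OF cadlag_right[OF path_cadlag[OF assms(1)] st] this]
  have "(\<lambda>m. w (grid m s + t)) \<longlonglongrightarrow> w (s + t)" .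
  moreover have "(\<lambda>m. w (grid m s)) \<longlonglongrightarrow> w s"
    using filterlim_compose[OF cadlag_right[OF path_cadlag[OF assms(1)] assms(2)] grid_tendsto[OF assms(2)]] .
  ultimately show ?thesis
    using assms(3) tendsto_diff by (auto simp: incr_def)
qed

text \<open>The increments after the \<open>grid\<close> times converge to those after \<open>T\<close> by right-continuity. In the
  limit this bounds closed boxes from below, and from above by slightly larger boxes.\<close>

lemma strong_markov_incr:
  assumes T: "optional T" and E: "E \<in> sets path_space"
  shows "ePr x {w\<in>paths. T w < \<infinity> \<and> incr_at T w \<in> E} =
    ePr x (finite_time T) * ePr 0 E"
proof -
  have [measurable]: "T \<in> borel_measurable path_space" by (rule measurable_optional[OF T])
  define \<tau> where "\<tau> w = real_of_ereal (T w)" for w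
  have \<tau>: "0 \<le> \<tau> w" if "w \<in> paths" for w
    using optional_nonneg_real[OF T that] by (simp add: \<tau>_def)
  have [measurable]: "\<tau> \<in> borel_measurable path_space"
    unfolding \<tau>_def by (rule borel_measurable_real_of_ereal) (rule measurable_optional[OF T])
  define S where "S = finite_time T"
  have S: "S \<in> sets path_space" unfolding S_def by measurable
  define Ev where "Ev E = {w\<in>paths. T w < \<infinity> \<and> incr (\<tau> w) w \<in> E}" for E
  define Eg where "Eg m E = {w\<in>paths. T w < \<infinity> \<and> incr (grid m (\<tau> w)) w \<in> E}" for m E
  have Ev_sets: "Ev E \<in> sets path_space" if "E \<in> sets path_space" for E
    unfolding Ev_def by (rule sets_finite_time_incr[OF T that]) (auto simp: \<tau>)
  have Eg_sets: "Eg m E \<in> sets path_space" if "E \<in> sets path_space" for m E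
    unfolding Eg_def by (rule sets_finite_time_incr[OF T that]) (measurable, auto simp: grid_def)
  have Eg: "Pr x (Eg m E) = Pr x S * Pr 0 E" if "E \<in> sets path_space" for m E
    using strong_markov_grid[OF T that, of x m] unfolding Eg_def \<tau>_def S_def
    by (simp add: law.emeasure_eq_measure ennreal_mult'[symmetric])
  have box: "Pr x (Ev (lower_box J c)) = Pr x S * Pr 0 (lower_box J c)"
    if J: "finite J" "J \<subseteq> {0..}" for J c
  proof (rule antisym)
    have in_box: "incr s w \<in> lower_box J c \<longleftrightarrow> (\<forall>t\<in>J. incr s w t \<le> c t)" if "w \<in> paths" "0 \<le> s" for s w c
      using incr_path[OF that] by (auto simp: lower_box_def)
    show "Pr x S * Pr 0 (lower_box J c) \<le> Pr x (Ev (lower_box J c))"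
    proof -
      \<comment> \<open>Their intersection is the limit superior of the grid events: a path whose
        grid increments are in the closed box infinitely often has its limiting increments
        there.\<close>
      define B where "B n = (\<Union>m\<in>{n..}. Eg m (lower_box J c))" for n
      have B_sets: "range B \<subseteq> sets (law x)" using Eg_sets J by (auto simp: B_def)
      have "decseq B" by (force simp: B_def decseq_def)
      have lim: "(\<lambda>n. Pr x (B n)) \<longlonglongrightarrow> Pr x (\<Inter>n. B n)"
        by (rule law.finite_Lim_measure_decseq[OF B_sets \<open>decseq B\<close>])
      have sub: "(\<Inter>n. B n) \<subseteq> Ev (lower_box J c)"
      proof
        fix w assume w: "w \<in> (\<Inter>n. B n)"
        then have wS: "w \<in> paths" "T w < \<infinity>" by (auto simp: B_def Eg_def)
        have "incr (\<tau> w) w t \<le> c t" if "t \<in> J" for t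
        proof (rule ccontr)
          assume "\<not> incr (\<tau> w) w t \<le> c t"
          then have "eventually (\<lambda>m. c t < incr (grid m (\<tau> w)) w t) sequentially"
            using incr_grid_tendsto[OF wS(1) \<tau>[OF wS(1)], of t] that J(2)
            by (intro order_tendstoD(1)) auto
          then obtain n where n: "\<And>m. n \<le> m \<Longrightarrow> c t < incr (grid m (\<tau> w)) w t"
            by (auto simp: eventually_sequentially)
          obtain m where "n \<le> m" "w \<in> Eg m (lower_box J c)" using w by (auto simp: B_def)
          then show False using n[of m] that by (auto simp: Eg_def lower_box_def)
        qed
        then show "w \<in> Ev (lower_box J c)"
          using wS in_box[OF wS(1) \<tau>[OF wS(1)]] by (simp add: Ev_def)
      qed
      have "Pr x S * Pr 0 (lower_box J c) \<le> Pr x (B n)" for n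
        unfolding Eg[OF sets_lower_box[OF J(1)], of n, symmetric]
        by (rule law.finite_measure_mono) (use B_sets in \<open>auto simp: B_def\<close>)
      then have "Pr x S * Pr 0 (lower_box J c) \<le> Pr x (\<Inter>n. B n)"
        by (intro LIMSEQ_le_const[OF lim]) auto
      also have "\<dots> \<le> Pr x (Ev (lower_box J c))"
        by (rule law.finite_measure_mono[OF sub]) (use Ev_sets J in auto)
      finally show ?thesis .
    qed
    \<comment> \<open>Strict enlargements: if the limiting increments are in the original box, the
      grid increments are eventually in the enlarged one, which is a limit inferior of grid events.
      At the end \<open>r\<close> tends to infinity.\<close>
    define c' where "c' r t = c t + 1 / Suc r" for r :: nat and t
    have upper: "Pr x (Ev (lower_box J c)) \<le> Pr x S * Pr 0 (lower_box J (c' r))" for r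
    proof -
      define B where "B n = (\<Inter>m\<in>{n..}. Eg m (lower_box J (c' r)))" for n
      have B_sets: "range B \<subseteq> sets (law x)" using Eg_sets J by (auto simp: B_def)
      have "incseq B" by (force simp: B_def incseq_def)
      have lim: "(\<lambda>n. Pr x (B n)) \<longlonglongrightarrow> Pr x (\<Union>n. B n)"
        by (rule law.finite_Lim_measure_incseq[OF B_sets \<open>incseq B\<close>])
      have sub: "Ev (lower_box J c) \<subseteq> (\<Union>n. B n)"
      proof
        fix w assume "w \<in> Ev (lower_box J c)"
        then have wS: "w \<in> paths" "T w < \<infinity>" and le: "\<And>t. t \<in> J \<Longrightarrow> incr (\<tau> w) w t \<le> c t"
          by (auto simp: Ev_def lower_box_def)
        have "eventually (\<lambda>m. incr (grid m (\<tau> w)) w t < c' r t) sequentially" if "t \<in> J" for t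
        proof (rule order_tendstoD(2)[OF incr_grid_tendsto[OF wS(1) \<tau>[OF wS(1)]]])
          have "0 < 1 / real (Suc r)" by simp
          then show "incr (\<tau> w) w t < c' r t" using le[OF that] unfolding c'_def by linarith
        qed (use that J(2) in auto)
        then have "eventually (\<lambda>m. \<forall>t\<in>J. incr (grid m (\<tau> w)) w t < c' r t) sequentially"
          using J(1) by (simp add: eventually_ball_finite)
        then obtain n where n: "\<And>m t. n \<le> m \<Longrightarrow> t \<in> J \<Longrightarrow> incr (grid m (\<tau> w)) w t < c' r t"
          by (auto simp: eventually_sequentially)
        have "w \<in> Eg m (lower_box J (c' r))" if "n \<le> m" for m
        proof -
          have "0 \<le> grid m (\<tau> w)"
            using \<tau>[OF wS(1)] grid_greater[OF \<tau>[OF wS(1)], of m] by linarith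
          then have "incr (grid m (\<tau> w)) w \<in> lower_box J (c' r)"
            using in_box[OF wS(1)] n[OF that] by (simp add: less_imp_le)
          then show ?thesis using wS by (simp add: Eg_def)
        qed
        then have "w \<in> B n" by (simp add: B_def)
        then show "w \<in> (\<Union>n. B n)" by blast
      qed
      have "Pr x (B n) \<le> Pr x S * Pr 0 (lower_box J (c' r))" for n
        unfolding Eg[OF sets_lower_box[OF J(1)], of n, symmetric]
        by (rule law.finite_measure_mono) (use Eg_sets J in \<open>auto simp: B_def\<close>)
      then have "Pr x (\<Union>n. B n) \<le> Pr x S * Pr 0 (lower_box J (c' r))"
        by (intro LIMSEQ_le_const2[OF lim]) auto
      moreover have "Pr x (Ev (lower_box J c)) \<le> Pr x (\<Union>n. B n)"
        by (rule law.finite_measure_mono[OF sub]) (use B_sets in auto)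
      ultimately show ?thesis by linarith
    qed
    have "(\<Inter>r. lower_box J (c' r)) = lower_box J c"
    proof
      show "(\<Inter>r. lower_box J (c' r)) \<subseteq> lower_box J c"
      proof
        fix w assume w: "w \<in> (\<Inter>r. lower_box J (c' r))"
        have "w t \<le> c t" if "t \<in> J" for t
        proof (rule field_le_epsilon)
          fix e :: real assume "0 < e"
          then obtain r where "inverse (real (Suc r)) < e" using reals_Archimedean by blast
          moreover have "w t \<le> c t + 1 / Suc r" using w that by (auto simp: lower_box_def c'_def)
          ultimately show "w t \<le> c t + e" unfolding inverse_eq_divide by linarith
        qed
        then show "w \<in> lower_box J c" using w by (auto simp: lower_box_def)
      qed
      show "lower_box J c \<subseteq> (\<Inter>r. lower_box J (c' r))"
        using lower_box_mono[of J c "c' _"] by (auto simp: c'_def)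
    qed
    moreover have "(\<lambda>r. Pr 0 (lower_box J (c' r))) \<longlonglongrightarrow> Pr 0 (\<Inter>r. lower_box J (c' r))"
    proof (rule law.finite_Lim_measure_decseq)
      show "decseq (\<lambda>r. lower_box J (c' r))"
        unfolding decseq_def by (intro allI impI lower_box_mono) (simp add: c'_def frac_le)
    qed (use J in auto)
    ultimately have "(\<lambda>r. Pr x S * Pr 0 (lower_box J (c' r))) \<longlonglongrightarrow> Pr x S * Pr 0 (lower_box J c)"
      by (auto intro: tendsto_mult)
    then show "Pr x (Ev (lower_box J c)) \<le> Pr x S * Pr 0 (lower_box J c)"
      by (rule LIMSEQ_le_const) (use upper in auto)
  qed
  let ?M = "distr (density (law x) (indicator S)) path_space (\<lambda>w. incr (\<tau> w) w)"
  let ?N = "scale_measure (ePr x S) (law 0)"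
  have incr_meas: "(\<lambda>w. incr (\<tau> w) w) \<in> path_space \<rightarrow>\<^sub>M path_space"
    by (rule measurable_incr_random) (use \<tau> in auto)
  have M: "emeasure ?M F = ePr x (Ev F)" if F: "F \<in> sets path_space" for F
  proof -
    have pre: "(\<lambda>w. incr (\<tau> w) w) -` F \<inter> paths \<in> sets path_space"
      by (rule measurable_sets[OF incr_meas F])
    have "emeasure ?M F = ePr x (S \<inter> ((\<lambda>w. incr (\<tau> w) w) -` F \<inter> paths))"
      using F incr_meas pre S
      by (subst emeasure_distr) (simp_all add: emeasure_density indicator_inter_arith[symmetric])
    also have "S \<inter> ((\<lambda>w. incr (\<tau> w) w) -` F \<inter> paths) = Ev F"
      by (auto simp: S_def Ev_def)
    finally show ?thesis .
  qed
  have "emeasure ?M E = emeasure ?N E"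
  proof (rule emeasure_eq_on_coord_algebra[where I="{0..}"])
    show "emeasure ?M (space ?M) \<noteq> \<infinity>"
      using M[OF sets.top[of path_space]] by (simp add: law.emeasure_eq_measure)
    show "emeasure ?M (lower_box K d) = emeasure ?N (lower_box K d)" if "finite K" "K \<subseteq> {0..}" for K d
      using box[OF that] M[OF sets_lower_box[OF that(1)]]
      by (simp add: law.emeasure_eq_measure ennreal_mult')
  qed (use E in \<open>auto simp: sets_path_space[symmetric] space_scale_measure\<close>)
  then show ?thesis using M[OF E] by (simp add: Ev_def S_def \<tau>_def)
qed

text \<open>This is \<open>strong_markov_incr\<close> for \<open>T\<close> killed wherever its
  position is outside \<open>B\<close>.\<close>

lemma strong_markov_joint:
  assumes T: "optional T" and B: "B \<in> sets borel" and E: "E \<in> sets path_space"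
  shows "ePr x {w\<in>paths. T w < \<infinity> \<and> value_at T w \<in> B \<and> incr_at T w \<in> E} =
    ePr x {w\<in>paths. T w < \<infinity> \<and> value_at T w \<in> B} * ePr 0 E"
proof -
  let ?T = "\<lambda>w. if value_at T w \<in> B then T w else \<infinity>"
  have "optional ?T"
    by (rule optional_restrict[OF T optional_eval[OF T B]])
  from strong_markov_incr[OF this E, of x]
  have "ePr x {w\<in>paths. ?T w < \<infinity> \<and> incr_at ?T w \<in> E} =
    ePr x (finite_time ?T) * ePr 0 E" .
  moreover have "{w\<in>paths. ?T w < \<infinity> \<and> incr_at ?T w \<in> E} =
      {w\<in>paths. T w < \<infinity> \<and> value_at T w \<in> B \<and> incr_at T w \<in> E}"
    by auto
  moreover have "finite_time ?T = {w\<in>paths. T w < \<infinity> \<and> value_at T w \<in> B}"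
    by auto
  ultimately show ?thesis by (simp only:)
qed

text \<open>The rectangle identity \<open>strong_markov_joint\<close> makes the joint law of
  position and later increments, restricted to finite \<open>T\<close>, a product measure; Fubini
  then allows the position to be frozen.\<close>

lemma strong_markov_nn_integral:
  assumes T: "optional T" and G: "G \<in> borel_measurable (borel \<Otimes>\<^sub>M path_space)"
  shows "(\<integral>\<^sup>+w. indicator (finite_time T) w * G (value_at T w, incr_at T w) \<partial>law x) =
    (\<integral>\<^sup>+w. indicator (finite_time T) w * (\<integral>\<^sup>+v. G (value_at T w, v) \<partial>law 0) \<partial>law x)"
proof -
  define S where "S = finite_time T"
  define f where "f w = value_at T w" for w :: "real \<Rightarrow> real"
  define g where "g w = incr_at T w" for w
  have Tm: "T \<in> borel_measurable path_space" by (rule measurable_optional[OF T])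
  have \<tau>: "(\<lambda>w. real_of_ereal (T w)) \<in> borel_measurable path_space"
    by (rule borel_measurable_real_of_ereal[OF Tm])
  have f: "f \<in> borel_measurable path_space"
    unfolding f_def by (rule measurable_eval[OF \<tau> optional_nonneg_real[OF T]])
  have g: "g \<in> path_space \<rightarrow>\<^sub>M path_space"
    unfolding g_def by (rule measurable_incr_random[OF \<tau> optional_nonneg_real[OF T]])
  have S: "S \<in> sets path_space"
    unfolding S_def using Tm by measurable
  let ?\<mu> = "density (law x) (indicator S)"
  have f': "f \<in> borel_measurable ?\<mu>" and g': "g \<in> ?\<mu> \<rightarrow>\<^sub>M path_space"
    using f g by (simp_all cong: measurable_cong_sets)
  have fg: "(\<lambda>w. (f w, g w)) \<in> ?\<mu> \<rightarrow>\<^sub>M borel \<Otimes>\<^sub>M path_space"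
    using f' g' by measurable
  have S': "emeasure ?\<mu> C = ePr x (S \<inter> C)" if "C \<in> sets path_space" for C
    using that S by (simp add: emeasure_density indicator_inter_arith[symmetric])
  have "finite_measure (distr ?\<mu> borel f)"
  proof (rule finite_measureI)
    show "emeasure (distr ?\<mu> borel f) (space (distr ?\<mu> borel f)) \<noteq> \<infinity>"
      using f' S'[OF sets.top] by (simp add: emeasure_distr law.emeasure_eq_measure)
  qed
  then have fin: "sigma_finite_measure (distr ?\<mu> borel f)"
    by (simp add: finite_measure_def)
  have pair: "distr ?\<mu> borel f \<Otimes>\<^sub>M law 0 = distr ?\<mu> (borel \<Otimes>\<^sub>M path_space) (\<lambda>w. (f w, g w))"
  proof (rule pair_measure_eqI[OF fin law.sigma_finite_measure_axioms])
    show "sets (distr ?\<mu> borel f \<Otimes>\<^sub>M law 0) = sets (distr ?\<mu> (borel \<Otimes>\<^sub>M path_space) (\<lambda>w. (f w, g w)))"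
      by (simp cong: sets_pair_measure_cong)
    fix B E assume "B \<in> sets (distr ?\<mu> borel f)" "E \<in> sets (law 0)"
    then have B: "B \<in> sets borel" and E: "E \<in> sets path_space" by auto
    have pf: "f -` B \<inter> paths \<in> sets path_space"
      and pg: "g -` E \<inter> paths \<in> sets path_space"
      using measurable_sets[OF f B] measurable_sets[OF g E] by auto
    have "emeasure (distr ?\<mu> borel f) B = ePr x (S \<inter> (f -` B \<inter> paths))"
      using S'[OF pf] f' B by (simp add: emeasure_distr)
    also have "S \<inter> (f -` B \<inter> paths) = {w\<in>paths. T w < \<infinity> \<and> f w \<in> B}"
      by (auto simp: S_def)
    finally have 1: "emeasure (distr ?\<mu> borel f) B = ePr x {w\<in>paths. T w < \<infinity> \<and> f w \<in> B}" .
    have eq: "(\<lambda>w. (f w, g w)) -` (B \<times> E) \<inter> paths = (f -` B \<inter> paths) \<inter> (g -` E \<inter> paths)"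
      by auto
    have "emeasure (distr ?\<mu> (borel \<Otimes>\<^sub>M path_space) (\<lambda>w. (f w, g w))) (B \<times> E) =
        emeasure ?\<mu> ((\<lambda>w. (f w, g w)) -` (B \<times> E) \<inter> paths)"
      using fg B E by (simp add: emeasure_distr)
    also have "\<dots> = ePr x (S \<inter> ((f -` B \<inter> paths) \<inter> (g -` E \<inter> paths)))"
      unfolding eq by (rule S'[OF sets.Int[OF pf pg]])
    also have "S \<inter> ((f -` B \<inter> paths) \<inter> (g -` E \<inter> paths)) =
        {w\<in>paths. T w < \<infinity> \<and> f w \<in> B \<and> g w \<in> E}"
      by (auto simp: S_def)
    finally show "emeasure (distr ?\<mu> borel f) B * ePr 0 E =
        emeasure (distr ?\<mu> (borel \<Otimes>\<^sub>M path_space) (\<lambda>w. (f w, g w))) (B \<times> E)"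
      using 1 strong_markov_joint[OF T B E, of x] by (simp only: f_def g_def)
  qed
  have G': "G \<in> borel_measurable (distr ?\<mu> borel f \<Otimes>\<^sub>M law 0)"
    using G measurable_cong_sets[OF sets_pair_measure_cong[OF sets_distr sets_law] refl] by blast
  have inner: "(\<lambda>a. \<integral>\<^sup>+v. G (a, v) \<partial>law 0) \<in> borel_measurable borel"
    by (rule law.borel_measurable_nn_integral_fst)
      (use G measurable_cong_sets[OF sets_pair_measure_cong[OF refl sets_law] refl] in blast)
  have "(\<integral>\<^sup>+w. indicator S w * G (f w, g w) \<partial>law x) = (\<integral>\<^sup>+w. G (f w, g w) \<partial>?\<mu>)"
    using measurable_compose[OF fg G] S by (subst nn_integral_density) auto
  also have "\<dots> = (\<integral>\<^sup>+z. G z \<partial>distr ?\<mu> (borel \<Otimes>\<^sub>M path_space) (\<lambda>w. (f w, g w)))"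
    by (rule nn_integral_distr[symmetric, OF fg]) (use G in simp)
  also have "\<dots> = (\<integral>\<^sup>+a. (\<integral>\<^sup>+v. G (a, v) \<partial>law 0) \<partial>distr ?\<mu> borel f)"
    unfolding pair[symmetric] by (rule law.nn_integral_fst[symmetric, OF G'])
  also have "\<dots> = (\<integral>\<^sup>+w. (\<integral>\<^sup>+v. G (f w, v) \<partial>law 0) \<partial>?\<mu>)"
    by (rule nn_integral_distr[OF f']) (use inner in simp)
  also have "\<dots> = (\<integral>\<^sup>+w. indicator S w * (\<integral>\<^sup>+v. G (f w, v) \<partial>law 0) \<partial>law x)"
    using measurable_compose[OF f inner] S by (subst nn_integral_density) auto
  finally show ?thesis by (simp only: S_def f_def g_def)
qed

lemma law_translate: "law y = distr (law x) path_space (\<lambda>w. \<lambda>t\<in>{0..}. y - x + w t)"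
proof -
  have eq: "(\<lambda>w. \<lambda>t\<in>{0..}. y - x + w t) \<circ> (\<lambda>\<omega>. \<lambda>t\<in>{0..}. x + X t \<omega>) = (\<lambda>\<omega>. \<lambda>t\<in>{0..}. y + X t \<omega>)"
    by (auto simp: fun_eq_iff)
  show ?thesis
    unfolding law_def by (subst distr_distr[OF measurable_translate measurable_levy_path]) (simp only: eq)
qed

lemma emeasure_law_translate:
  assumes "E \<in> sets path_space"
  shows "emeasure (law (x + y)) E = ePr x {w\<in>paths. (\<lambda>t\<in>{0..}. y + w t) \<in> E}"
  unfolding law_translate[of "x + y" x] using measurable_translate[of y] assms
  by (simp add: emeasure_distr vimage_def Int_def conj_commute)

text \<open>At position \<open>y\<close> the shifted path is \<open>y\<close> plus the increments,
  and \<open>law y\<close> is \<open>law 0\<close> translated by \<open>y\<close>.\<close>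

theorem strong_markov:
  assumes T: "optional T" and E: "E \<in> sets path_space"
  shows "ePr x {w\<in>paths. T w < \<infinity> \<and> value_at T w = y \<and> shift_at T w \<in> E} =
    ePr x (stopped_at T y) * ePr y E"
proof -
  define E' where "E' = {w\<in>paths. (\<lambda>t\<in>{0..}. y + w t) \<in> E}"
  have E': "E' \<in> sets path_space"
    using measurable_sets[OF measurable_translate E] by (simp add: E'_def vimage_def Int_def conj_commute)
  have "shift s w \<in> E \<longleftrightarrow> incr s w \<in> E'" if "w \<in> paths" "0 \<le> s" "w s = y" for s w
  proof -
    have "(\<lambda>t\<in>{0..}. y + incr s w t) = shift s w"
      using that by (auto simp: incr_def shift_def fun_eq_iff)
    then show ?thesis using incr_path[OF that(1,2)] by (simp add: E'_def)
  qed
  then have "{w\<in>paths. T w < \<infinity> \<and> value_at T w = y \<and> shift_at T w \<in> E} =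
      {w\<in>paths. T w < \<infinity> \<and> value_at T w \<in> {y} \<and> incr_at T w \<in> E'}"
    using optional_nonneg_real[OF T] by blast
  then show ?thesis
    using strong_markov_joint[OF T _ E', of "{y}" x] emeasure_law_translate[OF E, of 0 y]
    by (simp add: E'_def)
qed

end

subsection \<open>Hitting times\<close>

lemma hit_less_iff: "hit A w < t \<longleftrightarrow> (\<exists>s\<ge>0. ereal s < t \<and> w s \<in> A)"
  by (auto simp: hit_def INF_less_iff)

lemma hit_nonneg: "0 \<le> hit A w"
  unfolding hit_def by (rule INF_greatest) auto

lemma hit_le: "0 \<le> t \<Longrightarrow> w t \<in> A \<Longrightarrow> hit A w \<le> ereal t"
  unfolding hit_def by (rule INF_lower) auto

lemma hit_antimono: "A \<subseteq> B \<Longrightarrow> hit B w \<le> hit A w"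
  unfolding hit_def by (rule INF_superset_mono) auto

text \<open>By right-continuity a path stays in an open set for a short while after a visit, so
  rational times detect the visit.\<close>

lemma hit_open_less_iff:
  assumes "open A" "cadlag w"
  shows "hit A w < ereal t \<longleftrightarrow> (\<exists>s\<in>\<rat>. 0 \<le> s \<and> s < t \<and> w s \<in> A)"
proof
  assume "hit A w < ereal t"
  then obtain s where s: "0 \<le> s" "s < t" "w s \<in> A" by (auto simp: hit_less_iff)
  have "eventually (\<lambda>u. w u \<in> A) (at_right s)"
    using cadlag_right[OF assms(2) s(1)] assms(1) s(3) by (rule topological_tendstoD)
  then obtain b where b: "s < b" "\<And>u. s < u \<Longrightarrow> u < b \<Longrightarrow> w u \<in> A"
    using s(2) by (auto simp: eventually_at_right)
  have "s < min b t" using b(1) s(2) by simp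
  then obtain r where "r \<in> \<rat>" "s < r" "r < min b t"
    using Rats_dense_in_real by blast
  then show "\<exists>s\<in>\<rat>. 0 \<le> s \<and> s < t \<and> w s \<in> A"
    using b(2) s(1) by (intro bexI[of _ r]) auto
qed (auto simp: hit_less_iff)

lemma optional_hit_open:
  assumes "open A" shows "optional (hit A)"
  unfolding optional_def
proof (intro conjI ballI allI hit_nonneg)
  fix t :: real
  have "{w\<in>paths. hit A w < ereal t} =
      {w\<in>space (coord_algebra {0..t}). \<exists>s\<in>\<rat> \<inter> {0..<t}. w s \<in> A}"
    by (simp add: hit_open_less_iff[OF assms path_cadlag] Bex_def conj_assoc cong: conj_cong)
  also have "\<dots> \<in> sets (coord_algebra {0..t})"
  proof (rule sets.sets_Collect_countable_Ex')
    show "countable (\<rat> \<inter> {0..<t})"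
      by (rule countable_subset[OF _ countable_rat]) auto
    fix s assume "s \<in> \<rat> \<inter> {0..<t}"
    then have "(\<lambda>w. w s) \<in> borel_measurable (coord_algebra {0..t})"
      by (intro measurable_coord_algebra) auto
    from measurable_sets[OF this, of A] assms
    show "{w \<in> space (coord_algebra {0..t}). w s \<in> A} \<in> sets (coord_algebra {0..t})"
      by (simp add: vimage_def Int_def conj_commute)
  qed
  finally show "{w\<in>paths. hit A w < ereal t} \<in> sets (coord_algebra {0..t})" .
qed

text \<open>The infimum need not be attained. If the path were outside \<open>C\<close> at that
  time, right-continuity would keep it outside a little longer, although \<open>A\<close> is visited
  within every such interval.\<close>

lemma hit_attained_or_limit:
  assumes "cadlag w" "hit A w < \<infinity>" "closed C" "A \<subseteq> C"
  shows "value_at (hit A) w \<in> C"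
proof -
  obtain s where s: "hit A w = ereal s" "0 \<le> s"
    using assms(2) hit_nonneg[of A w] by (cases "hit A w") auto
  show ?thesis
  proof (rule ccontr)
    assume "\<not> ?thesis"
    then have ns: "w s \<in> - C" using s by simp
    have "eventually (\<lambda>u. w u \<in> - C) (at_right s)"
      using cadlag_right[OF assms(1) s(2)] assms(3) ns by (intro topological_tendstoD) auto
    then obtain b where b: "s < b" "\<And>u. s < u \<Longrightarrow> u < b \<Longrightarrow> w u \<in> - C"
      by (auto simp: eventually_at_right[of s "s + 1"])
    have "hit A w < ereal b" using s b by simp
    then obtain u where u: "0 \<le> u" "u < b" "w u \<in> A" by (auto simp: hit_less_iff)
    have "s \<le> u" using hit_le[OF u(1), of w A] u(3) s by simp
    then show False using u b(2)[of u] ns assms(4) by (cases "u = s") auto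
  qed
qed

text \<open>Open neighbourhoods shrinking to the closure of \<open>B\<close>. As
  \<open>infdist\<close> to the empty set is 0, an empty \<open>B\<close> would have the whole line
  as neighbourhood; hence the nonemptiness assumptions below.\<close>

definition near :: "real set \<Rightarrow> nat \<Rightarrow> real set" where
  "near B m = {y. infdist y B < 1 / real (Suc m)}"

lemma open_near: "open (near B m)"
  unfolding near_def by (intro open_Collect_less continuous_intros)

lemma subset_near: "B \<subseteq> near B m"
  by (auto simp: near_def)

lemma near_antimono: "m \<le> n \<Longrightarrow> near B n \<subseteq> near B m"
proof -
  assume "m \<le> n"
  then have "1 / real (Suc n) \<le> 1 / real (Suc m)" by (simp add: frac_le)
  then show ?thesis unfolding near_def by (auto simp del: of_nat_Suc)
qed

text \<open>An everywhere measurable version of \<open>hit B\<close>; the two agree almost surely because the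
  process does not jump at the limit of the approximating times (quasi-left-continuity).\<close>

definition reg_hit :: "real set \<Rightarrow> path \<Rightarrow> ereal" where
  "reg_hit B w = (SUP m. hit (near B m) w)"

lemma reg_hit_nonneg: "0 \<le> reg_hit B w"
  unfolding reg_hit_def by (rule SUP_upper2[of 0]) (auto intro: hit_nonneg)

lemma reg_hit_le_hit: "reg_hit B w \<le> hit B w"
  unfolding reg_hit_def by (intro SUP_least hit_antimono subset_near)

lemma hit_near_le_reg_hit: "hit (near B m) w \<le> reg_hit B w"
  unfolding reg_hit_def by (rule SUP_upper) simp

lemma incseq_hit_near: "incseq (\<lambda>m. hit (near B m) w)"
  by (intro incseq_SucI hit_antimono near_antimono) simp

text \<open>A supremum can equal \<open>t\<close> although every term is below \<open>t\<close>, so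
  being below \<open>t\<close> is expressed by a margin \<open>1 / Suc k\<close> common to all
  terms.\<close>

lemma optional_reg_hit: "optional (reg_hit B)"
  unfolding optional_def
proof (intro conjI ballI allI reg_hit_nonneg)
  fix t :: real
  have "reg_hit B w < ereal t \<longleftrightarrow> (\<exists>k::nat. \<forall>m. hit (near B m) w < ereal (t - 1 / Suc k))" for w
  proof
    assume "reg_hit B w < ereal t"
    then obtain r where r: "reg_hit B w < ereal r" "ereal r < ereal t"
      using ereal_dense2 by blast
    then obtain k where "inverse (real (Suc k)) < t - r"
      using reals_Archimedean[of "t - r"] by auto
    then have "ereal r < ereal (t - 1 / Suc k)" by (simp add: inverse_eq_divide)
    then show "\<exists>k::nat. \<forall>m. hit (near B m) w < ereal (t - 1 / Suc k)"
      using r(1) hit_near_le_reg_hit by (meson le_less_trans less_trans)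
  next
    assume "\<exists>k::nat. \<forall>m. hit (near B m) w < ereal (t - 1 / Suc k)"
    then obtain k where "\<And>m. hit (near B m) w < ereal (t - 1 / Suc k)" by blast
    then have "reg_hit B w \<le> ereal (t - 1 / Suc k)"
      unfolding reg_hit_def by (intro SUP_least less_imp_le)
    also have "\<dots> < ereal t" by simp
    finally show "reg_hit B w < ereal t" .
  qed
  then have "{w\<in>paths. reg_hit B w < ereal t} =
     {w\<in>space (coord_algebra {0..t}). \<exists>k::nat. \<forall>m. hit (near B m) w < ereal (t - 1 / Suc k)}"
    by simp
  also have "\<dots> \<in> sets (coord_algebra {0..t})"
    using optional_less[OF optional_hit_open[OF open_near], of _ t B]
    by (intro sets.sets_Collect_countable_Ex sets.sets_Collect_countable_All) simp
  finally show "{w\<in>paths. reg_hit B w < ereal t} \<in> sets (coord_algebra {0..t})" .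
qed

lemma hit_near_tendsto: "(\<lambda>m. hit (near B m) w) \<longlonglongrightarrow> reg_hit B w"
  unfolding reg_hit_def by (rule LIMSEQ_SUP[OF incseq_hit_near])

text \<open>If the path jumps off \<open>B\<close> at the limit of the approximating times, then arbitrarily short
  time spans starting just before the limit see an increment of fixed size.\<close>

lemma reg_hit_missed:
  assumes w: "cadlag w" and B: "closed B" "B \<noteq> {}" and fin: "reg_hit B w < \<infinity>"
    and miss: "value_at (reg_hit B) w \<notin> B"
  defines "S \<equiv> \<lambda>m. real_of_ereal (hit (near B m) w)"
  obtains r :: nat where "eventually (\<lambda>j. eventually (\<lambda>m.
      1 / Suc r < \<bar>w (S m + 1 / Suc j) - w (S m)\<bar>) sequentially) sequentially"
proof -
  obtain T where T: "reg_hit B w = ereal T" "0 \<le> T"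
    using fin reg_hit_nonneg[of B w] by (cases "reg_hit B w") auto
  have S: "hit (near B m) w = ereal (S m)" "0 \<le> S m" "S m \<le> T" for m
    using hit_near_le_reg_hit[of B m w] hit_nonneg[of "near B m" w] T
    by (cases "hit (near B m) w"; simp add: S_def)+
  have S_lim: "S \<longlonglongrightarrow> T"
    using hit_near_tendsto[of B w] by (simp add: S(1) T(1))
  have near: "infdist (w (S m)) B \<le> 1 / Suc m" for m
  proof -
    have "w (S m) \<in> {y. infdist y B \<le> 1 / Suc m}"
      unfolding S_def
    proof (rule hit_attained_or_limit[OF w])
      show "hit (near B m) w < \<infinity>" by (simp only: S(1) ereal_infty_less(1)) simp
    qed (auto simp: near_def intro!: closed_Collect_le continuous_intros)
    then show ?thesis by simp
  qed
  have lim0: "(\<lambda>m. 1 / real (Suc m)) \<longlonglongrightarrow> 0"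
    by (rule LIMSEQ_Suc[OF lim_1_over_n])
  have inB: "L \<in> B" if "(\<lambda>m. w (S m)) \<longlonglongrightarrow> L" for L
  proof -
    have "(\<lambda>m. infdist (w (S m)) B) \<longlonglongrightarrow> infdist L B"
      by (rule tendsto_infdist[OF that])
    moreover have "(\<lambda>m. infdist (w (S m)) B) \<longlonglongrightarrow> 0"
      by (rule tendsto_sandwich[OF _ _ tendsto_const lim0]) (simp_all only: near infdist_nonneg eventually_True)
    ultimately have "infdist L B = 0" by (rule LIMSEQ_unique)
    then show ?thesis using in_closed_iff_infdist_zero[OF B] by simp
  qed
  have S_mono: "S m \<le> S n" if "m \<le> n" for m n
    using incseqD[OF incseq_hit_near that, of B w] by (simp add: S(1))
  \<comment> \<open>Had the approximating times reached the limit, they would be constant from then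
    on and the position there would be in \<open>B\<close>. So the limit is approached strictly from
    the left, where the left limit of the path counts.\<close>
  have less: "S m < T" for m
  proof (rule ccontr)
    assume "\<not> S m < T"
    then have "S n = T" if "m \<le> n" for n
      using S(3)[of n] S_mono[OF that] by simp
    then have "eventually (\<lambda>n. w T = w (S n)) sequentially"
      by (auto simp: eventually_sequentially intro!: exI[of _ m])
    then have "(\<lambda>n. w (S n)) \<longlonglongrightarrow> w T"
      by (rule Lim_transform_eventually[OF tendsto_const])
    then show False using inB miss T by simp
  qed
  then have "0 < T" using le_less_trans[OF S(2)] by blast
  obtain L where L: "(w \<longlongrightarrow> L) (at_left T)"
    using cadlag_left[OF w \<open>0 < T\<close>] .
  have filt: "filterlim (\<lambda>m. S m + d) (at_left (T + d)) sequentially" for d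
    unfolding filterlim_at using less S_lim
    by (auto intro!: tendsto_intros simp: less_imp_neq)
  have SL: "(\<lambda>m. w (S m)) \<longlonglongrightarrow> L"
    using filterlim_compose[OF L, of S sequentially] filt[of 0] by simp
  then have "L \<in> B" by (rule inB)
  then have "w T \<noteq> L" using miss T by auto
  then have "0 < \<bar>w T - L\<bar>" by simp
  then obtain r where r: "inverse (real (Suc r)) < \<bar>w T - L\<bar>" using reals_Archimedean by blast
  define e where "e = 1 / real (Suc r)"
  have "e < \<bar>w T - L\<bar>" using r by (simp add: e_def inverse_eq_divide)
  \<comment> \<open>Slack between the prescribed size \<open>e\<close> and the jump, so that a weak
    inequality in the limit still yields a strict one.\<close>
  define e' where "e' = (e + \<bar>w T - L\<bar>) / 2"
  have e': "e < e'" "e' < \<bar>w T - L\<bar>" using \<open>e < _\<close> by (auto simp: e'_def)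
  have "((\<lambda>u. \<bar>w u - L\<bar>) \<longlongrightarrow> \<bar>w T - L\<bar>) (at_right T)"
    using cadlag_right[OF w T(2)] by (intro tendsto_intros)
  then have "eventually (\<lambda>u. e' < \<bar>w u - L\<bar>) (at_right T)"
    using e'(2) by (rule order_tendstoD(1))
  then obtain b where b: "T < b" "\<And>u. T < u \<Longrightarrow> u < b \<Longrightarrow> e' < \<bar>w u - L\<bar>"
    by (auto simp: eventually_at_right[of T "T + 1"])
  have "eventually (\<lambda>j. 1 / real (Suc j) < b - T) sequentially"
    using b(1) by (intro order_tendstoD(2)[OF lim0]) simp
  then have "eventually (\<lambda>j. eventually (\<lambda>m. e < \<bar>w (S m + 1 / Suc j) - w (S m)\<bar>) sequentially) sequentially"
  proof eventually_elim
    case (elim j)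
    define d where "d = 1 / real (Suc j)"
    have "0 < d" "T + d < b" using elim by (auto simp: d_def)
    \<comment> \<open>\<open>S m + d\<close> approaches \<open>T + d\<close> from below, so its
      positions converge to the left limit there and not to the value.\<close>
    obtain L' where L': "(w \<longlongrightarrow> L') (at_left (T + d))"
      using cadlag_left[OF w, of "T + d"] \<open>0 < T\<close> \<open>0 < d\<close> by auto
    have "eventually (\<lambda>u. T < u \<and> u < T + d) (at_left (T + d))"
      using \<open>0 < d\<close> by (auto simp: eventually_at_left[of T "T + d"] intro!: exI[of _ T])
    then have "eventually (\<lambda>u. e' \<le> \<bar>w u - L\<bar>) (at_left (T + d))"
      by eventually_elim (use b(2) \<open>T + d < b\<close> in force)
    moreover have "((\<lambda>u. \<bar>w u - L\<bar>) \<longlongrightarrow> \<bar>L' - L\<bar>) (at_left (T + d))"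
      using L' by (intro tendsto_intros)
    ultimately have "e' \<le> \<bar>L' - L\<bar>"
      by (intro tendsto_lowerbound[of "\<lambda>u. \<bar>w u - L\<bar>" _ "at_left (T + d)"]) auto
    then have "e < \<bar>L' - L\<bar>" using e'(1) by simp
    moreover have "(\<lambda>m. \<bar>w (S m + d) - w (S m)\<bar>) \<longlonglongrightarrow> \<bar>L' - L\<bar>"
      using filterlim_compose[OF L' filt] SL by (intro tendsto_intros)
    ultimately have "eventually (\<lambda>m. e < \<bar>w (S m + d) - w (S m)\<bar>) sequentially"
      by (intro order_tendstoD(1))
    then show ?case by (simp add: d_def)
  qed
  then show ?thesis using that[of r] by (simp add: e_def)
qed

section \<open>Quasi-left-continuity, and the passage from the completed law to measurable
  events\<close>

context levy_process
begin

lemma sets_Collect_coordinate_gt: "{v\<in>paths. e < \<bar>v t\<bar>} \<in> sets path_space"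
  by (intro borel_measurable_less borel_measurable_abs measurable_coordinate borel_measurable_const)

text \<open>Almost every path starts at 0 and is right-continuous, hence exceeds \<open>e\<close> at
  the times \<open>1 / Suc j\<close> only finitely often.\<close>

lemma prob_small_time_tendsto:
  assumes "0 < e"
  shows "(\<lambda>j. Pr 0 {v\<in>paths. e < \<bar>v (1 / Suc j)\<bar>}) \<longlonglongrightarrow> 0"
proof -
  define E where "E j = {v\<in>paths. e < \<bar>v (1 / Suc j)\<bar>}" for j
  define B where "B n = (\<Union>j\<in>{n..}. E j)" for n
  have E: "E j \<in> sets path_space" for j
    unfolding E_def by (rule sets_Collect_coordinate_gt)
  then have B: "range B \<subseteq> sets (law 0)" by (auto simp: B_def)
  have "decseq B" by (force simp: B_def decseq_def)
  have null: "Pr 0 (\<Inter>n. B n) = 0"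
  proof -
    have "AE w in law 0. w \<notin> (\<Inter>n. B n)"
      using AE_law_start[of 0] AE_space
    proof eventually_elim
      case (elim w)
      have "((\<lambda>t. \<bar>w t\<bar>) \<longlongrightarrow> \<bar>w 0\<bar>) (at_right 0)"
        using elim by (intro tendsto_intros cadlag_right path_cadlag) auto
      moreover have "filterlim (\<lambda>j. 1 / real (Suc j)) (at_right 0) sequentially"
        unfolding filterlim_at using LIMSEQ_Suc[OF lim_1_over_n] by (auto simp del: of_nat_Suc)
      ultimately have "(\<lambda>j. \<bar>w (1 / real (Suc j))\<bar>) \<longlonglongrightarrow> 0"
        using filterlim_compose elim(1) by force
      then have "eventually (\<lambda>j. \<bar>w (1 / real (Suc j))\<bar> < e) sequentially"
        using assms by (rule order_tendstoD(2))
      then obtain n where "\<And>j. n \<le> j \<Longrightarrow> \<bar>w (1 / real (Suc j))\<bar> < e"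
        by (auto simp: eventually_sequentially simp del: of_nat_Suc)
      then have "w \<notin> B n" by (force simp: B_def E_def)
      then show ?case by blast
    qed
    moreover have "(\<Inter>n. B n) \<in> sets (law 0)" using B by auto
    ultimately show ?thesis by (subst law.prob_eq_0) auto
  qed
  have lim: "(\<lambda>n. Pr 0 (B n)) \<longlonglongrightarrow> 0"
    using law.finite_Lim_measure_decseq[OF B \<open>decseq B\<close>] null by simp
  have "(\<lambda>j. Pr 0 (E j)) \<longlonglongrightarrow> 0"
    by (rule tendsto_sandwich[OF _ _ tendsto_const lim])
      (use B in \<open>auto intro!: always_eventually law.finite_measure_mono simp: B_def\<close>)
  then show ?thesis by (simp add: E_def)
qed

text \<open>By the strong Markov property at the approximating times, a large increment over the
  next \<open>1 / Suc j\<close> has probability at most \<open>Pr 0 (E r j)\<close> for every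
  \<open>m\<close>, and this tends to 0 in \<open>j\<close>. So each \<open>N r\<close> is null, and
  a path missing \<open>B\<close> lies in one of them.\<close>

lemma AE_reg_hit_attained:
  assumes B: "closed B" "B \<noteq> {}"
  shows "AE w in law x. reg_hit B w < \<infinity> \<longrightarrow> value_at (reg_hit B) w \<in> B"
proof -
  define S where "S m w = real_of_ereal (hit (near B m) w)" for m w
  define E where "E r j = {v\<in>paths. 1 / real (Suc r) < \<bar>v (1 / Suc j)\<bar>}" for r j
  define A where "A r j m = {w\<in>paths. hit (near B m) w < \<infinity> \<and> incr (S m w) w \<in> E r j}" for r j m
  define N where "N r = (\<Union>n. \<Inter>j\<in>{n..}. \<Union>k. \<Inter>m\<in>{k..}. A r j m)" for r
  have opt: "optional (hit (near B m))" for m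
    by (rule optional_hit_open[OF open_near])
  have E: "E r j \<in> sets path_space" for r j
    unfolding E_def by (rule sets_Collect_coordinate_gt)
  have A: "A r j m \<in> sets path_space" for r j m
    unfolding A_def S_def
    by (rule sets_finite_time_incr[OF opt E])
      (auto simp: optional_nonneg_real[OF opt] intro!: borel_measurable_real_of_ereal measurable_optional opt)
  have A_le: "Pr x (A r j m) \<le> Pr 0 (E r j)" for r j m
  proof -
    have "ePr x (A r j m) = ePr x {w\<in>paths. hit (near B m) w < \<infinity>} * ePr 0 (E r j)"
      unfolding A_def S_def by (rule strong_markov_incr[OF opt E])
    also have "\<dots> \<le> 1 * ePr 0 (E r j)"
      by (intro mult_right_mono law.emeasure_le_1) simp
    finally show ?thesis by (simp add: law.emeasure_eq_measure)
  qed
  have U_le: "Pr x (\<Union>k. \<Inter>m\<in>{k..}. A r j m) \<le> Pr 0 (E r j)" for r j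
  proof -
    let ?B = "\<lambda>k. \<Inter>m\<in>{k..}. A r j m"
    have "(\<lambda>k. Pr x (?B k)) \<longlonglongrightarrow> Pr x (\<Union>k. ?B k)"
      by (rule law.finite_Lim_measure_incseq) (use A in \<open>auto simp: incseq_def\<close>)
    moreover have "Pr x (?B k) \<le> Pr 0 (E r j)" for k
      by (rule order_trans[OF law.finite_measure_mono A_le[of r j k]]) (use A in auto)
    ultimately show ?thesis by (intro LIMSEQ_le_const2) auto
  qed
  have N: "AE w in law x. w \<notin> N r" for r
  proof -
    have lim: "(\<lambda>j. Pr 0 (E r j)) \<longlonglongrightarrow> 0"
      unfolding E_def by (rule prob_small_time_tendsto) simp
    have "AE w in law x. w \<notin> (\<Inter>j\<in>{n..}. \<Union>k. \<Inter>m\<in>{k..}. A r j m)" for n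
    proof -
      let ?C = "\<Inter>j\<in>{n..}. \<Union>k. \<Inter>m\<in>{k..}. A r j m"
      have C: "?C \<in> sets (law x)" using A by auto
      have "Pr x ?C \<le> Pr 0 (E r j)" if "n \<le> j" for j
        by (rule order_trans[OF law.finite_measure_mono U_le[of r j]]) (use A that in auto)
      then have "Pr x ?C \<le> 0"
        by (intro LIMSEQ_le_const[OF lim]) auto
      then have "Pr x ?C = 0" using measure_nonneg[of "law x" ?C] by linarith
      then show ?thesis using C by (simp add: law.prob_eq_0)
    qed
    then have "AE w in law x. \<forall>n. w \<notin> (\<Inter>j\<in>{n..}. \<Union>k. \<Inter>m\<in>{k..}. A r j m)"
      by (simp only: AE_all_countable) blast
    then show ?thesis by eventually_elim (auto simp: N_def)
  qed
  then have "AE w in law x. \<forall>r. w \<notin> N r"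
    by (simp only: AE_all_countable) blast
  then show ?thesis
    using AE_space
  proof eventually_elim
    case (elim w)
    then have w: "w \<in> paths" by simp
    show ?case
    proof (intro impI, rule ccontr)
      assume fin: "reg_hit B w < \<infinity>" and miss: "value_at (reg_hit B) w \<notin> B"
      obtain r :: nat where r: "eventually (\<lambda>j. eventually (\<lambda>m.
          1 / Suc r < \<bar>w (S m w + 1 / Suc j) - w (S m w)\<bar>) sequentially) sequentially"
        using reg_hit_missed[OF path_cadlag[OF w] B fin miss] unfolding S_def by blast
      have S0: "0 \<le> S m w" for m
        unfolding S_def using hit_nonneg by (simp add: real_of_ereal_pos)
      have "w \<in> A r j m \<longleftrightarrow> 1 / Suc r < \<bar>w (S m w + 1 / Suc j) - w (S m w)\<bar>" for j m
        using w le_less_trans[OF hit_near_le_reg_hit fin, of m] incr_path[OF w S0[of m]]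
        by (simp add: A_def E_def incr_def)
      moreover have "w \<in> N r \<longleftrightarrow> (\<exists>n. \<forall>j\<ge>n. \<exists>k. \<forall>m\<ge>k. w \<in> A r j m)"
        unfolding N_def UN_iff INT_iff Ball_def atLeast_iff by simp
      ultimately have "w \<in> N r"
        using r unfolding eventually_sequentially by simp
      then show False using elim by blast
    qed
  qed
qed

lemma AE_reg_hit_eq_hit:
  assumes B: "closed B" "B \<noteq> {}"
  shows "AE w in law x. reg_hit B w = hit B w"
  using AE_reg_hit_attained[OF B]
proof eventually_elim
  case (elim w)
  show ?case
  proof (rule antisym[OF reg_hit_le_hit])
    show "hit B w \<le> reg_hit B w"
      using elim hit_le[of "real_of_ereal (reg_hit B w)" w B] reg_hit_nonneg[of B w]
      by (cases "reg_hit B w") auto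
  qed
qed

lemma measurable_reg_hit: "reg_hit B \<in> borel_measurable path_space"
  by (rule measurable_optional[OF optional_reg_hit])

lemma measure_strong_markov:
  assumes T: "optional T" and E: "E \<in> sets path_space"
  shows "Pr x {w\<in>paths. T w < \<infinity> \<and> value_at T w = y \<and> shift_at T w \<in> E} =
    Pr x (stopped_at T y) * Pr y E"
  unfolding measure_def strong_markov[OF assms] by (simp add: enn2real_mult)

lemma sets_restarted:
  assumes T: "optional T" and B: "B \<in> sets borel" and E: "E \<in> sets path_space"
  shows "restarted T B E \<in> sets path_space"
proof -
  have [measurable]: "T \<in> borel_measurable path_space" by (rule measurable_optional[OF T])
  have \<tau>: "(\<lambda>w. real_of_ereal (T w)) \<in> borel_measurable path_space" by measurable
  note pos = optional_nonneg_real[OF T]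
  from sets.Int[OF sets_optional_finite[OF T] sets.Int[OF measurable_sets[OF measurable_eval[OF \<tau> pos] B]
      measurable_sets[OF measurable_shift_random[OF \<tau> pos] E]]]
  show ?thesis by (rule back_subst[of "\<lambda>A. A \<in> sets path_space"]) auto
qed

lemma sets_stopped_at:
  assumes T: "optional T" and B: "B \<in> sets borel"
  shows "{w\<in>paths. T w < \<infinity> \<and> value_at T w \<in> B} \<in> sets path_space"
proof -
  have "{w\<in>paths. T w < \<infinity> \<and> value_at T w \<in> B} = restarted T B paths"
    using shift_path optional_nonneg_real[OF T] by auto
  then show ?thesis
    using sets_restarted[OF assms sets.top] by (simp only:)
qed

text \<open>By the strong Markov property the restarted path meets an exceptional set of
  \<open>law y\<close> with probability 0.\<close>

lemma AE_shift:
  assumes T: "optional T" and Q: "AE v in law y. Q v"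
  shows "AE w in law x. T w < \<infinity> \<longrightarrow> value_at T w = y \<longrightarrow> Q (shift_at T w)"
proof -
  obtain N where N: "{v \<in> space (law y). \<not> Q v} \<subseteq> N" "ePr y N = 0" "N \<in> sets (law y)"
    using Q by (auto elim: AE_E)
  let ?N = "{w\<in>paths. T w < \<infinity> \<and> value_at T w = y \<and> shift_at T w \<in> N}"
  have N': "N \<in> sets path_space" using N(3) by simp
  have sets: "?N \<in> sets path_space"
    using sets_restarted[OF T _ N', of "{y}"] by simp
  have "ePr x ?N = 0"
    unfolding strong_markov[OF T N'] by (simp add: N(2))
  with sets have "AE w in law x. w \<notin> ?N"
    by (intro AE_not_in null_setsI) auto
  then show ?thesis
    using AE_space
  proof eventually_elim
    case (elim w)
    then have "shift_at T w \<in> paths"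
      by (intro shift_path optional_nonneg_real[OF T]) auto
    then show ?case using elim N(1) by auto
  qed
qed

text \<open>Bridge to the statement of the theorem: almost sure agreement with a raw event gives
  measurability for the completed law as well as the value. The raw events will be those of
  \<open>reg_hit\<close>.\<close>

lemma levy_prob_eq_measure:
  assumes "E' \<in> sets path_space" "AE w in law x. E w \<longleftrightarrow> w \<in> E'"
  shows "levy_prob P X x E = Pr x E'"
proof -
  interpret C: prob_space "completion (law x)"
    by (rule law.prob_space_completion)
  have E': "E' \<in> sets (law x)" using assms(1) by simp
  have ae: "AE w in completion (law x). E w \<longleftrightarrow> w \<in> E'"
    by (rule AE_completion[OF assms(2)])
  have sub: "E' \<subseteq> paths" by (rule sets.sets_into_space[OF assms(1)])
  have "{w \<in> space (completion (law x)). E w} \<in> sets (completion (law x))"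
  proof (rule complete_measure.in_sets_AE)
    show "complete_measure (completion (law x))" by (rule completion.complete_measure_axioms)
  next
    show "AE w in completion (law x). (w \<in> E') \<longleftrightarrow> w \<in> {w \<in> space (completion (law x)). E w}"
      using ae AE_space by eventually_elim auto
    show "E' \<in> sets (completion (law x))" using E' by (rule sets_completionI_sets)
    show "{w \<in> space (completion (law x)). E w} \<subseteq> space (completion (law x))" by auto
  qed
  then have "measure (completion (law x)) {w \<in> space (completion (law x)). E w} = measure (completion (law x)) E'"
    using ae E' by (intro C.finite_measure_eq_AE) (auto intro: sets_completionI_sets)
  also have "\<dots> = Pr x E'"
    using E' by (rule measure_completion)
  finally show ?thesis by (simp add: levy_prob_def levy_law_eq)
qed

end

subsection \<open>First hits of finite sets\<close>

text \<open>With no visit before \<open>t\<close>, the visits of \<open>w\<close> are those of the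
  shifted path delayed by \<open>t\<close>. The epsilon accounts for an infimum that is not
  attained.\<close>

lemma hit_shift:
  assumes "0 \<le> t" "ereal t \<le> hit A w"
  shows "hit A w = ereal t + hit A (shift t w)"
proof (rule antisym)
  show "hit A w \<le> ereal t + hit A (shift t w)"
  proof (cases "hit A (shift t w)")
    case (real r)
    show ?thesis
    proof (rule ereal_le_epsilon2)
      fix e :: real assume "0 < e"
      then have "hit A (shift t w) < ereal (r + e)" using real by simp
      then obtain s where s: "0 \<le> s" "s < r + e" "shift t w s \<in> A" by (auto simp: hit_less_iff)
      then have "hit A w \<le> ereal (t + s)"
        using assms(1) by (intro hit_le) (auto simp: shift_def)
      also have "\<dots> \<le> ereal (t + (r + e))" using s by simp
      finally show "hit A w \<le> ereal t + hit A (shift t w) + ereal e" using real by (simp add: add.assoc)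
    qed
  qed (use hit_nonneg[of A "shift t w"] in auto)
  show "ereal t + hit A (shift t w) \<le> hit A w"
    unfolding hit_def[of A w]
  proof (rule INF_greatest)
    fix s assume s: "s \<in> {s. 0 \<le> s \<and> w s \<in> A}"
    then have "ereal t \<le> ereal s" using order_trans[OF assms(2) hit_le[of s w A]] by simp
    then have "hit A (shift t w) \<le> ereal (s - t)"
      using s by (intro hit_le) (auto simp: shift_def)
    then have "ereal t + hit A (shift t w) \<le> ereal t + ereal (s - t)" by (intro add_left_mono)
    then show "ereal t + hit A (shift t w) \<le> ereal s" by simp
  qed
qed

lemma hit_shift_le:
  assumes "0 \<le> t"
  shows "hit A w \<le> ereal t + hit A (shift t w)"
proof (cases "ereal t \<le> hit A w")
  case False
  then have "hit A w \<le> ereal t" by simp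
  also have "\<dots> \<le> ereal t + hit A (shift t w)" using hit_nonneg[of A "shift t w"] by (cases "hit A (shift t w)") auto
  finally show ?thesis .
qed (use hit_shift[OF assms, of A w] in simp)

lemma reg_hit_shift_le:
  assumes "0 \<le> t"
  shows "reg_hit A w \<le> ereal t + reg_hit A (shift t w)"
  unfolding reg_hit_def[of A w]
  by (intro SUP_least order_trans[OF hit_shift_le[OF assms]] add_left_mono hit_near_le_reg_hit)

context levy_process
begin

lemma AE_reg_hit_eq_hit_singleton: "AE w in law x. reg_hit {b} w = hit {b} w"
  by (rule AE_reg_hit_eq_hit) auto

lemma AE_reg_hit_attained_singleton: "AE w in law x. reg_hit {b} w < \<infinity> \<longrightarrow> value_at (reg_hit {b}) w \<in> {b}"
  by (rule AE_reg_hit_attained) auto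

lemma measure_strong_markov_sum:
  assumes T: "optional T" and B: "finite B" and E: "E \<in> sets path_space"
  shows "Pr x (restarted T B E) = (\<Sum>y\<in>B. Pr x (stopped_at T y) * Pr y E)"
proof -
  let ?A = "\<lambda>y. {w\<in>paths. T w < \<infinity> \<and> value_at T w = y \<and> shift_at T w \<in> E}"
  have A: "?A y \<in> sets path_space" for y
    using sets_restarted[OF T _ E, of "{y}"] by simp
  have "restarted T B E = (\<Union>y\<in>B. ?A y)"
    by auto
  then have "Pr x (restarted T B E) = Pr x (\<Union>y\<in>B. ?A y)"
    by (rule arg_cong)
  also have "\<dots> = (\<Sum>y\<in>B. Pr x (?A y))"
    using A by (intro law.finite_measure_finite_Union B) (auto simp: disjoint_family_on_def)
  finally show ?thesis by (simp only: measure_strong_markov[OF T E])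
qed

lemma sum_measure_stopped_at:
  assumes T: "optional T" and B: "finite B"
  shows "(\<Sum>y\<in>B. Pr x (stopped_at T y)) = Pr x {w\<in>paths. T w < \<infinity> \<and> value_at T w \<in> B}"
proof -
  have "restarted T B paths = {w\<in>paths. T w < \<infinity> \<and> value_at T w \<in> B}"
    using shift_path optional_nonneg_real[OF T] by auto
  then show ?thesis
    using measure_strong_markov_sum[OF T B sets.top, of x] law.prob_space by simp
qed

text \<open>The quantity Q_B(x, y) of the overview, with the target written before the starting
  point; \<open>hit_before b c x\<close> is likewise h_b(x).\<close>

definition first_hit :: "real set \<Rightarrow> real \<Rightarrow> real \<Rightarrow> real" where
  "first_hit B y x = Pr x (stopped_at (reg_hit B) y)"

definition hit_before :: "real \<Rightarrow> real \<Rightarrow> real \<Rightarrow> real" where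
  "hit_before b c x = Pr x {w\<in>paths. reg_hit {b} w < reg_hit {c} w}"

lemma first_hit_nonneg: "0 \<le> first_hit B y x"
  by (simp add: first_hit_def)

lemma sets_reg_hit_less: "{w\<in>paths. reg_hit A w < reg_hit B w} \<in> sets path_space"
  by (intro borel_measurable_less measurable_reg_hit)

text \<open>The shift identity holds path by path for \<open>hit\<close>. Almost surely
  \<open>reg_hit\<close> agrees with it before the shift and, by \<open>AE_shift\<close> at each of
  the finitely many points of \<open>B\<close>, also after it.\<close>

lemma AE_reg_hit_shift:
  assumes "finite B" "A \<subseteq> B" "A \<noteq> {}"
  shows "AE w in law x. reg_hit B w < \<infinity> \<longrightarrow>
    reg_hit A w = reg_hit B w + reg_hit A (shift_at (reg_hit B) w)"
proof -
  have A: "closed A" and B: "closed B" "B \<noteq> {}"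
    using assms finite_imp_closed finite_subset by blast+
  have "AE w in law x. \<forall>y\<in>B. reg_hit B w < \<infinity> \<longrightarrow> value_at (reg_hit B) w = y \<longrightarrow>
      reg_hit A (shift_at (reg_hit B) w) = hit A (shift_at (reg_hit B) w)"
    by (intro AE_finite_allI assms(1) AE_shift[OF optional_reg_hit] AE_reg_hit_eq_hit A assms(3))
  then show ?thesis
    using AE_reg_hit_eq_hit[OF A assms(3)] AE_reg_hit_eq_hit[OF B] AE_reg_hit_attained[OF B]
  proof eventually_elim
    case (elim w)
    show ?case
    proof
      assume fin: "reg_hit B w < \<infinity>"
      then obtain t where t: "reg_hit B w = ereal t" "0 \<le> t"
        using reg_hit_nonneg[of B w] by (cases "reg_hit B w") auto
      have "ereal t \<le> hit A w"
        using hit_antimono[OF assms(2), of w] elim(3) t by simp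
      from hit_shift[OF t(2) this] have "hit A w = ereal t + hit A (shift t w)" .
      moreover have "reg_hit A (shift t w) = hit A (shift t w)"
        using bspec[OF elim(1), of "w t"] elim(4) fin by (simp add: t(1))
      ultimately show "reg_hit A w = reg_hit B w + reg_hit A (shift_at (reg_hit B) w)"
        using elim(2) by (simp add: t(1))
    qed
  qed
qed

text \<open>At a finite first hit of \<open>B\<close> both hitting times are reduced by the same
  amount, so the restarted path decides their order. If \<open>B\<close> is never hit, neither is
  \<open>b\<close>.\<close>

lemma hit_before_decomposition:
  assumes B: "finite B" "b \<in> B" "c \<in> B"
  shows "hit_before b c x = (\<Sum>y\<in>B. first_hit B y x * hit_before b c y)"
proof -
  define E where "E = {w\<in>paths. reg_hit {b} w < reg_hit {c} w}"
  have E: "E \<in> sets path_space" unfolding E_def by (rule sets_reg_hit_less)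
  have B': "closed B" "B \<noteq> {}" using B finite_imp_closed by auto
  let ?F = "restarted (reg_hit B) B E"
  have shift_b: "AE w in law x. reg_hit B w < \<infinity> \<longrightarrow> reg_hit {b} w = reg_hit B w + reg_hit {b} (shift_at (reg_hit B) w)"
    by (rule AE_reg_hit_shift[OF B(1)]) (use B in auto)
  have shift_c: "AE w in law x. reg_hit B w < \<infinity> \<longrightarrow> reg_hit {c} w = reg_hit B w + reg_hit {c} (shift_at (reg_hit B) w)"
    by (rule AE_reg_hit_shift[OF B(1)]) (use B in auto)
  have "AE w in law x. w \<in> E \<longleftrightarrow> w \<in> ?F"
    using shift_b shift_c AE_reg_hit_attained[OF B', of x]
      AE_reg_hit_eq_hit[OF B', of x] AE_reg_hit_eq_hit_singleton[of b x] AE_space[of "law x"]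
  proof eventually_elim
    case (elim w)
    then have w: "w \<in> paths" by simp
    show ?case
    proof (cases "reg_hit B w < \<infinity>")
      case True
      then obtain t where t: "reg_hit B w = ereal t" "0 \<le> t"
        using reg_hit_nonneg[of B w] by (cases "reg_hit B w") auto
      have "shift t w \<in> paths" by (rule shift_path[OF w t(2)])
      moreover have "reg_hit {b} w < reg_hit {c} w \<longleftrightarrow> reg_hit {b} (shift t w) < reg_hit {c} (shift t w)"
        using elim(1,2) B True by (simp add: t(1) ereal_add_strict_mono2 less_le_not_le ereal_add_le_add_iff)
      ultimately show ?thesis using elim(3) True w by (simp add: E_def t(1))
    next
      case False
      have "hit B w \<le> hit {b} w" using B by (intro hit_antimono) auto
      then have "reg_hit {b} w = \<infinity>" using elim False by auto
      then show ?thesis using False by (simp add: E_def)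
    qed
  qed
  then have "Pr x E = Pr x ?F"
    using E sets_restarted[OF optional_reg_hit borel_closed[OF B'(1)] E] by (intro law.finite_measure_eq_AE) auto
  also have "\<dots> = (\<Sum>y\<in>B. first_hit B y x * hit_before b c y)"
    unfolding measure_strong_markov_sum[OF optional_reg_hit B(1) E] by (simp add: first_hit_def hit_before_def E_def)
  finally show ?thesis by (simp add: hit_before_def E_def)
qed

lemma AE_reg_hit_start: "AE w in law b. b \<in> B \<longrightarrow> reg_hit B w = 0"
  using AE_law_start
proof eventually_elim
  case (elim w)
  then show ?case
    using hit_le[of 0 w B] reg_hit_le_hit[of B w] reg_hit_nonneg[of B w] by (auto simp: zero_ereal_def intro: antisym)
qed

lemma hit_before_self: "hit_before b c c = 0"
proof -
  have "AE w in law c. w \<notin> {w\<in>paths. reg_hit {b} w < reg_hit {c} w}"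
    using AE_reg_hit_start[of c "{c}"]
    by eventually_elim (simp add: reg_hit_nonneg not_less)
  then show ?thesis
    unfolding hit_before_def using sets_reg_hit_less[of "{b}" "{c}"] by (subst law.prob_eq_0) auto
qed

text \<open>A hit at time 0 would be attained and would put the starting point in
  \<open>B\<close>.\<close>

lemma AE_reg_hit_pos:
  assumes B: "closed B" "B \<noteq> {}" "x \<notin> B"
  shows "AE w in law x. 0 < reg_hit B w"
  using AE_reg_hit_attained[OF B(1,2)] AE_law_start[of x]
proof eventually_elim
  case (elim w)
  then have "reg_hit B w \<noteq> 0" using B(3) by auto
  then show ?case using reg_hit_nonneg[of B w] by simp
qed

lemma hit_before_start:
  assumes "b \<noteq> c" shows "hit_before b c b = 1"
proof -
  have "AE w in law b. w \<in> {w\<in>paths. reg_hit {b} w < reg_hit {c} w}"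
    using AE_reg_hit_start[of b "{b}"] AE_reg_hit_pos[of "{c}" b, simplified, OF assms] AE_space[of "law b"]
    by eventually_elim auto
  then show ?thesis
    unfolding hit_before_def using sets_reg_hit_less[of "{b}" "{c}"] by (subst law.prob_eq_1) auto
qed

lemma hit_before_le_1: "hit_before b c x \<le> 1"
  unfolding hit_before_def by (rule law.prob_le_1)

lemma levy_prob_hit_less: "levy_prob P X x (\<lambda>w. hit {b} w < hit {c} w) = hit_before b c x"
  unfolding hit_before_def
proof (rule levy_prob_eq_measure[OF sets_reg_hit_less])
  show "AE w in law x. hit {b} w < hit {c} w \<longleftrightarrow> w \<in> {w \<in> paths. reg_hit {b} w < reg_hit {c} w}"
    using AE_reg_hit_eq_hit_singleton[of b x] AE_reg_hit_eq_hit_singleton[of c x] AE_space[of "law x"]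
    by eventually_elim simp
qed

text \<open>At a finite hitting time of \<open>{b}\<close> the path is almost surely at
  \<open>b\<close>, so equality of the two times places the first hit of \<open>B\<close> at
  \<open>b\<close>; conversely, being at \<open>b\<close> then is itself a hit of
  \<open>{b}\<close>.\<close>

lemma levy_prob_hit_first:
  assumes B: "finite B" "b \<in> B"
  shows "levy_prob P X x (\<lambda>w. hit {b} w = hit B w \<and> hit B w < \<infinity>) = first_hit B b x"
  unfolding first_hit_def
proof (rule levy_prob_eq_measure)
  have B': "closed B" "B \<noteq> {}" using B finite_imp_closed by auto
  show "stopped_at (reg_hit B) b \<in> sets path_space"
    using sets_stopped_at[OF optional_reg_hit, of "{b}" B] by simp
  show "AE w in law x. (hit {b} w = hit B w \<and> hit B w < \<infinity>) \<longleftrightarrow>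
      w \<in> stopped_at (reg_hit B) b"
    using AE_reg_hit_eq_hit_singleton[of b x] AE_reg_hit_eq_hit[OF B', of x] AE_reg_hit_attained_singleton[of b x] AE_space[of "law x"]
  proof eventually_elim
    case (elim w)
    have "hit {b} w = hit B w" if fin: "hit B w < \<infinity>" and at: "value_at (hit B) w = b"
    proof (rule antisym)
      show "hit B w \<le> hit {b} w" using B by (intro hit_antimono) auto
      obtain t where "hit B w = ereal t" "0 \<le> t"
        using fin hit_nonneg[of B w] by (cases "hit B w") auto
      then show "hit {b} w \<le> hit B w" using hit_le[of t w "{b}"] at by simp
    qed
    then show ?case using elim by auto
  qed
qed

lemma sum_first_hit: "finite B \<Longrightarrow> (\<Sum>y\<in>B. first_hit B y x) \<le> 1"
  unfolding first_hit_def by (simp only: sum_measure_stopped_at[OF optional_reg_hit] law.prob_le_1)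

end

subsection \<open>Returning before hitting another point\<close>

lemma hit_eq_infinity_iff: "hit A w = \<infinity> \<longleftrightarrow> (\<forall>s\<ge>0. w s \<notin> A)"
  using hit_less_iff[of A w \<infinity>] by auto

text \<open>If a process started at \<open>x\<close> surely returned to \<open>x\<close> before meeting \<open>c\<close>, it would never
  belong to any of these sets.\<close>

definition settled :: "real \<Rightarrow> real \<Rightarrow> real \<Rightarrow> path set" where
  "settled c R t = {w\<in>paths. reg_hit {c} w \<le> ereal t \<or> hit {- R<..<R} (shift (max t 0) w) = \<infinity>}"

text \<open>The definition goes through the hitting time of an open interval for the sake of
  measurability; arguments use this form. Negative \<open>t\<close> occur because the propagation in
  \<open>t\<close> starts before time 0.\<close>

lemma settled_iff:
  assumes "w \<in> paths"
  shows "w \<in> settled c R t \<longleftrightarrow> reg_hit {c} w \<le> ereal t \<or> (\<forall>s\<ge>max t 0. R \<le> \<bar>w s\<bar>)"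
proof -
  have "hit {- R<..<R} (shift (max t 0) w) = \<infinity> \<longleftrightarrow> (\<forall>s\<ge>max t 0. R \<le> \<bar>w s\<bar>)" (is "?l \<longleftrightarrow> ?r")
  proof
    assume l: ?l
    show ?r
    proof (intro allI impI)
      fix s assume s: "max t 0 \<le> s"
      then have "shift (max t 0) w (s - max t 0) \<notin> {- R<..<R}"
        using l by (simp add: hit_eq_infinity_iff)
      then show "R \<le> \<bar>w s\<bar>" using s by (auto simp: shift_def)
    qed
  next
    assume r: ?r
    have "shift (max t 0) w s \<notin> {- R<..<R}" if "0 \<le> s" for s
      using r[rule_format, of "max t 0 + s"] that by (auto simp: shift_def)
    then show ?l by (simp add: hit_eq_infinity_iff)
  qed
  then show ?thesis using assms by (simp add: settled_def)
qed

lemma sets_settled: "settled c R t \<in> sets path_space"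
proof -
  have 1: "{w\<in>paths. reg_hit {c} w \<le> ereal t} \<in> sets path_space"
    by (intro borel_measurable_le measurable_optional optional_reg_hit borel_measurable_const)
  have "(\<lambda>w. shift (max t 0) w) \<in> path_space \<rightarrow>\<^sub>M path_space"
    by (rule measurable_shift_random) simp_all
  from measurable_compose[OF this measurable_optional[OF optional_hit_open]]
  have "(\<lambda>w. hit {- R<..<R} (shift (max t 0) w)) \<in> borel_measurable path_space" by simp
  from measurable_sets[OF this, of "{\<infinity>}"]
  have 2: "{w\<in>paths. hit {- R<..<R} (shift (max t 0) w) = \<infinity>} \<in> sets path_space"
    by (simp add: vimage_def Int_def conj_commute)
  have "settled c R t = {w\<in>paths. reg_hit {c} w \<le> ereal t} \<union>
      {w\<in>paths. hit {- R<..<R} (shift (max t 0) w) = \<infinity>}"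
    by (auto simp: settled_def)
  then show ?thesis using sets.Un[OF 1 2] by simp
qed

lemma settled_mono: assumes "t \<le> u" shows "settled c R t \<subseteq> settled c R u"
proof
  fix w assume w: "w \<in> settled c R t"
  then have sp: "w \<in> paths" by (simp add: settled_def)
  from w have "reg_hit {c} w \<le> ereal t \<or> (\<forall>s\<ge>max t 0. R \<le> \<bar>w s\<bar>)"
    by (simp only: settled_iff[OF sp])
  moreover have "reg_hit {c} w \<le> ereal u" if "reg_hit {c} w \<le> ereal t"
    using that assms by (meson ereal_less_eq(3) order_trans)
  moreover have "\<forall>s\<ge>max u 0. R \<le> \<bar>w s\<bar>" if "\<forall>s\<ge>max t 0. R \<le> \<bar>w s\<bar>"
    using that assms by auto
  ultimately show "w \<in> settled c R u" unfolding settled_iff[OF sp] by blast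
qed

text \<open>A path inside the interval at time \<open>s\<close> has not left it for good by then,
  and \<open>eq\<close> says that meeting \<open>c\<close> is still ahead or happens at
  \<open>s\<close>. So settling by \<open>t\<close> becomes settling by \<open>t - s\<close> after
  the restart.\<close>

lemma shift_settled:
  assumes w: "w \<in> paths" "w \<in> settled c R t" and s: "0 \<le> s" "\<bar>w s\<bar> < R"
    and eq: "reg_hit {c} w = ereal s + reg_hit {c} (shift s w)"
  shows "shift s w \<in> settled c R (t - s)"
proof -
  have sw: "shift s w \<in> paths" by (rule shift_path[OF w(1) s(1)])
  consider "reg_hit {c} w \<le> ereal t" | "\<forall>u\<ge>max t 0. R \<le> \<bar>w u\<bar>"
    using w(2) by (auto simp only: settled_iff[OF w(1)])
  then show ?thesis
  proof cases
    case 1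
    then have "reg_hit {c} (shift s w) \<le> ereal (t - s)"
      using eq reg_hit_nonneg[of "{c}" "shift s w"] by (cases "reg_hit {c} (shift s w)") auto
    then show ?thesis by (simp add: settled_iff[OF sw])
  next
    case 2
    then have "s < max t 0" using s(2) by (meson leD not_le)
    then have "s < t" using s(1) by (simp add: max_def split: if_splits)
    have "R \<le> \<bar>shift s w u\<bar>" if "max (t - s) 0 \<le> u" for u
      using 2[rule_format, of "s + u"] that s(1) by (simp add: shift_def)
    then show ?thesis by (simp add: settled_iff[OF sw])
  qed
qed

context levy_process
begin

text \<open>From \<open>y\<close> the path almost surely reaches \<open>x\<close> before
  \<open>c\<close>, and at \<open>x\<close> it is inside the interval. It can therefore only settle
  after restarting at \<open>x\<close>, with no more than \<open>t\<close> left.\<close>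

lemma settled_before_return:
  assumes h: "hit_before x c y = 1" and R: "\<bar>x\<bar> < R"
  shows "Pr y (settled c R t) \<le> Pr x (settled c R t)"
proof -
  let ?T = "reg_hit {x, c}"
  let ?F = "{w\<in>paths. ?T w < \<infinity> \<and> value_at ?T w = x \<and> shift_at ?T w \<in> settled c R t}"
  have F: "?F \<in> sets path_space"
    using sets_restarted[OF optional_reg_hit _ sets_settled, of "{x}"] by simp
  have cl: "closed {x, c}" "{x, c} \<noteq> {}" by auto
  have "AE w in law y. reg_hit {x} w < reg_hit {c} w"
    using h AE_space[of "law y"] unfolding hit_before_def
    by (subst (asm) law.prob_eq_1) (auto simp: sets_reg_hit_less)
  then have "AE w in law y. w \<in> settled c R t \<longrightarrow> w \<in> ?F"
    using AE_reg_hit_shift[of "{x, c}" "{c}" y, simplified] AE_reg_hit_attained[OF cl, of y]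
      AE_reg_hit_eq_hit[OF cl, of y] AE_reg_hit_eq_hit_singleton[of x y] AE_reg_hit_eq_hit_singleton[of c y] AE_space[of "law y"]
  proof eventually_elim
    case (elim w)
    then have w: "w \<in> paths" by simp
    have less: "hit {x} w < hit {c} w" using elim by simp
    have le: "?T w \<le> hit {x} w" using hit_antimono[of "{x}" "{x, c}" w] elim by simp
    have fin: "?T w < \<infinity>" using le_less_trans[OF le less_le_trans[OF less, of \<infinity>]] by simp
    then obtain s where s: "?T w = ereal s" "0 \<le> s"
      using reg_hit_nonneg[of "{x, c}" w] by (cases "?T w") auto
    have "w s \<noteq> c"
    proof
      assume "w s = c"
      then have "hit {c} w \<le> ?T w" using hit_le[of s w "{c}"] s by simp
      then show False using le less by simp
    qed
    then have ws: "w s = x" using elim(3) fin s by auto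
    show ?case
    proof
      assume "w \<in> settled c R t"
      then have "shift s w \<in> settled c R (t - s)"
        using shift_settled[OF w _ s(2)] R ws elim(2) fin s by simp
      then have "shift s w \<in> settled c R t"
        using settled_mono[of "t - s" t c R] s(2) by auto
      then show "w \<in> ?F" using w fin ws s by simp
    qed
  qed
  then have "Pr y (settled c R t) \<le> Pr y ?F"
    using F by (intro law.finite_measure_mono_AE) auto
  also have "\<dots> = Pr y (stopped_at ?T x) * Pr x (settled c R t)"
    by (rule measure_strong_markov[OF optional_reg_hit sets_settled])
  also have "\<dots> \<le> 1 * Pr x (settled c R t)"
    by (intro mult_right_mono law.prob_le_1) simp
  finally show ?thesis by simp
qed

text \<open>Split at the first hit of \<open>B\<close>, at time \<open>s\<close>. If
  \<open>s < d\<close>, the clock left is at most \<open>t + d\<close>, otherwise at most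
  \<open>t\<close>. From the point hit, \<open>x\<close> is surely reached before \<open>c\<close>,
  so \<open>settled_before_return\<close> replaces that point by \<open>x\<close>.\<close>

lemma settled_step:
  assumes B: "finite B" "c \<in> B" "x \<notin> B"
    and sure: "(\<Sum>y\<in>B. first_hit B y x * hit_before x c y) = 1"
    and R: "\<bar>x\<bar> < R" "\<And>y. y \<in> B \<Longrightarrow> \<bar>y\<bar> < R"
  shows "Pr x (settled c R (t + d)) \<le>
    Pr x {w\<in>paths. reg_hit B w < ereal d} * Pr x (settled c R (t + d))
      + Pr x (settled c R t)"
proof -
  have B': "closed B" "B \<noteq> {}" using B finite_imp_closed by auto
  let ?T = "reg_hit B"
  define T' where "T' w = (if ?T w < ereal d then ?T w else \<infinity>)" for w
  define q where "q y = Pr x (stopped_at T' y)" for y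
  have optT': "optional T'"
    unfolding T'_def by (rule optional_before[OF optional_reg_hit])
  have T'_fin: "T' w < \<infinity> \<longleftrightarrow> ?T w < ereal d" for w
    by (auto simp: T'_def intro: less_trans)
  \<comment> \<open>The weights sum to at most 1 and the factors are at most 1, so a total of 1
    leaves no slack: the factor is 1 wherever the weight is nonzero, and \<open>B\<close> is hit
    almost surely.\<close>
  have Q: "first_hit B y x * hit_before x c y = first_hit B y x" if "y \<in> B" for y
  proof -
    have "first_hit B y x * hit_before x c y \<le> first_hit B y x" for y
      by (rule mult_left_le[OF hit_before_le_1 first_hit_nonneg])
    then have "(\<Sum>y\<in>B. first_hit B y x - first_hit B y x * hit_before x c y) = 0"
      using sum_first_hit[OF B(1), of x] sure
      by (intro antisym sum_nonneg) (simp_all add: sum_subtractf)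
    then have "\<forall>y\<in>B. first_hit B y x - first_hit B y x * hit_before x c y = 0"
      using \<open>\<And>y. _ \<le> first_hit B y x\<close> B(1) by (subst (asm) sum_nonneg_eq_0_iff) auto
    then show ?thesis using that by simp
  qed
  have "(\<Sum>y\<in>B. first_hit B y x) = 1"
    unfolding sure[symmetric] by (rule sum.cong) (simp_all add: Q)
  then have one: "Pr x {w\<in>paths. ?T w < \<infinity> \<and> value_at ?T w \<in> B} = 1"
    unfolding first_hit_def sum_measure_stopped_at[OF optional_reg_hit B(1)] .
  have fin: "AE w in law x. ?T w < \<infinity>"
    using one AE_space[of "law x"]
    by (subst (asm) law.prob_eq_1)
      (use sets_stopped_at[OF optional_reg_hit borel_closed[OF B'(1)], of B] in auto)
  have F_le: "Pr y (settled c R u) \<le> Pr x (settled c R u)"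
    if "y \<in> B" "first_hit B y x \<noteq> 0" for y u
    using Q[OF that(1)] that(2) settled_before_return[OF _ R(1)] by simp
  have q_le: "q y \<le> first_hit B y x" for y
    unfolding q_def first_hit_def
  proof (rule law.finite_measure_mono)
    show "stopped_at ?T y \<in> sets (law x)"
      using sets_stopped_at[OF optional_reg_hit, of "{y}" B] by simp
  qed (auto simp: T'_def split: if_splits)
  let ?F1 = "restarted T' B (settled c R (t + d))"
  let ?F2 = "restarted ?T B (settled c R t)"
  have F: "?F1 \<in> sets (law x)" "?F2 \<in> sets (law x)"
    using sets_restarted[OF optT' borel_closed[OF B'(1)] sets_settled]
      sets_restarted[OF optional_reg_hit borel_closed[OF B'(1)] sets_settled] by simp_all
  have c: "{c} \<subseteq> B" "{c} \<noteq> {}" using B by auto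
  have "AE w in law x. w \<in> settled c R (t + d) \<longrightarrow> w \<in> ?F1 \<union> ?F2"
    using fin AE_reg_hit_shift[OF B(1) c] AE_reg_hit_attained[OF B', of x] AE_space[of "law x"]
  proof eventually_elim
    case (elim w)
    then have w: "w \<in> paths" by simp
    obtain s where s: "?T w = ereal s" "0 \<le> s"
      using elim(1) reg_hit_nonneg[of B w] by (cases "?T w") auto
    have ws: "w s \<in> B" using elim s by simp
    show ?case
    proof
      assume "w \<in> settled c R (t + d)"
      then have *: "shift s w \<in> settled c R (t + d - s)"
        using shift_settled[OF w _ s(2) R(2)[OF ws]] elim(1,2) s B(2) by simp
      show "w \<in> ?F1 \<union> ?F2"
      proof (cases "s < d")
        case True
        have "T' w = ereal s" using True s by (simp add: T'_def)
        moreover have "shift s w \<in> settled c R (t + d)"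
          using settled_mono[of "t + d - s" "t + d" c R] s(2) * by auto
        ultimately show ?thesis using w ws by simp
      next
        case False
        then have "shift s w \<in> settled c R t"
          using settled_mono[of "t + d - s" t c R] * by auto
        then show ?thesis using w ws s by simp
      qed
    qed
  qed
  then have "Pr x (settled c R (t + d)) \<le> Pr x (?F1 \<union> ?F2)"
    using F by (intro law.finite_measure_mono_AE sets.Un) auto
  also have "\<dots> \<le> Pr x ?F1 + Pr x ?F2"
    by (rule measure_Un_le[OF F])
  also have "Pr x ?F1 = (\<Sum>y\<in>B. q y * Pr y (settled c R (t + d)))"
    unfolding q_def by (rule measure_strong_markov_sum[OF optT' B(1) sets_settled])
  also have "\<dots> \<le> (\<Sum>y\<in>B. q y * Pr x (settled c R (t + d)))"
  proof (rule sum_mono)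
    fix y assume y: "y \<in> B"
    show "q y * Pr y (settled c R (t + d)) \<le> q y * Pr x (settled c R (t + d))"
    proof (cases "first_hit B y x = 0")
      case True
      then have "q y = 0" using q_le[of y] by (simp add: q_def antisym)
      then show ?thesis by simp
    qed (auto intro!: mult_left_mono F_le y simp: q_def)
  qed
  also have "\<dots> = (\<Sum>y\<in>B. q y) * Pr x (settled c R (t + d))"
    by (simp add: sum_distrib_right)
  also have "(\<Sum>y\<in>B. q y) = Pr x {w\<in>paths. T' w < \<infinity> \<and> value_at T' w \<in> B}"
    unfolding q_def by (rule sum_measure_stopped_at[OF optT' B(1)])
  also have "\<dots> \<le> Pr x {w\<in>paths. ?T w < ereal d}"
  proof (rule law.finite_measure_mono)
    show "{w\<in>paths. ?T w < ereal d} \<in> sets (law x)"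
      using sets_optional_less[OF optional_reg_hit] by simp
  qed (use T'_fin in auto)
  also have "Pr x ?F2 = (\<Sum>y\<in>B. first_hit B y x * Pr y (settled c R t))"
    unfolding first_hit_def by (rule measure_strong_markov_sum[OF optional_reg_hit B(1) sets_settled])
  also have "\<dots> \<le> (\<Sum>y\<in>B. first_hit B y x * Pr x (settled c R t))"
  proof (rule sum_mono)
    fix y assume y: "y \<in> B"
    show "first_hit B y x * Pr y (settled c R t) \<le> first_hit B y x * Pr x (settled c R t)"
      by (cases "first_hit B y x = 0") (auto intro!: mult_left_mono F_le y first_hit_nonneg)
  qed
  also have "\<dots> = Pr x (settled c R t)"
    by (simp add: sum_distrib_right[symmetric] \<open>(\<Sum>y\<in>B. first_hit B y x) = 1\<close>)
  finally show ?thesis by (simp add: mult_right_mono)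
qed

text \<open>\<open>settled_step\<close> carries vanishing of \<open>F\<close> from \<open>t\<close>
  to \<open>t + d\<close>, so almost no path ever settles. But escape to infinity and meeting
  \<open>c\<close> both settle a path, which contradicts either alternative of
  \<open>leave\<close>.\<close>

lemma return_not_sure:
  assumes B: "finite B" "c \<in> B" "x \<notin> B"
    and leave: "(AE w in law x. filterlim (\<lambda>t. \<bar>w t\<bar>) at_top at_top) \<or>
      0 < Pr x (finite_time (reg_hit {c}))"
  shows "(\<Sum>y\<in>B. first_hit B y x * hit_before x c y) \<noteq> 1"
proof
  assume sure: "(\<Sum>y\<in>B. first_hit B y x * hit_before x c y) = 1"
  have B': "closed B" "B \<noteq> {}" using B finite_imp_closed by auto
  \<comment> \<open>Larger in size than every point involved, so that a path located at one of them
    is inside the interval.\<close>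
  define R where "R = 1 + (\<Sum>y\<in>insert x B. \<bar>y\<bar>)"
  have R: "\<bar>y\<bar> < R" if "y \<in> insert x B" for y
    using member_le_sum[OF that, of abs] B(1) by (simp add: R_def)
  define F where "F t = Pr x (settled c R t)" for t
  have F_mono: "F t \<le> F u" if "t \<le> u" for t u
    unfolding F_def using settled_mono[OF that] sets_settled by (intro law.finite_measure_mono) auto
  let ?E = "\<lambda>j::nat. {w\<in>paths. reg_hit B w < ereal (1 / Suc j)}"
  have E: "?E j \<in> sets (law x)" for j
    using sets_optional_less[OF optional_reg_hit] by simp
  have null: "Pr x (\<Inter>j. ?E j) = 0"
  proof -
    have "AE w in law x. w \<notin> (\<Inter>j. ?E j)"
      using AE_reg_hit_pos[OF B' B(3)]
    proof eventually_elim
      case (elim w)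
      then obtain r where r: "0 < ereal r" "ereal r < reg_hit B w"
        using ereal_dense2 by blast
      then obtain j where "inverse (real (Suc j)) < r" using reals_Archimedean by auto
      then have "ereal (1 / Suc j) \<le> ereal r" by (simp add: inverse_eq_divide)
      also have "\<dots> \<le> reg_hit B w" using r(2) by simp
      finally have "\<not> reg_hit B w < ereal (1 / Suc j)" by simp
      then show ?case by auto
    qed
    then show ?thesis using E by (subst law.prob_eq_0) auto
  qed
  have "(\<lambda>j. Pr x (?E j)) \<longlonglongrightarrow> Pr x (\<Inter>j. ?E j)"
  proof (rule law.finite_Lim_measure_decseq)
    show "decseq ?E"
    proof (intro decseq_SucI subsetI)
      fix j w assume "w \<in> ?E (Suc j)"
      moreover have "ereal (1 / Suc (Suc j)) \<le> ereal (1 / Suc j)" by (simp add: frac_le)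
      ultimately show "w \<in> ?E j" by (auto intro: less_le_trans)
    qed
  qed (use E in auto)
  \<comment> \<open>A path started off \<open>B\<close> rarely reaches it at once; any probability
    below 1 serves as contraction factor.\<close>
  then have "eventually (\<lambda>j. Pr x (?E j) < 1) sequentially"
    unfolding null by (rule order_tendstoD(2)) simp
  then obtain j where j: "Pr x (?E j) < 1"
    by (auto simp: eventually_sequentially)
  define d where "d = 1 / real (Suc j)"
  have "0 < d" by (simp add: d_def)
  have step: "F (t + d) = 0" if "F t = 0" for t
  proof -
    have "F (t + d) \<le> Pr x (?E j) * F (t + d) + F t"
      unfolding F_def d_def by (rule settled_step[OF B sure]) (use R in auto)
    then have "(1 - Pr x (?E j)) * F (t + d) \<le> 0"
      using that by (simp add: algebra_simps)
    then have "F (t + d) \<le> 0"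
      using j by (simp add: mult_le_0_iff)
    then show ?thesis by (simp add: F_def antisym)
  qed
  \<comment> \<open>With a negative clock, \<open>c\<close> cannot have been met, and staying
    outside the interval would include time 0, when the path is at \<open>x\<close>.\<close>
  have base: "F (- d) = 0"
  proof -
    have "AE w in law x. w \<notin> settled c R (- d)"
      using AE_law_start[of x] AE_space[of "law x"]
    proof eventually_elim
      case (elim w)
      have "\<not> reg_hit {c} w \<le> ereal (- d)"
        using reg_hit_nonneg[of "{c}" w] \<open>0 < d\<close> by (cases "reg_hit {c} w") auto
      moreover have "\<not> (\<forall>s\<ge>max (- d) 0. R \<le> \<bar>w s\<bar>)"
        using elim(1) R[of x] \<open>0 < d\<close> by (auto intro!: exI[of _ 0])
      ultimately show ?case using elim(2) by (simp add: settled_iff)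
    qed
    then show ?thesis unfolding F_def using sets_settled by (subst law.prob_eq_0) auto
  qed
  have zero: "F (- d + real k * d) = 0" for k
  proof (induction k)
    case (Suc k)
    from step[OF this] show ?case by (simp add: algebra_simps)
  qed (use base in simp)
  have F0: "F t = 0" for t
  proof -
    obtain k where "(t + d) / d < real k" using reals_Archimedean2 by blast
    then have "t \<le> - d + real k * d" using \<open>0 < d\<close> by (simp add: field_simps)
    from F_mono[OF this] show ?thesis
      unfolding zero by (simp add: F_def antisym)
  qed
  have "AE w in law x. w \<notin> settled c R (real k)" for k :: nat
    using F0[of "real k"] sets_settled unfolding F_def by (subst (asm) law.prob_eq_0) auto
  then have never: "AE w in law x. \<forall>k::nat. w \<notin> settled c R (real k)"
    by (simp only: AE_all_countable) blast
  show False
    using leave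
  proof
    assume "AE w in law x. filterlim (\<lambda>t. \<bar>w t\<bar>) at_top at_top"
    then have "AE w in law x. False"
      using never AE_space[of "law x"]
    proof eventually_elim
      case (elim w)
      then have "eventually (\<lambda>t. R \<le> \<bar>w t\<bar>) at_top" by (simp add: filterlim_at_top)
      then obtain u where u: "\<And>t. u \<le> t \<Longrightarrow> R \<le> \<bar>w t\<bar>" by (auto simp: eventually_at_top_linorder)
      obtain k where "u \<le> real k" using real_arch_simple by blast
      then have "w \<in> settled c R (real k)"
        using u elim(3) by (simp add: settled_iff)
      then show False using elim(2) by blast
    qed
    then show False using law.AE_False by simp
  next
    assume pos: "0 < Pr x (finite_time (reg_hit {c}))"
    have "AE w in law x. w \<notin> finite_time (reg_hit {c})"
      using never AE_space[of "law x"]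
    proof eventually_elim
      case (elim w)
      have "\<not> reg_hit {c} w < \<infinity>"
      proof
        assume "reg_hit {c} w < \<infinity>"
        then obtain k :: nat where "reg_hit {c} w < ereal (real k)"
          using less_PInf_Ex_of_nat by auto
        then have "w \<in> settled c R (real k)" using elim(2) by (simp add: settled_def less_imp_le)
        then show False using elim(1) by blast
      qed
      then show ?case by simp
    qed
    moreover have "finite_time (reg_hit {c}) \<in> sets (law x)"
      using sets_optional_finite[OF optional_reg_hit] by simp
    ultimately have "Pr x (finite_time (reg_hit {c})) = 0"
      by (subst law.prob_eq_0) auto
    then show False using pos by simp
  qed
qed

end

subsection \<open>The potential measure\<close>

text \<open>Right-continuity gives joint measurability in time and path; \<open>max 0\<close> avoids
  the times at which paths are undefined.\<close>

lemma measurable_joint_eval: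
  "(\<lambda>(t, w). w (max 0 t)) \<in> borel_measurable (borel \<Otimes>\<^sub>M path_space)"
proof (rule measurable_right_eval[where \<tau>="\<lambda>(t, w). max 0 t" and V="\<lambda>(t, w). w"])
  show "(\<lambda>(t, w). max 0 t) \<in> borel_measurable (borel \<Otimes>\<^sub>M path_space :: (real \<times> path) measure)"
    by measurable
  show "(\<lambda>z. (case z of (t, w) \<Rightarrow> w) u) \<in> borel_measurable (borel \<Otimes>\<^sub>M path_space)" for u
    using measurable_compose[OF measurable_snd measurable_coordinate]
    by (simp add: case_prod_unfold)
  fix z :: "real \<times> path" assume "z \<in> space (borel \<Otimes>\<^sub>M path_space)"
  then have "snd z \<in> paths" by (auto simp: space_pair_measure)
  from cadlag_right[OF path_cadlag[OF this], of "max 0 (fst z)"]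
  show "((case z of (t, w) \<Rightarrow> w) \<longlongrightarrow> (case z of (t, w) \<Rightarrow> w (max 0 t))) (at_right (case z of (t, w) \<Rightarrow> max 0 t))"
    by (simp add: case_prod_unfold)
qed (auto simp: case_prod_unfold)

text \<open>Averaging over this law discounts time by \<open>exp (- t)\<close>; rate 1 is the
  resolvent parameter \<open>q = 1\<close>.\<close>

definition expo :: "real measure" where
  "expo = density lborel (exponential_density 1)"

lemma prob_space_expo: "prob_space expo"
  unfolding expo_def by (rule prob_space_exponential_density) simp

lemma sets_expo [simp, measurable_cong]: "sets expo = sets borel"
  by (simp add: expo_def)

lemma space_expo [simp]: "space expo = UNIV"
  by (simp add: expo_def)

lemma nn_integral_expo:
  assumes "f \<in> borel_measurable borel"
  shows "(\<integral>\<^sup>+t. f t \<partial>expo) = (\<integral>\<^sup>+t. ennreal (exponential_density 1 t) * f t \<partial>lborel)"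
  unfolding expo_def by (rule nn_integral_density) (use assms in auto)

lemma nn_integral_expo_shift:
  assumes f: "f \<in> borel_measurable borel"
  shows "(\<integral>\<^sup>+t. ennreal (exponential_density 1 (t - s)) * f (t - s) \<partial>lborel) = (\<integral>\<^sup>+t. f t \<partial>expo)"
proof -
  have "(\<integral>\<^sup>+t. ennreal (exponential_density 1 t) * f t \<partial>lborel) =
      (\<integral>\<^sup>+t. ennreal (exponential_density 1 (- s + 1 * t)) * f (- s + 1 * t) \<partial>lborel)"
    using f by (subst nn_integral_real_affine[where c=1 and t="- s"]) auto
  then show ?thesis by (simp add: nn_integral_expo[OF f])
qed

context
  fixes g :: "real \<Rightarrow> ennreal"
  assumes g [measurable]: "g \<in> borel_measurable borel"
begin

text \<open>Discounted total of \<open>g\<close> along the path lifted by \<open>y\<close>. Keeping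
  \<open>y\<close> apart lets position and later increments be inserted separately at a random
  time.\<close>

definition discounted :: "real \<Rightarrow> path \<Rightarrow> ennreal" where
  "discounted y w = (\<integral>\<^sup>+t. g (y + w (max 0 t)) \<partial>expo)"

lemma measurable_discounted: "(\<lambda>(y, w). discounted y w) \<in> borel_measurable (borel \<Otimes>\<^sub>M path_space)"
proof -
  interpret prob_space expo by (rule prob_space_expo)
  have "(\<lambda>z. (snd z, snd (fst z))) \<in> (borel \<Otimes>\<^sub>M path_space) \<Otimes>\<^sub>M expo \<rightarrow>\<^sub>M borel \<Otimes>\<^sub>M path_space"
    by measurable
  from measurable_compose[OF this measurable_joint_eval]
  have [measurable]: "(\<lambda>z. snd (fst z) (max 0 (snd z))) \<in> borel_measurable ((borel \<Otimes>\<^sub>M path_space) \<Otimes>\<^sub>M expo)"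
    by (simp add: case_prod_unfold)
  have "(\<lambda>z. g (fst (fst z) + snd (fst z) (max 0 (snd z)))) \<in> borel_measurable ((borel \<Otimes>\<^sub>M path_space) \<Otimes>\<^sub>M expo)"
    by measurable
  then have "(\<lambda>(p, t). g (fst p + snd p (max 0 t))) \<in> borel_measurable ((borel \<Otimes>\<^sub>M path_space) \<Otimes>\<^sub>M expo)"
    by (simp add: case_prod_unfold)
  from borel_measurable_nn_integral[OF this]
  show ?thesis by (simp add: discounted_def case_prod_unfold)
qed

lemma measurable_path_time:
  assumes w: "w \<in> paths" shows "(\<lambda>t. w (max 0 t)) \<in> borel_measurable borel"
proof -
  have "(\<lambda>t. (t, w)) \<in> borel \<rightarrow>\<^sub>M borel \<Otimes>\<^sub>M path_space"
    using w by measurable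
  from measurable_compose[OF this measurable_joint_eval] show ?thesis by simp
qed

text \<open>Off \<open>A\<close> the integrand is at most \<open>s\<close>. A visit to
  \<open>A\<close> comes no earlier than the hitting time: if that is before \<open>N\<close>,
  forgetting the discount up to it gives the second term; otherwise the visit is at \<open>N\<close>
  or later, and the discount \<open>exp (- N)\<close> gives the third.\<close>

lemma discounted_le:
  assumes w: "w \<in> paths" and N: "0 \<le> N"
    and out: "\<And>z. z \<notin> A \<Longrightarrow> g z \<le> s"
  shows "discounted 0 w \<le> s + indicator {w. hit A w < ereal N} w *
      discounted (value_at (hit A) w) (incr_at (hit A) w) +
      ennreal (exp (- N)) * discounted (w N) (incr N w)"
proof -
  let ?e = "\<lambda>t. ennreal (exponential_density 1 t)"
  define \<tau> where "\<tau> = real_of_ereal (hit A w)"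
  have "0 \<le> \<tau>" unfolding \<tau>_def by (rule real_of_ereal_pos[OF hit_nonneg])
  have inc: "(\<lambda>t. g (w u + incr u w (max 0 t))) \<in> borel_measurable borel" if "0 \<le> u" for u
    using measurable_path_time[OF incr_path[OF w that]] by measurable
  have shifted: "discounted (w u) (incr u w) = (\<integral>\<^sup>+t. ?e (t - u) * g (w u + incr u w (max 0 (t - u))) \<partial>lborel)" if "0 \<le> u" for u
    unfolding discounted_def by (rule nn_integral_expo_shift[OF inc[OF that], symmetric])
  have sm: "(\<lambda>t. ?e (t - u) * g (w u + incr u w (max 0 (t - u)))) \<in> borel_measurable lborel" if "0 \<le> u" for u
    using measurable_compose[OF _ inc[OF that], of "\<lambda>t. t - u" borel] by simp
  have gw: "(\<lambda>t. g (0 + w (max 0 t))) \<in> borel_measurable borel"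
    using measurable_path_time[OF w] by measurable
  have pt: "?e t * g (0 + w (max 0 t)) \<le> ?e t * s +
      (indicator {w. hit A w < ereal N} w * (?e (t - \<tau>) * g (w \<tau> + incr \<tau> w (max 0 (t - \<tau>)))) +
       ennreal (exp (- N)) * (?e (t - N) * g (w N + incr N w (max 0 (t - N)))))" (is "_ \<le> _ + (?b + ?c)") for t
  proof (cases "t < 0")
    case True
    then show ?thesis by (simp add: exponential_density_def)
  next
    case False
    then have t: "0 \<le> t" by simp
    show ?thesis
    proof (cases "w t \<in> A")
      case out': False
      have "?e t * g (0 + w (max 0 t)) \<le> ?e t * s"
        using out[OF out'] t by (intro mult_left_mono) auto
      also have "\<dots> \<le> ?e t * s + (?b + ?c)" by simp
      finally show ?thesis .
    next
      case True
      have hit: "hit A w \<le> ereal t" using hit_le[of t w A] t True by simp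
      show ?thesis
      proof (cases "hit A w < ereal N")
        case less: True
        have \<tau>: "hit A w = ereal \<tau>"
          using less hit_nonneg[of A w] by (cases "hit A w") (auto simp: \<tau>_def)
        then have "\<tau> \<le> t" using hit by simp
        then have "?e t * g (0 + w (max 0 t)) \<le> ?e (t - \<tau>) * g (w \<tau> + incr \<tau> w (max 0 (t - \<tau>)))"
          using \<open>0 \<le> \<tau>\<close> t by (intro mult_mono) (auto simp: exponential_density_def incr_def)
        also have "\<dots> = ?b" using less by simp
        also have "\<dots> \<le> ?e t * s + (?b + ?c)" by (simp add: add_increasing)
        finally show ?thesis .
      next
        case False
        then have "N \<le> t" using hit by (meson ereal_less_eq(3) leI order_trans)
        have "?e t = ennreal (exp (- N)) * ?e (t - N)"
          using \<open>N \<le> t\<close> t by (simp add: exponential_density_def ennreal_mult'[symmetric] exp_add[symmetric])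
        moreover have "g (0 + w (max 0 t)) = g (w N + incr N w (max 0 (t - N)))"
          using \<open>N \<le> t\<close> t by (simp add: incr_def)
        ultimately have "?e t * g (0 + w (max 0 t)) = ?c" by (simp add: mult.assoc)
        also have "\<dots> \<le> ?e t * s + (?b + ?c)" by (simp add: add_increasing)
        finally show ?thesis .
      qed
    qed
  qed
  have one: "(\<integral>\<^sup>+t. ?e t * s \<partial>lborel) = s"
    using prob_space.emeasure_space_1[OF prob_space_expo] nn_integral_expo[of "\<lambda>_. s"] by simp
  have "discounted 0 w = (\<integral>\<^sup>+t. ?e t * g (0 + w (max 0 t)) \<partial>lborel)"
    unfolding discounted_def by (rule nn_integral_expo[OF gw])
  also have "\<dots> \<le> (\<integral>\<^sup>+t. ?e t * s +
      (indicator {w. hit A w < ereal N} w * (?e (t - \<tau>) * g (w \<tau> + incr \<tau> w (max 0 (t - \<tau>)))) +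
       ennreal (exp (- N)) * (?e (t - N) * g (w N + incr N w (max 0 (t - N))))) \<partial>lborel)"
    by (rule nn_integral_mono) (rule pt)
  also have "\<dots> = s + (indicator {w. hit A w < ereal N} w * discounted (w \<tau>) (incr \<tau> w) +
      ennreal (exp (- N)) * discounted (w N) (incr N w))"
    using sm[OF \<open>0 \<le> \<tau>\<close>] sm[OF N]
    by (simp add: nn_integral_add nn_integral_cmult one shifted[OF \<open>0 \<le> \<tau>\<close>] shifted[OF N])
  finally show ?thesis by (simp add: \<tau>_def add.assoc)
qed

end

lemma optional_const: "0 \<le> N \<Longrightarrow> optional (\<lambda>_. ereal N)"
  unfolding optional_def using sets.top[of "coord_algebra {0..t}" for t] by (auto simp: zero_ereal_def)

context levy_process
begin

text \<open>The 1-potential measure, written as the law of the process at an independent exponential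
  time.\<close>

definition potential :: "real measure" where
  "potential = distr (expo \<Otimes>\<^sub>M law 0) borel (\<lambda>(t, w). w (max 0 t))"

lemma measurable_joint_eval_law: "(\<lambda>(t, w). w (max 0 t)) \<in> borel_measurable (expo \<Otimes>\<^sub>M law 0)"
  using measurable_joint_eval measurable_cong_sets[OF sets_pair_measure_cong[OF sets_expo sets_law] refl] by blast

lemma sets_potential [simp, measurable_cong]: "sets potential = sets borel"
  by (simp add: potential_def)

lemma pair_prob_space_expo: "pair_prob_space expo (law 0)"
  using prob_space_expo prob_space_law by (simp add: pair_prob_space_def pair_sigma_finite_def prob_space_imp_sigma_finite)

lemma prob_space_potential: "prob_space potential"
  unfolding potential_def
  by (rule prob_space.prob_space_distr[OF prob_space_pair[OF prob_space_expo prob_space_law] measurable_joint_eval_law])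

lemma nn_integral_discounted:
  assumes [measurable]: "g \<in> borel_measurable borel"
  shows "(\<integral>\<^sup>+w. discounted g y w \<partial>law 0) = (\<integral>\<^sup>+x. g (y + x) \<partial>potential)"
proof -
  interpret pair_prob_space expo "law 0" by (rule pair_prob_space_expo)
  have [measurable]: "(\<lambda>(t, w). w (max 0 t)) \<in> borel_measurable (expo \<Otimes>\<^sub>M law 0)"
    by (rule measurable_joint_eval_law)
  have m: "(\<lambda>(t, w). g (y + w (max 0 t))) \<in> borel_measurable (expo \<Otimes>\<^sub>M law 0)"
  proof -
    have "(\<lambda>z. g (y + (\<lambda>(t, w). w (max 0 t)) z)) \<in> borel_measurable (expo \<Otimes>\<^sub>M law 0)"
      by measurable
    then show ?thesis by (simp add: case_prod_unfold)
  qed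
  have "(\<integral>\<^sup>+x. g (y + x) \<partial>potential) = (\<integral>\<^sup>+z. g (y + (\<lambda>(t, w). w (max 0 t)) z) \<partial>(expo \<Otimes>\<^sub>M law 0))"
    unfolding potential_def by (subst nn_integral_distr) (auto intro: measurable_joint_eval_law)
  also have "\<dots> = (\<integral>\<^sup>+w. (\<integral>\<^sup>+t. g (y + w (max 0 t)) \<partial>expo) \<partial>law 0)"
    using nn_integral_snd[OF m] by (simp add: case_prod_unfold)
  finally show ?thesis by (simp add: discounted_def)
qed

text \<open>Before \<open>A\<close> is hit \<open>g\<close> is at most \<open>s\<close>. The discount makes the time after \<open>N\<close> negligible, so a
  large potential forces \<open>A\<close> to be hit before time \<open>N\<close>, uniformly in \<open>A\<close>.\<close>

lemma potential_le:
  assumes g: "g \<in> borel_measurable borel" and A: "open A" and N: "0 \<le> N"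
    and out: "\<And>z. z \<notin> A \<Longrightarrow> g z \<le> s" and K: "\<And>y. (\<integral>\<^sup>+x. g (y + x) \<partial>potential) \<le> K"
  shows "(\<integral>\<^sup>+x. g x \<partial>potential) \<le> s + ePr 0 {w\<in>paths. hit A w < ereal N} * K + ennreal (exp (- N)) * K"
proof -
  define T where "T w = (if hit A w < ereal N then hit A w else \<infinity>)" for w
  have optT: "optional T"
    unfolding T_def by (rule optional_before[OF optional_hit_open[OF A]])
  have T_fin: "T w < \<infinity> \<longleftrightarrow> hit A w < ereal N" for w
    by (auto simp: T_def intro: less_trans)
  let ?D = "\<lambda>(y, w). discounted g y w"
  have D: "?D \<in> borel_measurable (borel \<Otimes>\<^sub>M path_space)"
    by (rule measurable_discounted[OF g])
  have inner: "(\<integral>\<^sup>+v. ?D (y, v) \<partial>law 0) \<le> K" for y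
    using nn_integral_discounted[OF g, of y] K[of y] by simp
  let ?S = "{w\<in>paths. hit A w < ereal N}"
  have S: "?S \<in> sets (law 0)"
    using sets_optional_less[OF optional_hit_open[OF A]] by simp
  have part: "(\<integral>\<^sup>+w. indicator (finite_time U) w * ?D (value_at U w, incr_at U w) \<partial>law 0)
      \<le> ePr 0 (finite_time U) * K" if U: "optional U" for U
  proof -
    have "finite_time U \<in> sets (law 0)"
      using sets_optional_finite[OF U] by simp
    note s = this
    have "(\<integral>\<^sup>+w. indicator (finite_time U) w * ?D (value_at U w, incr_at U w) \<partial>law 0)
      = (\<integral>\<^sup>+w. indicator (finite_time U) w * (\<integral>\<^sup>+v. ?D (value_at U w, v) \<partial>law 0) \<partial>law 0)"
      by (rule strong_markov_nn_integral[OF U D])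
    also have "\<dots> \<le> (\<integral>\<^sup>+w. K * indicator (finite_time U) w \<partial>law 0)"
      using inner by (intro nn_integral_mono) (auto simp: mult.commute intro!: mult_mono)
    also have "\<dots> = K * ePr 0 (finite_time U)"
      using s by (rule nn_integral_cmult_indicator)
    finally show ?thesis by (simp add: mult.commute)
  qed
  let ?I1 = "\<lambda>w. indicator (finite_time T) w * ?D (value_at T w, incr_at T w)"
  \<comment> \<open>The deterministic time \<open>N\<close> is written as an optional time so that
    \<open>part\<close> covers it too.\<close>
  let ?I2 = "\<lambda>w. indicator {w\<in>paths. ereal N < \<infinity>} w * ?D (w (real_of_ereal (ereal N)), incr (real_of_ereal (ereal N)) w)"
  have meas: "(\<lambda>w. indicator (finite_time U) w * ?D (value_at U w, incr_at U w)) \<in> borel_measurable (law 0)"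
    if U: "optional U" for U
  proof -
    have [measurable]: "U \<in> borel_measurable path_space" by (rule measurable_optional[OF U])
    have \<tau>: "(\<lambda>w. real_of_ereal (U w)) \<in> borel_measurable path_space" by measurable
    note pos = optional_nonneg_real[OF U]
    have "(\<lambda>w. (value_at U w, incr_at U w)) \<in> path_space \<rightarrow>\<^sub>M borel \<Otimes>\<^sub>M path_space"
      by (rule measurable_Pair[OF measurable_eval[OF \<tau> pos] measurable_incr_random[OF \<tau> pos]])
    from measurable_compose[OF this D]
    have "(\<lambda>w. ?D (value_at U w, incr_at U w)) \<in> borel_measurable path_space" .
    moreover have "finite_time U \<in> sets path_space" by measurable
    ultimately have "(\<lambda>w. indicator (finite_time U) w * ?D (value_at U w, incr_at U w)) \<in> borel_measurable path_space"
      by (intro borel_measurable_times_ennreal borel_measurable_indicator)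
    then show ?thesis using measurable_cong_sets[OF sets_law refl] by blast
  qed
  have "(\<integral>\<^sup>+x. g x \<partial>potential) = (\<integral>\<^sup>+w. discounted g 0 w \<partial>law 0)"
    using nn_integral_discounted[OF g, of 0] by simp
  also have "\<dots> \<le> (\<integral>\<^sup>+w. s + ?I1 w + ennreal (exp (- N)) * ?I2 w \<partial>law 0)"
  proof (rule nn_integral_mono)
    fix w assume "w \<in> space (law 0)"
    then have w: "w \<in> paths" by simp
    have le: "discounted g 0 w \<le> s + indicator {w. hit A w < ereal N} w *
      discounted g (value_at (hit A) w) (incr_at (hit A) w) +
      ennreal (exp (- N)) * discounted g (w N) (incr N w)"
      by (rule discounted_le[OF g w N]) (rule out)
    have "indicator {w. hit A w < ereal N} w *
      discounted g (value_at (hit A) w) (incr_at (hit A) w) = ?I1 w"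
      using w T_fin[of w] by (auto simp: T_def indicator_def)
    moreover have "discounted g (w N) (incr N w) = ?I2 w" using w by simp
    ultimately show "discounted g 0 w \<le> s + ?I1 w + ennreal (exp (- N)) * ?I2 w"
      using le by (simp only:)
  qed
  also have "\<dots> = s + (\<integral>\<^sup>+w. ?I1 w \<partial>law 0) + ennreal (exp (- N)) * (\<integral>\<^sup>+w. ?I2 w \<partial>law 0)"
    using meas[OF optT] meas[OF optional_const[OF N]] law.emeasure_space_1
    by (simp add: nn_integral_add nn_integral_cmult)
  also have "\<dots> \<le> s + ePr 0 ?S * K + ennreal (exp (- N)) * K"
  proof (intro add_mono mult_left_mono order_refl)
    show "(\<integral>\<^sup>+w. ?I1 w \<partial>law 0) \<le> ePr 0 ?S * K"
      using part[OF optT] by (simp only: T_fin)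
    have "ePr 0 {w\<in>paths. ereal N < \<infinity>} * K \<le> 1 * K"
      by (intro mult_right_mono law.emeasure_le_1) simp
    then show "(\<integral>\<^sup>+w. ?I2 w \<partial>law 0) \<le> K"
      using order_trans[OF part[OF optional_const[OF N]]] by simp
  qed simp
  finally show ?thesis .
qed

end

subsection \<open>Fourier inversion with Gaussian weights\<close>

lemma integrable_exponential_density: "integrable lborel (exponential_density 1)"
proof (rule integrableI_nonneg)
  have "(\<integral>\<^sup>+t. ennreal (exponential_density 1 t) \<partial>lborel) = 1"
    using nn_integral_expo[of "\<lambda>_. 1"] prob_space.emeasure_space_1[OF prob_space_expo] by simp
  then show "(\<integral>\<^sup>+t. ennreal (exponential_density 1 t) \<partial>lborel) < \<infinity>" by simp
qed (auto simp: exponential_density_nonneg)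

text \<open>Laplace transform of the exponential law, by the fundamental theorem of calculus on
  \<open>{0..real n}\<close>; as \<open>0 \<le> Re z\<close>, the exponential density
  dominates.\<close>

lemma integral_expo_exp:
  fixes z :: complex
  assumes "0 \<le> Re z"
  shows "(LINT t|expo. exp (- (of_real (max 0 t) * z))) = 1 / (1 + z)"
proof -
  let ?f = "\<lambda>t. exponential_density 1 t *\<^sub>R exp (- (of_real (max 0 t) * z))"
  let ?h = "\<lambda>t. exp (of_real t * (- (1 + z)))"
  have nz: "1 + z \<noteq> 0" using assms by (auto simp: complex_eq_iff)
  have "(LINT t|expo. exp (- (of_real (max 0 t) * z))) = (LINT t|lborel. ?f t)"
    unfolding expo_def by (rule integral_density) (auto simp: exponential_density_nonneg)
  have f_eq: "?f t = (if 0 \<le> t then ?h t else 0)" for t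
    by (simp add: exponential_density_def scaleR_conv_of_real exp_of_real[symmetric] mult_exp_exp algebra_simps)
  have lim1: "(\<lambda>n. LINT t|lborel. indicator {0..real n} t *\<^sub>R ?h t) \<longlonglongrightarrow> (LINT t|lborel. ?f t)"
  proof (rule integral_dominated_convergence)
    show "integrable lborel (exponential_density 1)" by (rule integrable_exponential_density)
    show "AE t in lborel. (\<lambda>n. indicator {0..real n} t *\<^sub>R ?h t) \<longlonglongrightarrow> ?f t"
    proof (rule AE_I2)
      fix t :: real
      obtain N where "t \<le> real N" using real_arch_simple by blast
      then have "indicator {0..real n} t *\<^sub>R ?h t = ?f t" if "N \<le> n" for n
        using that by (auto simp: f_eq indicator_def)
      then show "(\<lambda>n. indicator {0..real n} t *\<^sub>R ?h t) \<longlonglongrightarrow> ?f t"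
        by (intro tendsto_eventually) (auto simp: eventually_sequentially)
    qed
    show "AE t in lborel. norm (indicator {0..real n} t *\<^sub>R ?h t) \<le> exponential_density 1 t" for n
    proof (rule AE_I2)
      fix t :: real
      have "norm (?h t) \<le> exp (- t)" if "0 \<le> t"
        using mult_nonneg_nonneg[OF that assms] by (simp add: algebra_simps)
      then show "norm (indicator {0..real n} t *\<^sub>R ?h t) \<le> exponential_density 1 t"
        by (auto simp: exponential_density_def indicator_def)
    qed
  qed auto
  have "(LINT t|lborel. indicator {0..real n} t *\<^sub>R ?h t) = - (?h n / (1 + z)) - - (?h 0 / (1 + z))" for n :: nat
  proof (rule integral_FTC_atLeastAtMost)
    show "((\<lambda>t. - (?h t / (1 + z))) has_vector_derivative ?h t) (at t within {0..real n})" for t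
    proof -
      have "((\<lambda>x. - (exp (x * (- (1 + z))) / (1 + z))) has_field_derivative ?h t) (at (of_real t))"
      proof -
        have "((\<lambda>x. - (exp (x * (- (1 + z))) / (1 + z))) has_field_derivative - (?h t * (- (1 + z)) / (1 + z))) (at (of_real t))"
          by (rule derivative_eq_intros refl | use nz in simp)+
        moreover have "- (?h t * (- (1 + z)) / (1 + z)) = ?h t"
          using nz by (simp only: mult_minus_right minus_divide_left minus_minus nonzero_mult_div_cancel_right not_False_eq_True)
        ultimately show ?thesis by (simp only:)
      qed
      from has_vector_derivative_real_field[OF this] show ?thesis .
    qed
    show "continuous_on {0..real n} ?h" by (intro continuous_intros)
  qed simp
  then have eq: "(LINT t|lborel. indicator {0..real n} t *\<^sub>R ?h t) = 1 / (1 + z) - ?h n / (1 + z)" for n :: nat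
    by simp
  have "(\<lambda>n::nat. ?h n) \<longlonglongrightarrow> 0"
  proof (rule Lim_null_comparison)
    show "eventually (\<lambda>n. norm (?h (real n)) \<le> (exp (- 1)) ^ n) sequentially"
    proof (rule always_eventually, rule allI)
      fix n :: nat
      have "norm (?h (real n)) \<le> exp (- real n)"
        using mult_nonneg_nonneg[OF of_nat_0_le_iff assms, of n] by (simp add: algebra_simps)
      then show "norm (?h (real n)) \<le> (exp (- 1)) ^ n"
        by (simp add: exp_of_nat_mult[symmetric])
    qed
    show "(\<lambda>n. exp (- 1 :: real) ^ n) \<longlonglongrightarrow> 0" by (rule LIMSEQ_power_zero) simp
  qed
  then have "(\<lambda>n::nat. 1 / (1 + z) - ?h n / (1 + z)) \<longlonglongrightarrow> 1 / (1 + z) - 0 / (1 + z)"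
    using nz by (intro tendsto_intros) auto
  with lim1 have "(LINT t|lborel. ?f t) = 1 / (1 + z)"
    unfolding eq using LIMSEQ_unique by fastforce
  then show ?thesis using \<open>_ = (LINT t|lborel. ?f t)\<close> by simp
qed

context real_distribution
begin

text \<open>Integral of an unnormalised Gaussian kernel of width \<open>1 / s\<close> around
  \<open>y\<close>. If \<open>M\<close> has a bounded continuous density \<open>p\<close>, then
  \<open>sqrt (2 * pi) * s * gauss s y\<close> tends to \<open>2 * pi * p y\<close> as
  \<open>s\<close> grows.\<close>

definition gauss :: "real \<Rightarrow> real \<Rightarrow> real" where
  "gauss s y = (LINT x|M. exp (- (s * (x - y))\<^sup>2 / 2))"

text \<open>Parseval's identity with the standard normal law, whose characteristic function is Gaussian.\<close>

lemma of_real_gauss: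
  assumes "0 < s"
  shows "of_real (sqrt (2 * pi) * s * gauss s y) =
    (LINT u|lborel. exp (- (u / s)\<^sup>2 / 2) *\<^sub>R (iexp (- (y * u)) * char M u))"
proof -
  let ?N = "std_normal_distribution"
  interpret N: real_distribution ?N by (rule real_dist_normal_dist)
  interpret pair_prob_space M ?N ..
  have chN: "(LINT v|?N. iexp (t * v)) = of_real (exp (- t\<^sup>2 / 2))" for t
    using fun_cong[OF char_std_normal_distribution, of t] by (simp add: char_def)
  have m [measurable]: "(\<lambda>(x, v). iexp (s * (x - y) * v)) \<in> borel_measurable (M \<Otimes>\<^sub>M ?N)"
    by measurable
  have int: "integrable (M \<Otimes>\<^sub>M ?N) (case_prod (\<lambda>x v. iexp (s * (x - y) * v)))"
    by (rule P.integrable_const_bound[of _ 1]) (auto simp: case_prod_unfold)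
  have "complex_of_real (gauss s y) = (LINT x|M. complex_of_real (exp (- (s * (x - y))\<^sup>2 / 2)))"
    unfolding gauss_def by (rule integral_complex_of_real[symmetric])
  also have "\<dots> = (LINT x|M. (LINT v|?N. iexp (s * (x - y) * v)))"
    by (simp only: chN)
  also have "\<dots> = (LINT v|?N. (LINT x|M. iexp (s * (x - y) * v)))"
    by (rule Fubini_integral[OF int, symmetric])
  also have "(\<lambda>v. LINT x|M. iexp (s * (x - y) * v)) = (\<lambda>v. iexp (- (y * (s * v))) * char M (s * v))"
  proof
    fix v
    have "(LINT x|M. iexp (s * (x - y) * v)) = (LINT x|M. iexp (- (y * (s * v))) * iexp (s * v * x))"
      by (rule Bochner_Integration.integral_cong) (auto simp: mult_exp_exp algebra_simps)
    then show "(LINT x|M. iexp (s * (x - y) * v)) = iexp (- (y * (s * v))) * char M (s * v)"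
      by (simp add: char_def)
  qed
  also have "(LINT v|?N. iexp (- (y * (s * v))) * char M (s * v)) =
      (LINT v|lborel. std_normal_density v *\<^sub>R (iexp (- (y * (s * v))) * char M (s * v)))"
    by (rule integral_density) auto
  also have "\<dots> = \<bar>1 / s\<bar> *\<^sub>R (LINT u|lborel. std_normal_density (0 + 1 / s * u) *\<^sub>R
      (iexp (- (y * (s * (0 + 1 / s * u)))) * char M (s * (0 + 1 / s * u))))"
    using assms by (intro lborel_integral_real_affine) simp
  also have "\<dots> = (1 / s) *\<^sub>R (LINT u|lborel. (1 / sqrt (2 * pi)) *\<^sub>R (exp (- (u / s)\<^sup>2 / 2) *\<^sub>R (iexp (- (y * u)) * char M u)))"
    using assms by (simp add: std_normal_density_def)
  also have "\<dots> = of_real (1 / (sqrt (2 * pi) * s)) * (LINT u|lborel. exp (- (u / s)\<^sup>2 / 2) *\<^sub>R (iexp (- (y * u)) * char M u))"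
    by (simp only: integral_scaleR_right) (simp add: scaleR_conv_of_real)
  finally show ?thesis using assms by (simp add: field_simps)
qed

context
  assumes int: "integrable lborel (char M)"
begin

lemma gauss_le: "0 < s \<Longrightarrow> sqrt (2 * pi) * s * gauss s y \<le> (LINT u|lborel. cmod (char M u))"
proof -
  assume s: "0 < s"
  have "0 \<le> gauss s y" unfolding gauss_def by (intro integral_nonneg_AE) auto
  then have "sqrt (2 * pi) * s * gauss s y = cmod (of_real (sqrt (2 * pi) * s * gauss s y))"
    using s by (simp only: norm_of_real) simp
  also have "\<dots> \<le> (LINT u|lborel. cmod (char M u))"
    unfolding of_real_gauss[OF s]
    using int
    by (intro order_trans[OF integral_norm_bound] integral_mono)
      (auto simp: norm_mult intro!: AE_I2 mult_left_le_one_le integrable_norm Bochner_Integration.integrable_bound[OF int])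
  finally show ?thesis .
qed

text \<open>\<open>2 * pi\<close> times the density that Fourier inversion yields; it is used only
  as a limit of Gaussian averages.\<close>

definition inversion :: "real \<Rightarrow> complex" where
  "inversion y = (LINT u|lborel. iexp (- (y * u)) * char M u)"

lemma gauss_tendsto: "(\<lambda>n. sqrt (2 * pi) * real (Suc n) * gauss (real (Suc n)) y) \<longlonglongrightarrow> Re (inversion y)"
proof -
  have "(\<lambda>n. LINT u|lborel. exp (- (u / real (Suc n))\<^sup>2 / 2) *\<^sub>R (iexp (- (y * u)) * char M u)) \<longlonglongrightarrow> inversion y"
    unfolding inversion_def
  proof (rule integral_dominated_convergence)
    show "integrable lborel (\<lambda>u. cmod (char M u))" using int by (rule integrable_norm)
    show "AE u in lborel. (\<lambda>n. exp (- (u / real (Suc n))\<^sup>2 / 2) *\<^sub>R (iexp (- (y * u)) * char M u)) \<longlonglongrightarrow> iexp (- (y * u)) * char M u"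
    proof (rule AE_I2)
      fix u :: real
      have "(\<lambda>n. 1 / real (Suc n)) \<longlonglongrightarrow> 0" by (rule LIMSEQ_Suc[OF lim_1_over_n])
      then have "(\<lambda>n. exp (- (u * (1 / real (Suc n)))\<^sup>2 / 2) *\<^sub>R (iexp (- (y * u)) * char M u)) \<longlonglongrightarrow>
          exp (- (u * 0)\<^sup>2 / 2) *\<^sub>R (iexp (- (y * u)) * char M u)"
        by (intro tendsto_intros) auto
      then show "(\<lambda>n. exp (- (u / real (Suc n))\<^sup>2 / 2) *\<^sub>R (iexp (- (y * u)) * char M u)) \<longlonglongrightarrow> iexp (- (y * u)) * char M u"
        by simp
    qed
    show "AE u in lborel. norm (exp (- (u / real (Suc n))\<^sup>2 / 2) *\<^sub>R (iexp (- (y * u)) * char M u)) \<le> cmod (char M u)" for n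
      by (auto simp: norm_mult intro!: mult_left_le_one_le)
  qed auto
  then have "(\<lambda>n. complex_of_real (sqrt (2 * pi) * real (Suc n) * gauss (real (Suc n)) y)) \<longlonglongrightarrow> inversion y"
    by (subst of_real_gauss) simp_all
  from tendsto_Re[OF this] show ?thesis by (simp only: Re_complex_of_real)
qed

lemma isCont_inversion: "isCont inversion y"
  unfolding continuous_at_sequentially
proof (intro allI impI)
  fix f :: "nat \<Rightarrow> real" assume f: "f \<longlonglongrightarrow> y"
  show "(inversion \<circ> f) \<longlonglongrightarrow> inversion y"
    unfolding comp_def inversion_def
  proof (rule integral_dominated_convergence)
    show "integrable lborel (\<lambda>u. cmod (char M u))" using int by (rule integrable_norm)
    show "AE u in lborel. (\<lambda>n. iexp (- (f n * u)) * char M u) \<longlonglongrightarrow> iexp (- (y * u)) * char M u"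
      using f by (auto intro!: tendsto_intros)
  qed (auto simp: norm_mult)
qed

text \<open>At 0 the real part is the integral of the strictly positive function
  \<open>Re (char M u)\<close>; continuity extends positivity to a neighbourhood.\<close>

lemma inversion_pos_near_0:
  assumes "\<And>u. 0 < Re (char M u)"
  obtains e where "0 < e" "\<And>y. \<bar>y\<bar> < e \<Longrightarrow> 0 < Re (inversion y)"
proof -
  have intRe: "integrable lborel (\<lambda>u. Re (char M u))" using int by (rule integrable_Re)
  have "inversion 0 = (LINT u|lborel. char M u)" by (simp add: inversion_def)
  then have eq: "Re (inversion 0) = (LINT u|lborel. Re (char M u))" using int by simp
  have "Re (inversion 0) \<noteq> 0"
  proof
    assume "Re (inversion 0) = 0"
    then have "AE u in lborel. Re (char M u) = 0"
      using integral_nonneg_eq_0_iff_AE[OF intRe] assms unfolding eq by (simp add: less_imp_le)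
    then have "AE u in lborel :: real measure. False"
      by eventually_elim (use assms less_irrefl in metis)
    then have "(UNIV :: real set) \<in> null_sets lborel"
      by (simp add: AE_iff_null)
    then have "emeasure lborel (UNIV :: real set) = 0" by (rule null_setsD1)
    then show False by (simp only: emeasure_lborel_UNIV) simp
  qed
  moreover have "0 \<le> Re (inversion 0)"
    unfolding eq using assms by (intro integral_nonneg_AE) (simp add: less_imp_le)
  ultimately have pos: "0 < Re (inversion 0)" by simp
  have "isCont (\<lambda>y. Re (inversion y)) 0"
    using tendsto_Re[OF isCont_inversion[of 0, unfolded isCont_def]] by (simp add: isCont_def)
  then have "((\<lambda>y. Re (inversion y)) \<longlongrightarrow> Re (inversion 0)) (nhds 0)"
    using tendsto_at_iff_tendsto_nhds[of "\<lambda>y. Re (inversion y)" 0] by (simp only: isCont_def)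
  then have "eventually (\<lambda>y. 0 < Re (inversion y)) (nhds 0)"
    using pos by (rule order_tendstoD(1))
  then obtain e where "0 < e" "\<And>y. dist y 0 < e \<Longrightarrow> 0 < Re (inversion y)"
    by (auto simp: eventually_nhds_metric)
  then show ?thesis using that by auto
qed

end

end

subsection \<open>Hitting points under integrability of the resolvent\<close>

lemma (in real_distribution) char_uminus: "char M (- t) = cnj (char M t)"
  unfolding char_def by (simp add: exp_cnj Bochner_Integration.integral_cnj[symmetric] del: Bochner_Integration.integral_cnj)

text \<open>Conjugate symmetry reflects the bound on the half-line to negative frequencies.\<close>

lemma (in real_distribution) integrable_char_half:
  assumes "(\<integral>\<^sup>+u\<in>{0..}. ennreal (cmod (char M u)) \<partial>lborel) < \<infinity>"
  shows "integrable lborel (char M)"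
proof (rule integrableI_bounded)
  let ?f = "\<lambda>u. ennreal (cmod (char M u)) * indicator {0..} u"
  have "(\<integral>\<^sup>+u. ennreal (cmod (char M u)) \<partial>lborel) \<le> (\<integral>\<^sup>+u. ?f u + ?f (0 + - 1 * u) \<partial>lborel)"
    by (rule nn_integral_mono) (auto simp: char_uminus indicator_def)
  also have "\<dots> = (\<integral>\<^sup>+u. ?f u \<partial>lborel) + (\<integral>\<^sup>+u. ?f (0 + - 1 * u) \<partial>lborel)"
    by (rule nn_integral_add) auto
  also have "(\<integral>\<^sup>+u. ?f (0 + - 1 * u) \<partial>lborel) = (\<integral>\<^sup>+u. ?f u \<partial>lborel)"
    by (subst nn_integral_real_affine[where c="- 1" and t=0 and f="?f"]) auto
  finally show "(\<integral>\<^sup>+u. ennreal (cmod (char M u)) \<partial>lborel) < \<infinity>"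
    using assms by (auto simp: le_less_trans)
qed simp

context levy_process
begin

lemma real_distribution_potential: "real_distribution potential"
  using prob_space_potential by (simp add: real_distribution_def real_distribution_axioms_def)

lemma integral_law_exponent:
  assumes "characteristic_exponent P X \<Psi>" "0 \<le> t"
  shows "(LINT w|law 0. iexp (\<xi> * w t)) = exp (- (of_real t * \<Psi> \<xi>))"
proof -
  have [measurable]: "(\<lambda>w. w t) \<in> borel_measurable (law 0)"
    using measurable_coordinate measurable_cong_sets[OF sets_law refl] by blast
  have "(LINT w|levy_law P X 0. iexp (\<xi> * w t)) = (LINT w|law 0. iexp (\<xi> * w t))"
    unfolding levy_law_eq by (rule integral_completion) measurable
  then show ?thesis using assms by (simp add: characteristic_exponent_def)
qed

lemma Re_exponent_nonneg:
  assumes "characteristic_exponent P X \<Psi>"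
  shows "0 \<le> Re (\<Psi> \<xi>)"
proof -
  have "cmod (LINT w|law 0. iexp (\<xi> * w 1)) \<le> (LINT w|law 0. cmod (iexp (\<xi> * w 1)))"
    by (rule integral_norm_bound)
  also have "\<dots> = 1" using law.prob_space by simp
  finally show ?thesis
    using integral_law_exponent[OF assms, of 1 \<xi>] by simp
qed

text \<open>Fubini and the Laplace transform of the exponential law, available because
  characteristic functions are bounded by 1 and so \<open>0 \<le> Re (\<Psi> \<xi>)\<close>.\<close>

lemma char_potential:
  assumes "characteristic_exponent P X \<Psi>"
  shows "char potential \<xi> = 1 / (1 + \<Psi> \<xi>)"
proof -
  interpret pair_prob_space expo "law 0" by (rule pair_prob_space_expo)
  note [measurable] = measurable_joint_eval_law
  have int: "integrable (expo \<Otimes>\<^sub>M law 0) (\<lambda>z. iexp (\<xi> * (\<lambda>(t, w). w (max 0 t)) z))"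
    by (rule P.integrable_const_bound[of _ 1]) (simp, measurable)
  have "char potential \<xi> = (LINT z|(expo \<Otimes>\<^sub>M law 0). iexp (\<xi> * (\<lambda>(t, w). w (max 0 t)) z))"
    unfolding char_def potential_def by (rule integral_distr) measurable
  also have "\<dots> = (LINT t|expo. LINT w|law 0. iexp (\<xi> * w (max 0 t)))"
    using integral_fst'[OF int] by simp
  also have "\<dots> = (LINT t|expo. exp (- (of_real (max 0 t) * \<Psi> \<xi>)))"
    by (simp only: integral_law_exponent[OF assms max.cobounded1])
  also have "\<dots> = 1 / (1 + \<Psi> \<xi>)"
    by (rule integral_expo_exp[OF Re_exponent_nonneg[OF assms]])
  finally show ?thesis .
qed

text \<open>In the normalisation of \<open>gauss\<close>, the kernel at \<open>y\<close> has a
  potential tending to \<open>u > 0\<close>, and at most \<open>C\<close> from any starting point.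
  With \<open>near {y} m\<close> as target, \<open>potential_le\<close> gives
  \<open>u \<le> (Pr 0 (E N m) + exp (- N)) * C\<close> as \<open>s\<close> grows. Since
  \<open>u\<close> and \<open>C\<close> are independent of \<open>m\<close>, this survives the
  intersection over \<open>m\<close>.\<close>

lemma hit_small_pos:
  assumes \<Psi>: "characteristic_exponent P X \<Psi>"
    and fin: "(\<integral>\<^sup>+ \<xi> \<in> {0..}. ennreal (cmod (1 / (1 + \<Psi> \<xi>))) \<partial>lborel) < \<infinity>"
  obtains e where "0 < e"
    "\<And>y. \<bar>y\<bar> < e \<Longrightarrow> 0 < Pr 0 (finite_time (reg_hit {y}))"
proof -
  interpret U: real_distribution potential by (rule real_distribution_potential)
  have int: "integrable lborel (char potential)"
    by (rule U.integrable_char_half) (use fin in \<open>simp add: char_potential[OF \<Psi>]\<close>)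
  have Re_pos: "0 < Re (char potential u)" for u
  proof -
    have "1 + \<Psi> u \<noteq> 0" "0 < Re (1 + \<Psi> u)"
      using Re_exponent_nonneg[OF \<Psi>, of u] by (auto simp: complex_eq_iff)
    then show ?thesis
      unfolding char_potential[OF \<Psi>] by (simp add: Re_divide' cmod_def Re_divide add_pos_nonneg sum_power2_gt_zero_iff complex_eq_iff)
  qed
  obtain e where e: "0 < e" "\<And>y. \<bar>y\<bar> < e \<Longrightarrow> 0 < Re (U.inversion y)"
    using U.inversion_pos_near_0[OF int Re_pos] by blast
  have "0 < Pr 0 (finite_time (reg_hit {y}))" if "\<bar>y\<bar> < e" for y
  proof -
    define C where "C = (LINT u|lborel. cmod (char potential u))"
    define u where "u = Re (U.inversion y)"
    have "0 < u" using e(2)[OF that] by (simp add: u_def)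
    have "0 \<le> C" unfolding C_def by (rule integral_nonneg_AE) simp
    define E where "E N m = {w\<in>paths. hit (near {y} m) w < ereal N}" for N m
    have E_sets: "E N m \<in> sets (law 0)" for N m
      unfolding E_def using sets_optional_less[OF optional_hit_open[OF open_near]] by simp
    have bound: "u \<le> (Pr 0 (E N m) + exp (- N)) * C" if N: "0 \<le> N" for N m
    proof -
      \<comment> \<open>Radius of the neighbourhood; outside it the kernel is at most
        \<open>exp (- (s * a)^2 / 2)\<close>.\<close>
      define a where "a = 1 / real (Suc m)"
      have "0 < a" by (simp add: a_def)
      let ?b = "(Pr 0 (E N m) + exp (- N)) * C"
      have fin_n: "sqrt (2 * pi) * s * U.gauss s y \<le> sqrt (2 * pi) * s * exp (- (s * a)\<^sup>2 / 2) + ?b"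
        if s: "0 < s" for s
      proof -
        let ?g = "\<lambda>z x. ennreal (exp (- (s * (x - z))\<^sup>2 / 2))"
        define K where "K = C / (sqrt (2 * pi) * s)"
        have "0 \<le> K" using \<open>0 \<le> C\<close> s by (simp add: K_def)
        have g: "(\<integral>\<^sup>+x. ?g z x \<partial>potential) = ennreal (U.gauss s z)" for z
          unfolding U.gauss_def
          by (rule nn_integral_eq_integral) (auto intro!: U.integrable_const_bound[of _ 1])
        have "(\<integral>\<^sup>+x. ?g y x \<partial>potential) \<le> ennreal (exp (- (s * a)\<^sup>2 / 2)) +
            ePr 0 {w\<in>paths. hit (near {y} m) w < ereal N} * ennreal K + ennreal (exp (- N)) * ennreal K"
        proof (rule potential_le[OF _ open_near N])
          show "?g y \<in> borel_measurable borel" by measurable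
          fix z assume "z \<notin> near {y} m"
          then have "a \<le> \<bar>z - y\<bar>" by (simp add: near_def a_def dist_real_def)
          then have "(s * a)\<^sup>2 \<le> (s * (z - y))\<^sup>2"
            using s \<open>0 < a\<close> by (intro abs_le_square_iff[THEN iffD1]) (auto simp: abs_mult)
          then show "?g y z \<le> ennreal (exp (- (s * a)\<^sup>2 / 2))"
            by (intro ennreal_leI) simp
        next
          fix z
          have "(\<integral>\<^sup>+x. ?g y (z + x) \<partial>potential) = (\<integral>\<^sup>+x. ?g (y - z) x \<partial>potential)"
            by (simp add: algebra_simps)
          also have "\<dots> \<le> ennreal K"
            unfolding g K_def using U.gauss_le[OF int s, of "y - z"] s
            by (intro ennreal_leI) (simp add: C_def field_simps)
          finally show "(\<integral>\<^sup>+x. ?g y (z + x) \<partial>potential) \<le> ennreal K" .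
        qed
        then have "ennreal (U.gauss s y) \<le> ennreal (exp (- (s * a)\<^sup>2 / 2) + Pr 0 (E N m) * K + exp (- N) * K)"
          using \<open>0 \<le> K\<close> unfolding g E_def[symmetric] law.emeasure_eq_measure
          by (simp add: ennreal_mult[symmetric] ennreal_plus[symmetric] del: ennreal_plus)
        then have "U.gauss s y \<le> exp (- (s * a)\<^sup>2 / 2) + Pr 0 (E N m) * K + exp (- N) * K"
          using \<open>0 \<le> K\<close> by (subst (asm) ennreal_le_iff) (auto intro!: add_nonneg_nonneg)
        then have "sqrt (2 * pi) * s * U.gauss s y \<le> sqrt (2 * pi) * s * (exp (- (s * a)\<^sup>2 / 2) + Pr 0 (E N m) * K + exp (- N) * K)"
          using s by (intro mult_left_mono) auto
        also have "\<dots> = sqrt (2 * pi) * s * exp (- (s * a)\<^sup>2 / 2) + (Pr 0 (E N m) + exp (- N)) * (sqrt (2 * pi) * s * K)"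
          by (simp add: algebra_simps)
        also have "sqrt (2 * pi) * s * K = C" using s by (simp add: K_def)
        finally show ?thesis .
      qed
      \<comment> \<open>The part outside the neighbourhood decays like \<open>1 / s\<close>, from
        \<open>v \<le> exp v\<close> with \<open>v = (s * a)^2 / 2\<close>.\<close>
      have small: "sqrt (2 * pi) * s * exp (- (s * a)\<^sup>2 / 2) \<le> sqrt (2 * pi) * (2 / a\<^sup>2) * (1 / s)" if s: "0 < s" for s
      proof -
        have "1 + (s * a)\<^sup>2 / 2 \<le> exp ((s * a)\<^sup>2 / 2)" by (rule exp_ge_add_one_self)
        then have "(s * a)\<^sup>2 / 2 \<le> exp ((s * a)\<^sup>2 / 2)" by linarith
        then have "exp (- (s * a)\<^sup>2 / 2) \<le> 1 / ((s * a)\<^sup>2 / 2)"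
          using s \<open>0 < a\<close> by (simp add: exp_minus field_simps)
        then have "s * exp (- (s * a)\<^sup>2 / 2) \<le> s * (1 / ((s * a)\<^sup>2 / 2))"
          using s by (intro mult_left_mono) auto
        also have "\<dots> = 2 / a\<^sup>2 * (1 / s)" using s \<open>0 < a\<close> by (simp add: power2_eq_square field_simps)
        finally have "sqrt (2 * pi) * (s * exp (- (s * a)\<^sup>2 / 2)) \<le> sqrt (2 * pi) * (2 / a\<^sup>2 * (1 / s))"
          by (rule mult_left_mono) simp
        then show ?thesis by (simp only: mult.assoc)
      qed
      have "(\<lambda>n. sqrt (2 * pi) * (2 / a\<^sup>2) * (1 / real (Suc n)) + ?b) \<longlonglongrightarrow>
          sqrt (2 * pi) * (2 / a\<^sup>2) * 0 + ?b"
        by (intro tendsto_intros LIMSEQ_Suc[OF lim_1_over_n])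
      then have "(\<lambda>n. sqrt (2 * pi) * (2 / a\<^sup>2) * (1 / real (Suc n)) + ?b) \<longlonglongrightarrow>
          ?b" by simp
      from U.gauss_tendsto[OF int] this show ?thesis
        unfolding u_def
      proof (rule LIMSEQ_le, intro exI[of _ 0] allI impI)
        fix n :: nat
        show "sqrt (2 * pi) * real (Suc n) * U.gauss (real (Suc n)) y \<le>
          sqrt (2 * pi) * (2 / a\<^sup>2) * (1 / real (Suc n)) + ?b"
          using fin_n[of "real (Suc n)"] small[of "real (Suc n)"] by simp
      qed
    qed
    have "C \<noteq> 0" using bound[of 0 0] \<open>0 < u\<close> by auto
    then have "0 < C" using \<open>0 \<le> C\<close> by simp
    \<comment> \<open>The late part is limited to half of \<open>u\<close>; the other half bounds
      the probability of a hit before \<open>N\<close> from below.\<close>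
    obtain N where N: "0 \<le> N" "exp (- N) * C \<le> u / 2"
    proof
      show "0 \<le> max 0 (- ln (u / (2 * C)))" by simp
      have "exp (- max 0 (- ln (u / (2 * C)))) \<le> exp (ln (u / (2 * C)))" by simp
      also have "\<dots> = u / (2 * C)" using \<open>0 < u\<close> \<open>0 < C\<close> by simp
      finally show "exp (- max 0 (- ln (u / (2 * C)))) * C \<le> u / 2"
        using \<open>0 < C\<close> by (simp add: field_simps)
    qed
    have low: "u / (2 * C) \<le> Pr 0 (E N m)" for m
      using bound[OF N(1), of m] N(2) \<open>0 < C\<close> by (simp add: field_simps)
    have "(\<lambda>m. Pr 0 (E N m)) \<longlonglongrightarrow> Pr 0 (\<Inter>m. E N m)"
    proof (rule law.finite_Lim_measure_decseq)
      show "decseq (E N)"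
        unfolding E_def using le_less_trans[OF incseq_SucD[OF incseq_hit_near]]
        by (intro decseq_SucI) blast
    qed (use E_sets in auto)
    then have "u / (2 * C) \<le> Pr 0 (\<Inter>m. E N m)"
      by (rule LIMSEQ_le_const) (use low in auto)
    also have "\<dots> \<le> Pr 0 (finite_time (reg_hit {y}))"
    proof (rule law.finite_measure_mono)
      show "finite_time (reg_hit {y}) \<in> sets (law 0)"
        using sets_optional_finite[OF optional_reg_hit] by simp
      show "(\<Inter>m. E N m) \<subseteq> finite_time (reg_hit {y})"
      proof
        fix w assume w: "w \<in> (\<Inter>m. E N m)"
        then have "reg_hit {y} w \<le> ereal N"
          unfolding reg_hit_def by (intro SUP_least) (auto simp: E_def intro: less_imp_le)
        then have "reg_hit {y} w < \<infinity>" by (auto intro: le_less_trans)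
        then show "w \<in> finite_time (reg_hit {y})" using w by (auto simp: E_def)
      qed
    qed
    finally show ?thesis using \<open>0 < u\<close> \<open>0 < C\<close> by (meson divide_pos_pos less_le_trans mult_pos_pos zero_less_numeral)
  qed
  then show ?thesis using e(1) that by blast
qed

lemma reg_hit_translate: "reg_hit {x + y} (\<lambda>t\<in>{0..}. x + w t) = reg_hit {y} w"
proof -
  have "hit (near {x + y} m) (\<lambda>t\<in>{0..}. x + w t) = hit (near {y} m) w" for m
    unfolding hit_def by (rule INF_cong) (auto simp: near_def dist_real_def)
  then show ?thesis by (simp add: reg_hit_def)
qed

text \<open>The way from \<open>x\<close> to \<open>y\<close> is cut into \<open>k\<close> steps
  shorter than \<open>e\<close>. Each endpoint is reached from the preceding one with positive
  probability, and the strong Markov property multiplies these.\<close>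

lemma hit_pos:
  assumes \<Psi>: "characteristic_exponent P X \<Psi>"
    and fin: "(\<integral>\<^sup>+ \<xi> \<in> {0..}. ennreal (cmod (1 / (1 + \<Psi> \<xi>))) \<partial>lborel) < \<infinity>"
  shows "0 < Pr x (finite_time (reg_hit {y}))"
proof -
  have E: "finite_time (reg_hit {y}) \<in> sets path_space" for y
    by (rule sets_optional_finite[OF optional_reg_hit])
  obtain e where e: "0 < e"
    "\<And>y. \<bar>y\<bar> < e \<Longrightarrow> 0 < Pr 0 (finite_time (reg_hit {y}))"
    using hit_small_pos[OF assms] by blast
  have near: "0 < Pr x {w\<in>paths. reg_hit {x + d} w < \<infinity>}" if "\<bar>d\<bar> < e" for x d
  proof -
    have "ePr x {w\<in>paths. reg_hit {x + d} w < \<infinity>} =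
      ePr 0 {w\<in>paths. (\<lambda>t\<in>{0..}. x + w t) \<in> {w\<in>paths. reg_hit {x + d} w < \<infinity>}}"
      using emeasure_law_translate[OF E[of "x + d"], of 0 x] by simp
    also have "{w\<in>paths. (\<lambda>t\<in>{0..}. x + w t) \<in> {w\<in>paths. reg_hit {x + d} w < \<infinity>}} =
      finite_time (reg_hit {d})"
      by (auto simp: reg_hit_translate space_path_space cadlag_add_const)
    finally show ?thesis using e(2)[OF that] by (simp add: measure_def)
  qed
  obtain k :: nat where k: "\<bar>y - x\<bar> / e < real k" using reals_Archimedean2 by blast
  then have "0 < real k" using e(1) by (meson abs_ge_zero divide_nonneg_pos le_less_trans)
  then have "0 < k" by simp
  define d where "d = (y - x) / real k"
  have d: "\<bar>d\<bar> < e" using k \<open>0 < k\<close> e(1) by (simp add: d_def field_simps)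
  have "0 < Pr x {w\<in>paths. reg_hit {x + real j * d} w < \<infinity>}" for j
  proof (induction j)
    case 0
    show ?case using near[of 0 x] e(1) by simp
  next
    case (Suc j)
    define y' where "y' = x + real j * d"
    let ?T = "reg_hit {y'}"
    let ?F = "stopped_at ?T y'"
    let ?E = "{w\<in>paths. reg_hit {y' + d} w < \<infinity>}"
    have F: "?F \<in> sets path_space"
      using sets_stopped_at[OF optional_reg_hit, of "{y'}"] by simp
    have "Pr x (finite_time ?T) = Pr x ?F"
      using AE_reg_hit_attained_singleton[of y' x] F E by (intro law.finite_measure_eq_AE) auto
    then have "0 < Pr x ?F * Pr y' ?E"
      using Suc near[OF d, of y'] by (simp add: y'_def)
    also have "\<dots> = Pr x {w\<in>paths. ?T w < \<infinity> \<and> value_at ?T w = y' \<and> shift_at ?T w \<in> ?E}"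
      by (rule measure_strong_markov[OF optional_reg_hit E, symmetric])
    also have "\<dots> \<le> Pr x ?E"
    proof (rule law.finite_measure_mono)
      show "{w\<in>paths. ?T w < \<infinity> \<and> value_at ?T w = y' \<and> shift_at ?T w \<in> ?E} \<subseteq> ?E"
      proof
        fix w assume w: "w \<in> {w\<in>paths. ?T w < \<infinity> \<and> value_at ?T w = y' \<and> shift_at ?T w \<in> ?E}"
        have "reg_hit {y' + d} w \<le> ereal (real_of_ereal (?T w)) + reg_hit {y' + d} (shift_at ?T w)"
          by (rule reg_hit_shift_le) (simp add: real_of_ereal_pos reg_hit_nonneg)
        also have "\<dots> < \<infinity>" using w by (cases "reg_hit {y' + d} (shift_at ?T w)") auto
        finally show "w \<in> ?E" using w by simp
      qed
    qed (use E in simp)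
    finally show ?case by (simp add: y'_def algebra_simps)
  qed
  from this[of k] show ?thesis using \<open>0 < k\<close> by (simp add: d_def)
qed

end

subsection \<open>The hitting matrix\<close>

context levy_process
begin

text \<open>Moving the starting point changes the absolute value of the position by at most
  \<open>\<bar>x\<bar>\<close>.\<close>

lemma AE_transient:
  assumes "transient P X"
  shows "AE w in law x. filterlim (\<lambda>t. \<bar>w t\<bar>) at_top at_top"
proof -
  have "AE w in law 0. filterlim (\<lambda>t. \<bar>w t\<bar>) at_top at_top"
    using assms unfolding transient_def levy_law_eq AE_completion_iff .
  then have "AE w in distr (law x) path_space (\<lambda>w. \<lambda>t\<in>{0..}. 0 - x + w t). filterlim (\<lambda>t. \<bar>w t\<bar>) at_top at_top"
    unfolding law_translate[of 0 x, symmetric] .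
  then have "AE w in law x. filterlim (\<lambda>t. \<bar>(\<lambda>t\<in>{0..}. 0 - x + w t) t\<bar>) at_top at_top"
  proof (rule AE_distrD[rotated])
    show "(\<lambda>w. \<lambda>t\<in>{0..}. 0 - x + w t) \<in> law x \<rightarrow>\<^sub>M path_space"
      using measurable_translate measurable_cong_sets[OF sets_law refl] by blast
  qed
  then show ?thesis
  proof eventually_elim
    case (elim w)
    show ?case
      unfolding filterlim_at_top
    proof
      fix Z :: real
      have "eventually (\<lambda>t. Z + \<bar>x\<bar> \<le> \<bar>(\<lambda>t\<in>{0..}. 0 - x + w t) t\<bar>) at_top"
        using elim by (simp only: filterlim_at_top)
      then show "eventually (\<lambda>t. Z \<le> \<bar>w t\<bar>) at_top"
        using eventually_ge_at_top[of 0]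
      proof eventually_elim
        case (elim t)
        then have "Z + \<bar>x\<bar> \<le> \<bar>w t - x\<bar>" by simp
        then show ?case using abs_triangle_ineq4[of "w t" x] by linarith
      qed
    qed
  qed
qed

text \<open>Removing the point \<open>x\<close> from \<open>S\<close> and decomposing at the first hit of the remaining
  points expresses row \<open>x\<close> through the other rows, except for the diagonal entry, where the
  return probability appears instead of \<open>1\<close>.\<close>

lemma hit_before_independent:
  assumes S: "finite S" "q \<notin> S" and zero: "\<And>y. y \<in> S \<Longrightarrow> (\<Sum>b\<in>S. c b * hit_before b q y) = 0"
    and leave: "\<And>x. (AE w in law x. filterlim (\<lambda>t. \<bar>w t\<bar>) at_top at_top) \<or>
      0 < Pr x (finite_time (reg_hit {q}))"
    and x: "x \<in> S"
  shows "c x = 0"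
proof -
  have one: "hit_before x q x = 1" using S(2) x by (intro hit_before_start) auto
  define S' where "S' = S - {x}"
  define B where "B = insert q S'"
  have B: "finite B" "q \<in> B" "x \<notin> B" using S x by (auto simp: B_def S'_def)
  have split: "(\<Sum>b\<in>S. f b) = f x + (\<Sum>b\<in>S'. f b)" for f :: "real \<Rightarrow> real"
    unfolding S'_def by (rule sum.remove[OF S(1) x])
  \<comment> \<open>At \<open>y = q\<close> both sides vanish by \<open>hit_before_self\<close>; at
    the other points this is \<open>zero\<close> with the summand of \<open>x\<close> moved
    across.\<close>
  have rest: "(\<Sum>b\<in>S'. c b * hit_before b q y) = - (c x * hit_before x q y)" if "y \<in> B" for y
  proof (cases "y = q")
    case True
    then show ?thesis by (simp add: hit_before_self)
  next
    case False
    then have "y \<in> S" using that by (auto simp: B_def S'_def)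
    from zero[OF this] show ?thesis unfolding split by simp
  qed
  have "(\<Sum>b\<in>S'. c b * hit_before b q x) = (\<Sum>b\<in>S'. c b * (\<Sum>y\<in>B. first_hit B y x * hit_before b q y))"
    using hit_before_decomposition[OF B(1) _ B(2), of _ x] by (intro sum.cong) (auto simp: B_def)
  also have "\<dots> = (\<Sum>y\<in>B. first_hit B y x * (\<Sum>b\<in>S'. c b * hit_before b q y))"
    unfolding sum_distrib_left by (subst sum.swap) (simp add: mult_ac)
  also have "\<dots> = - c x * (\<Sum>y\<in>B. first_hit B y x * hit_before x q y)"
    using rest by (simp add: sum_distrib_left sum_negf mult_ac cong: sum.cong)
  \<comment> \<open>Comparison with \<open>zero\<close> at \<open>x\<close> itself, where the
    diagonal entry is 1.\<close>
  finally have "c x * (1 - (\<Sum>y\<in>B. first_hit B y x * hit_before x q y)) = 0"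
    using zero[OF x] one unfolding split by (simp add: algebra_simps)
  then show ?thesis
    using return_not_sure[OF B leave] by simp
qed

lemma hitting_matrix_carrier: "hitting_matrix P X n a \<in> carrier_mat (n - 1) (n - 1)"
  by (simp add: hitting_matrix_def)

text \<open>A zero determinant gives a nonzero vector in the kernel of the transpose, hence a
  vanishing combination of rows, which \<open>hit_before_independent\<close> forbids.\<close>

lemma det_hitting_matrix:
  assumes inj: "inj_on a {1..n}" and n: "2 \<le> n"
    and leave: "\<And>x. (AE w in law x. filterlim (\<lambda>t. \<bar>w t\<bar>) at_top at_top) \<or>
      0 < Pr x {w\<in>paths. reg_hit {a n} w < \<infinity>}"
  shows "Determinant.det (hitting_matrix P X n a) \<noteq> 0"
proof
  let ?M = "hitting_matrix P X n a"
  have carrier: "transpose_mat ?M \<in> carrier_mat (n - 1) (n - 1)"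
    using hitting_matrix_carrier[of n a] unfolding transpose_carrier_mat .
  assume "Determinant.det ?M = 0"
  then have "Determinant.det (transpose_mat ?M) = 0"
    using det_transpose[OF hitting_matrix_carrier] by simp
  then obtain v where v: "v \<in> carrier_vec (n - 1)" "v \<noteq> 0\<^sub>v (n - 1)" "transpose_mat ?M *\<^sub>v v = 0\<^sub>v (n - 1)"
    using det_0_iff_vec_prod_zero_field[OF carrier] by blast
  define p where "p k = a (Suc k)" for k
  have inj_p: "inj_on p {..<n - 1}"
  proof (rule inj_onI)
    fix i j assume "i \<in> {..<n - 1}" "j \<in> {..<n - 1}" "p i = p j"
    then show "i = j" using inj_onD[OF inj, of "Suc i" "Suc j"] by (simp add: p_def)
  qed
  \<comment> \<open>Coefficients are carried from indices to points, which is consistent because the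
    points are distinct.\<close>
  define c where "c b = vec_index v (the_inv_into {..<n - 1} p b)" for b
  have c: "c (p k) = vec_index v k" if "k < n - 1" for k
    using that the_inv_into_f_f[OF inj_p, of k] by (simp add: c_def)
  have "vec_index v k = 0" if k: "k < n - 1" for k
  proof -
    have "c (p k) = 0"
    proof (rule hit_before_independent[where S="p ` {..<n - 1}" and q="a n" and c=c])
      show "a n \<notin> p ` {..<n - 1}"
      proof
        assume "a n \<in> p ` {..<n - 1}"
        then obtain k where "k < n - 1" "a n = a (Suc k)" by (auto simp: p_def)
        moreover from this have "Suc k < n" by simp
        ultimately show False using inj_onD[OF inj, of n "Suc k"] by simp
      qed
      fix y assume "y \<in> p ` {..<n - 1}"
      then obtain l where l: "l < n - 1" "y = p l" by auto
      have "(\<Sum>b\<in>p ` {..<n - 1}. c b * hit_before b (a n) y) = (\<Sum>k<n - 1. c (p k) * hit_before (p k) (a n) (p l))"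
        unfolding l(2) by (subst sum.reindex[OF inj_p]) simp
      also have "\<dots> = vec_index (transpose_mat ?M *\<^sub>v v) l"
        using l v(1) c
        by (simp add: hitting_matrix_def levy_prob_hit_less scalar_prod_def p_def mult.commute lessThan_atLeast0 carrier_vecD)
      finally show "(\<Sum>b\<in>p ` {..<n - 1}. c b * hit_before b (a n) y) = 0"
        using l by (simp add: v(3))
    qed (use leave k in auto)
    then show ?thesis using c[OF k] by simp
  qed
  then have "v = 0\<^sub>v (n - 1)" using carrier_vecD[OF v(1)] by (intro eq_vecI) simp_all
  then show False using v(2) by blast
qed

text \<open>Decomposition at the first hit of the whole set; the summand of the last point
  \<open>a n\<close> vanishes by \<open>hit_before_self\<close>.\<close>

lemma hitting_matrix_mult_first_hit:
  assumes inj: "inj_on a {1..n}" and n: "2 \<le> n"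
  shows "hitting_matrix P X n a *\<^sub>v Matrix.vec (n - 1) (\<lambda>k. first_hit (a ` {1..n}) (a (Suc k)) x) =
    Matrix.vec (n - 1) (\<lambda>k. hit_before (a (Suc k)) (a n) x)"
proof (rule eq_vecI)
  fix k assume "k < dim_vec (Matrix.vec (n - 1) (\<lambda>k. hit_before (a (Suc k)) (a n) x))"
  then have k: "k < n - 1" by simp
  let ?B = "a ` {1..n}"
  have B: "finite ?B" "a (Suc k) \<in> ?B" "a n \<in> ?B" using k n by auto
  have "{1..n} = insert n (Suc ` {..<n - 1})"
    using n unfolding image_Suc_lessThan by auto
  then have "hit_before (a (Suc k)) (a n) x = (\<Sum>i\<in>insert n (Suc ` {..<n - 1}). first_hit ?B (a i) x * hit_before (a (Suc k)) (a n) (a i))"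
    unfolding hit_before_decomposition[OF B, of x] by (subst sum.reindex[OF inj]) simp
  also have "\<dots> = (\<Sum>l<n - 1. first_hit ?B (a (Suc l)) x * hit_before (a (Suc k)) (a n) (a (Suc l)))"
    by (subst sum.insert) (auto simp: hit_before_self sum.reindex)
  finally show "vec_index (hitting_matrix P X n a *\<^sub>v Matrix.vec (n - 1) (\<lambda>k. first_hit ?B (a (Suc k)) x)) k =
      vec_index (Matrix.vec (n - 1) (\<lambda>k. hit_before (a (Suc k)) (a n) x)) k"
    using k by (simp add: hitting_matrix_def levy_prob_hit_less scalar_prod_def lessThan_atLeast0 mult.commute)
qed (simp add: hitting_matrix_def)

end

theorem theorem1p2:
  fixes P :: "'w measure" and X :: "real \<Rightarrow> 'w \<Rightarrow> real"
    and \<Psi> :: "real \<Rightarrow> complex" and n :: nat and a :: "nat \<Rightarrow> real"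
  assumes "levy_process P X"
    and "characteristic_exponent P X \<Psi>"
    and "(recurrent P X \<and>
            (\<forall>q::real. q > 0 \<longrightarrow>
               (\<integral>\<^sup>+ \<xi> \<in> {0..}. ennreal (cmod (1 / (of_real q + \<Psi> \<xi>))) \<partial>lborel) < \<infinity>))
         \<or> (transient P X \<and> \<not> compound_poisson P X \<and> regular_for_itself P X)"
    and "n \<ge> 2"
    and "inj_on a {1..n}"
  shows "invertible_mat (hitting_matrix P X n a) \<and>
    (\<forall>x::real.
       Matrix.vec (n - 1)
         (\<lambda>k. levy_prob P X x (\<lambda>w. hit {a (Suc k)} w = hit (a ` {1..n}) w \<and>
                                     hit (a ` {1..n}) w < \<infinity>))
       = the (mat_inverse (hitting_matrix P X n a)) *\<^sub>v
         Matrix.vec (n - 1) (\<lambda>k. levy_prob P X x (\<lambda>w. hit {a (Suc k)} w < hit {a n} w)))"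
proof -
  interpret levy_process P X by (rule assms(1))
  let ?M = "hitting_matrix P X n a"
  have leave: "(AE w in law x. filterlim (\<lambda>t. \<bar>w t\<bar>) at_top at_top) \<or>
      0 < Pr x {w\<in>paths. reg_hit {a n} w < \<infinity>}" for x
    using assms(3)
  proof
    assume "recurrent P X \<and> (\<forall>q::real. q > 0 \<longrightarrow>
               (\<integral>\<^sup>+ \<xi> \<in> {0..}. ennreal (cmod (1 / (of_real q + \<Psi> \<xi>))) \<partial>lborel) < \<infinity>)"
    \<comment> \<open>The instance \<open>q = 1\<close> matches the rate of the exponential
      discount.\<close>
    from this[THEN conjunct2, rule_format, of 1]
    have "(\<integral>\<^sup>+ \<xi> \<in> {0..}. ennreal (cmod (1 / (1 + \<Psi> \<xi>))) \<partial>lborel) < \<infinity>"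
      by (simp only: of_real_1 zero_less_one simp_thms)
    then show ?thesis by (intro disjI2 hit_pos[OF assms(2)])
  next
    assume "transient P X \<and> \<not> compound_poisson P X \<and> regular_for_itself P X"
    then show ?thesis using AE_transient[of x] by (intro disjI1) (elim conjE)
  qed
  have M: "?M \<in> carrier_mat (n - 1) (n - 1)" by (rule hitting_matrix_carrier)
  \<comment> \<open>\<open>mat_inverse\<close> yields \<open>None\<close> for singular matrices, so
    being a unit is what gives \<open>the\<close> its meaning.\<close>
  have "?M \<in> Units (ring_mat TYPE(real) (n - 1) ())"
    by (rule det_non_zero_imp_unit[OF M det_hitting_matrix[OF assms(5,4) leave]])
  then obtain N where N: "mat_inverse ?M = Some N"
    using mat_inverse(1)[OF M, of "()"] by (cases "mat_inverse ?M") auto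
  then have inv: "?M * N = 1\<^sub>m (n - 1)" "N * ?M = 1\<^sub>m (n - 1)" "N \<in> carrier_mat (n - 1) (n - 1)"
    using mat_inverse(2)[OF M] by auto
  have "invertible_mat ?M"
    unfolding invertible_mat_def inverts_mat_def using M inv by (auto intro!: exI[of _ N])
  moreover have "Matrix.vec (n - 1) (\<lambda>k. levy_prob P X x (\<lambda>w. hit {a (Suc k)} w = hit (a ` {1..n}) w \<and> hit (a ` {1..n}) w < \<infinity>))
       = the (mat_inverse ?M) *\<^sub>v Matrix.vec (n - 1) (\<lambda>k. levy_prob P X x (\<lambda>w. hit {a (Suc k)} w < hit {a n} w))" for x
  proof -
    let ?q = "Matrix.vec (n - 1) (\<lambda>k. first_hit (a ` {1..n}) (a (Suc k)) x)"
    have "N *\<^sub>v (?M *\<^sub>v ?q) = (N * ?M) *\<^sub>v ?q"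
      by (rule assoc_mult_mat_vec[OF inv(3) M, symmetric]) simp
    also have "\<dots> = ?q" unfolding inv(2) by (rule one_mult_mat_vec) simp
    finally have "?q = N *\<^sub>v Matrix.vec (n - 1) (\<lambda>k. hit_before (a (Suc k)) (a n) x)"
      unfolding hitting_matrix_mult_first_hit[OF assms(5,4)] by simp
    moreover have "Matrix.vec (n - 1) (\<lambda>k. levy_prob P X x (\<lambda>w. hit {a (Suc k)} w = hit (a ` {1..n}) w \<and> hit (a ` {1..n}) w < \<infinity>)) = ?q"
    proof (rule eq_vecI)
      fix k assume "k < dim_vec ?q"
      then have k: "k < n - 1" by simp
      then have "a (Suc k) \<in> a ` {1..n}" by (intro imageI) simp
      from levy_prob_hit_first[OF finite_imageI[OF finite_atLeastAtMost] this, of x]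
      show "vec_index (Matrix.vec (n - 1) (\<lambda>k. levy_prob P X x (\<lambda>w. hit {a (Suc k)} w = hit (a ` {1..n}) w \<and> hit (a ` {1..n}) w < \<infinity>))) k = vec_index ?q k"
        unfolding index_vec[OF k] .
    qed simp
    ultimately show ?thesis by (simp add: N levy_prob_hit_less)
  qed
  ultimately show ?thesis by blast
qed

end
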